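(* Let $b>0$. Let $f\in C(\mathbb{R})$ be strictly increasing with $f(0)=0$ and $f(s)\to\pm\infty$ as $s\to\pm\infty$. Let $g\in C(\mathbb{R})$ be positive and such that $|s|^{\alpha}g(s)\to C_{g\pm}$ as $s\to\pm\infty$ for some exponent $\alpha>2$ and constants $C_{g+},C_{g-}>0$. Consider the problem $$u_t-f(g(u_x)u_{xx})=0 \text{ in } (-b,b)\times(0,\infty),\qquad \lim_{x\to\pm b}u(x,t)=\infty \text{ for any } t>0,\qquad u(\cdot,0)=u_0 \text{ in } (-b,b). \quad (P)$$ (1) If $u_0\in C((-b,b))$ satisfies $$\lim_{x\to\pm b}u_0(x)=\infty,\quad \limsup_{x\to b}u_0(x)(b-x)^{\gamma}<\infty,\quad \limsup_{x\to -b}u_0(x)(b+x)^{\gamma}<\infty$$ for some $\gamma>0$, then there exists a viscosity solution $u:(-b,b)\times[0,\infty)\to\mathbb{R}$ of $(P)$. (2) If $u_0\in C((-b,b))$ satisfies $$\lim_{x\to b}\bigl(u_0(x)-D_+\psi_{\gamma_+}(b-x)\bigr)=\hat C_+,\qquad \lim_{x\to -b}\bigl(u_0(x)-D_-\psi_{\gamma_-}(b+x)\bigr)=\hat C_-$$ for some constants $\gamma_\pm\ge 0$, $D_\pm>0$ and $\hat C_\pm\in\mathbb{R}$, then the viscosity solution of $(P)$ is continuous and unique.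
   Context: For $\gamma\ge 0$ and $s>0$: $\psi_\gamma(s)=s^{-\gamma}$ if $\gamma>0$, and $\psi_0(s)=-\log s$. Let $Q=(-b,b)\times(0,\infty)$, $Q_0=(-b,b)\times[0,\infty)$ and $F(p,z)=-f(g(p)z)$ for $p,z\in\mathbb{R}$. For a function $u$ on $Q_0$, its upper and lower semicontinuous envelopes are $u^*(x,t)=\lim_{r\to+0}\sup\{u(y,s):(y,s)\in Q_0\cap B_r((x,t))\}$ and $u_*(x,t)=\lim_{r\to+0}\inf\{u(y,s):(y,s)\in Q_0\cap B_r((x,t))\}$, for $(x,t)\in\overline{Q}$. An upper semicontinuous function $u$ in $Q_0$ is a sub-solution (of the equation with the singular boundary condition) if whenever $(x_0,t_0)\in Q$ and $\phi\in C^2(Q)$ are such that $u-\phi$ attains a local maximum at $(x_0,t_0)$, one has $\phi_t(x_0,t_0)+F(\phi_x(x_0,t_0),\phi_{xx}(x_0,t_0))\le 0$. A lower semicontinuous function $u$ in $Q_0$ is a super-solution if (i) whenever $(x_0,t_0)\in Q$ and $\phi\in C^2(Q)$ are such that $u-\phi$ attains a local minimum at $(x_0,t_0)$, one has $\phi_t(x_0,t_0)+F(\phi_x(x_0,t_0),\phi_{xx}(x_0,t_0))\ge 0$; and (ii) $\lim_{x\to\pm b}u(x,t)=\infty$ for any $t>0$. A function $u$ defined in $Q_0$ is a viscosity solution of $(P)$ if $u^*$ is a sub-solution, $u_*$ is a super-solution, and $u^*(\cdot,0)=u_*(\cdot,0)=u_0$ in $(-b,b)$. *)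

theory Defs
  imports "HOL-Analysis.Analysis"
begin

text \<open>Points of the space-time domain are pairs \<open>(x, t) :: real \<times> real\<close>; functions on
  \<open>Q0 b\<close> are total functions of which only the values on \<open>Q0 b\<close> are ever used.\<close>

definition psi :: "real \<Rightarrow> real \<Rightarrow> real" where
  "psi \<gamma> s = (if \<gamma> > 0 then s powr (-\<gamma>) else - ln s)"

definition Q :: "real \<Rightarrow> (real \<times> real) set" where
  "Q b = {-b<..<b} \<times> {0<..}"

definition Q0 :: "real \<Rightarrow> (real \<times> real) set" where
  "Q0 b = {-b<..<b} \<times> {0..}"

definition F :: "(real \<Rightarrow> real) \<Rightarrow> (real \<Rightarrow> real) \<Rightarrow> real \<Rightarrow> real \<Rightarrow> real" where
  "F f g p z = - f (g p * z)"

definition upper_env :: "real \<Rightarrow> (real \<times> real \<Rightarrow> real) \<Rightarrow> real \<times> real \<Rightarrow> ereal" where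
  "upper_env b u z = Lim (at_right 0) (\<lambda>r. SUP p \<in> Q0 b \<inter> ball z r. ereal (u p))"

definition lower_env :: "real \<Rightarrow> (real \<times> real \<Rightarrow> real) \<Rightarrow> real \<times> real \<Rightarrow> ereal" where
  "lower_env b u z = Lim (at_right 0) (\<lambda>r. INF p \<in> Q0 b \<inter> ball z r. ereal (u p))"

definition usc_on :: "'a::topological_space set \<Rightarrow> ('a \<Rightarrow> real) \<Rightarrow> bool" where
  "usc_on S u \<longleftrightarrow> (\<forall>a. openin (top_of_set S) {p \<in> S. u p < a})"

definition lsc_on :: "'a::topological_space set \<Rightarrow> ('a \<Rightarrow> real) \<Rightarrow> bool" where
  "lsc_on S u \<longleftrightarrow> (\<forall>a. openin (top_of_set S) {p \<in> S. u p > a})"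

definition has_partials_on ::
    "(real \<times> real) set \<Rightarrow> (real \<times> real \<Rightarrow> real) \<Rightarrow> (real \<times> real \<Rightarrow> real) \<Rightarrow> (real \<times> real \<Rightarrow> real) \<Rightarrow> bool"
  where
  "has_partials_on S \<phi> \<phi>x \<phi>t \<longleftrightarrow> (\<forall>(x, t) \<in> S.
     ((\<lambda>y. \<phi> (y, t)) has_real_derivative \<phi>x (x, t)) (at x) \<and>
     ((\<lambda>s. \<phi> (x, s)) has_real_derivative \<phi>t (x, t)) (at t))"

text \<open>Used only for open \<open>S\<close>.\<close>

definition C2_on :: "(real \<times> real) set \<Rightarrow> (real \<times> real \<Rightarrow> real) \<Rightarrow> bool" where
  "C2_on S \<phi> \<longleftrightarrow> (\<exists>\<phi>x \<phi>t \<phi>xx \<phi>xt \<phi>tx \<phi>tt.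
     has_partials_on S \<phi> \<phi>x \<phi>t \<and> has_partials_on S \<phi>x \<phi>xx \<phi>xt \<and> has_partials_on S \<phi>t \<phi>tx \<phi>tt \<and>
     (\<forall>h \<in> {\<phi>, \<phi>x, \<phi>t, \<phi>xx, \<phi>xt, \<phi>tx, \<phi>tt}. continuous_on S h))"

definition d_t :: "(real \<times> real \<Rightarrow> real) \<Rightarrow> real \<times> real \<Rightarrow> real" where
  "d_t \<phi> = (\<lambda>(x, t). deriv (\<lambda>s. \<phi> (x, s)) t)"

definition d_x :: "(real \<times> real \<Rightarrow> real) \<Rightarrow> real \<times> real \<Rightarrow> real" where
  "d_x \<phi> = (\<lambda>(x, t). deriv (\<lambda>y. \<phi> (y, t)) x)"

definition sub_solution ::
    "real \<Rightarrow> (real \<Rightarrow> real) \<Rightarrow> (real \<Rightarrow> real) \<Rightarrow> (real \<times> real \<Rightarrow> real) \<Rightarrow> bool" where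
  "sub_solution b f g u \<longleftrightarrow> usc_on (Q0 b) u \<and>
     (\<forall>z \<in> Q b. \<forall>\<phi>. C2_on (Q b) \<phi> \<longrightarrow>
        (\<forall>\<^sub>F p in nhds z. u p - \<phi> p \<le> u z - \<phi> z) \<longrightarrow>
        d_t \<phi> z + F f g (d_x \<phi> z) (d_x (d_x \<phi>) z) \<le> 0)"

definition super_solution ::
    "real \<Rightarrow> (real \<Rightarrow> real) \<Rightarrow> (real \<Rightarrow> real) \<Rightarrow> (real \<times> real \<Rightarrow> real) \<Rightarrow> bool" where
  "super_solution b f g u \<longleftrightarrow> lsc_on (Q0 b) u \<and>
     (\<forall>z \<in> Q b. \<forall>\<phi>. C2_on (Q b) \<phi> \<longrightarrow>
        (\<forall>\<^sub>F p in nhds z. u p - \<phi> p \<ge> u z - \<phi> z) \<longrightarrow>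
        d_t \<phi> z + F f g (d_x \<phi> z) (d_x (d_x \<phi>) z) \<ge> 0) \<and>
     (\<forall>t>0. filterlim (\<lambda>x. u (x, t)) at_top (at_left b) \<and>
            filterlim (\<lambda>x. u (x, t)) at_top (at_right (-b)))"

text \<open>Sub- and super-solutions are real-valued functions on \<open>Q0 b\<close>, so the requirement that
  the envelopes (a priori extended-real-valued) be a sub- and a super-solution includes that
  they are finite on \<open>Q0 b\<close>.\<close>

definition viscosity_solution ::
    "real \<Rightarrow> (real \<Rightarrow> real) \<Rightarrow> (real \<Rightarrow> real) \<Rightarrow> (real \<Rightarrow> real) \<Rightarrow> (real \<times> real \<Rightarrow> real) \<Rightarrow> bool" where
  "viscosity_solution b f g u0 u \<longleftrightarrow>
     (\<forall>z \<in> Q0 b. \<bar>upper_env b u z\<bar> \<noteq> \<infinity> \<and> \<bar>lower_env b u z\<bar> \<noteq> \<infinity>) \<and>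
     sub_solution b f g (\<lambda>z. real_of_ereal (upper_env b u z)) \<and>
     super_solution b f g (\<lambda>z. real_of_ereal (lower_env b u z)) \<and>
     (\<forall>x \<in> {-b<..<b}. upper_env b u (x, 0) = ereal (u0 x) \<and> lower_env b u (x, 0) = ereal (u0 x))"

end

theory Submission
  imports Defs
begin

text \<open>
  Existence is Perron's method with the classical majorant \<open>K (b\<^sup>2 - x\<^sup>2)\<^sup>-\<^sup>\<nu> + C t\<close>, whose speed is bounded
  because steep graphs hardly move. Affine functions are stationary, so the affine functions below
  \<open>u0\<close> lie below the Perron solution and make it blow up at \<open>\<plusminus>b\<close>; local parabolas give the initial values.

  For uniqueness it suffices that the upper envelope of one solution lies below the lower envelope of
  another. Near \<open>\<plusminus>b\<close> both keep the asymptotics of \<open>u0\<close>: barriers that become singular inside the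
  domain need no lateral boundary data, and \<open>\<alpha> > 2\<close> makes them almost stationary. In the interior the
  equation is solved approximately by an implicit time scheme on \<open>[l, r]\<close> with lateral values constant in
  time. Every time step is a two-point boundary value problem for an ordinary differential equation,
  solved by shooting, so the iterates are twice differentiable in \<open>x\<close>; their Lipschitz constant does not increase,
  which makes the degeneracy of \<open>g\<close> at infinity harmless. As the iterates are smooth in \<open>x\<close>, a sub- or
  supersolution can be compared with them by doubling the time variable only, and no theorem on sums
  is needed.
\<close>

section \<open>Semicontinuity, jets and comparison with classical barriers\<close>

text \<open>The scheme is used at a fixed step size. A sub- and a supersolution are compared with
  the same iterates, and the error depends on the iterates only through a speed bound
  \<open>C\<close> that is independent of the step size and of the residual. The parameters can
  therefore be chosen in the order polynomial data, \<open>C\<close>, \<open>\<sigma>\<close>,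
  \<open>\<delta>\<close>, \<open>\<epsilon>\<close>, \<open>h\<close>.

  Everything that is used for testing, barriers as well as iterates with a time penalty, has the
  form \<open>A x + B t\<close>. Hence jets without a mixed term suffice, and a general C2 test
  function is reduced to such a jet by completing a square. The sign change that turns
  supersolutions into subsolutions of a reflected equation lets every comparison be proved once.

  Existence rests on bounds that hold for each member of the Perron family separately; this is why
  the growth bound of part (1) is enough there. The full expansion of \<open>u0\<close>, including
  its constant term, enters only when two solutions have to be tied to the same values near
  \<open>\<plusminus>b\<close>.\<close>

lemma usc_on_iff:
  fixes u :: "'a::metric_space \<Rightarrow> real"
  shows "usc_on S u \<longleftrightarrow> (\<forall>z\<in>S. \<forall>e>0. \<exists>d>0. \<forall>y\<in>S. dist y z < d \<longrightarrow> u y < u z + e)"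
proof
  assume L: "usc_on S u"
  show "\<forall>z\<in>S. \<forall>e>0. \<exists>d>0. \<forall>y\<in>S. dist y z < d \<longrightarrow> u y < u z + e"
  proof (intro ballI allI impI)
    fix z and e :: real
    assume z: "z \<in> S" "e > 0"
    have "openin (top_of_set S) {p \<in> S. u p < u z + e}" using L unfolding usc_on_def by blast
    then show "\<exists>d>0. \<forall>y\<in>S. dist y z < d \<longrightarrow> u y < u z + e"
      unfolding openin_euclidean_subtopology_iff using z by fastforce
  qed
next
  assume R: "\<forall>z\<in>S. \<forall>e>0. \<exists>d>0. \<forall>y\<in>S. dist y z < d \<longrightarrow> u y < u z + e"
  show "usc_on S u"
    unfolding usc_on_def openin_euclidean_subtopology_iff
  proof (intro allI conjI ballI)
    fix a x assume "x \<in> {p \<in> S. u p < a}"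
    then have x: "x \<in> S" "a - u x > 0" by auto
    then obtain d where "d > 0" "\<forall>y\<in>S. dist y x < d \<longrightarrow> u y < u x + (a - u x)" using R by blast
    then show "\<exists>e>0. \<forall>x'\<in>S. dist x' x < e \<longrightarrow> x' \<in> {p \<in> S. u p < a}" by auto
  qed auto
qed

lemma usc_onD:
  fixes u :: "'a::metric_space \<Rightarrow> real"
  assumes "usc_on S u" "z \<in> S" "e > 0"
  obtains d where "d > 0" "\<And>y. y \<in> S \<Longrightarrow> dist y z < d \<Longrightarrow> u y < u z + e"
  using assms unfolding usc_on_iff by blast

lemma lsc_on_iff_usc: "lsc_on S u \<longleftrightarrow> usc_on S (\<lambda>z. - u z)"
proof -
  have "(\<forall>a. openin (top_of_set S) {p \<in> S. u p > a}) \<longleftrightarrow> (\<forall>a. openin (top_of_set S) {p \<in> S. u p > - a})"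
    by (metis minus_minus)
  moreover have "\<And>a. {p \<in> S. u p > - a} = {p \<in> S. - u p < a}" by auto
  ultimately show ?thesis by (simp add: lsc_on_def usc_on_def)
qed

lemma usc_on_subset:
  fixes u :: "'a::metric_space \<Rightarrow> real"
  shows "usc_on S u \<Longrightarrow> T \<subseteq> S \<Longrightarrow> usc_on T u"
  unfolding usc_on_iff by (meson subsetD)

lemma usc_on_diff_continuous:
  fixes u :: "'a::metric_space \<Rightarrow> real"
  assumes "usc_on S u" "continuous_on S \<phi>"
  shows "usc_on S (\<lambda>z. u z - \<phi> z)"
  unfolding usc_on_iff
proof (intro ballI allI impI)
  fix z and e :: real
  assume z: "z \<in> S" "e > 0"
  then obtain d where d: "d > 0" "\<And>y. y \<in> S \<Longrightarrow> dist y z < d \<Longrightarrow> u y < u z + e/2"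
    using usc_onD[OF assms(1), of z "e/2"] by auto
  obtain d' where d': "d' > 0" "\<And>y. y \<in> S \<Longrightarrow> dist y z < d' \<Longrightarrow> dist (\<phi> y) (\<phi> z) < e/2"
    using assms(2) z unfolding continuous_on_iff by (metis half_gt_zero)
  show "\<exists>d>0. \<forall>y\<in>S. dist y z < d \<longrightarrow> u y - \<phi> y < u z - \<phi> z + e"
  proof (intro exI[of _ "min d d'"] conjI ballI impI)
    fix y assume y: "y \<in> S" "dist y z < min d d'"
    have "u y < u z + e/2" "dist (\<phi> y) (\<phi> z) < e/2" using y d d' by auto
    then show "u y - \<phi> y < u z - \<phi> z + e" unfolding dist_real_def by linarith
  qed (use d d' in auto)
qed

text \<open>If no value were maximal, the relatively open sets on which \<open>u\<close> is below
  \<open>u y\<close>, for \<open>y\<close> in \<open>K\<close>, would cover \<open>K\<close>. The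
  centre with the largest value in a finite subcover lies in none of its sets.\<close>

lemma usc_attains_max:
  fixes u :: "'a::metric_space \<Rightarrow> real"
  assumes "compact K" "K \<noteq> {}" "usc_on K u"
  obtains z where "z \<in> K" "\<And>y. y \<in> K \<Longrightarrow> u y \<le> u z"
proof (rule ccontr)
  assume neg: "\<not> thesis"
  have op: "\<And>y. openin (top_of_set K) {p \<in> K. u p < u y}" using assms(3) unfolding usc_on_def by blast
  have "\<forall>y. \<exists>T. open T \<and> {p \<in> K. u p < u y} = K \<inter> T" using op unfolding openin_open by blast
  then obtain T where T: "\<And>y. open (T y)" "\<And>y. {p \<in> K. u p < u y} = K \<inter> T y" by metis
  have "K \<subseteq> (\<Union>y\<in>K. T y)"
  proof
    fix z assume z: "z \<in> K"
    have "\<exists>y\<in>K. u z < u y" using neg that z by (meson not_le)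
    then obtain y where "y \<in> K" "u z < u y" by blast
    then show "z \<in> (\<Union>y\<in>K. T y)" using T(2)[of y] z by blast
  qed
  then obtain C where C: "C \<subseteq> K" "finite C" "K \<subseteq> (\<Union>y\<in>C. T y)"
    using compactE_image[OF assms(1), of K T] T(1) by blast
  then have "C \<noteq> {}" using assms(2) by auto
  then have "Max (u ` C) \<in> u ` C" using C(2) by (intro Max_in) auto
  then obtain y where y: "y \<in> C" "u y = Max (u ` C)" by auto
  then have "y \<in> K" using C by auto
  then obtain y' where y': "y' \<in> C" "y \<in> T y'" using C by blast
  then have "u y < u y'" using T(2)[of y'] \<open>y \<in> K\<close> by blast
  moreover have "u y' \<le> u y" using y y' C by simp
  ultimately show False by simp
qed

lemma usc_bounded_above:
  fixes u :: "'a::metric_space \<Rightarrow> real"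
  assumes "compact K" "usc_on K u"
  obtains M where "\<And>y. y \<in> K \<Longrightarrow> u y \<le> M"
proof (cases "K = {}")
  case True
  then show ?thesis using that[of 0] by auto
next
  case False
  then show ?thesis using usc_attains_max[OF assms(1) False assms(2)] that by metis
qed

text \<open>Subsolutions tested by second order jets without mixed term. A supersolution \<open>v\<close> for \<open>f, g\<close> is
  treated as the subsolution \<open>-v\<close> for \<open>\<lambda>s. - f (- s)\<close> and \<open>\<lambda>p. g (- p)\<close>.\<close>

definition jet_sub :: "real \<Rightarrow> (real \<Rightarrow> real) \<Rightarrow> (real \<Rightarrow> real) \<Rightarrow> (real \<times> real \<Rightarrow> real) \<Rightarrow> bool" where
  "jet_sub b f g u \<longleftrightarrow> (\<forall>z\<in>Q b. \<forall>\<tau> p X c.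
     (\<forall>\<^sub>F y in nhds z. u y \<le> u z + \<tau> * (snd y - snd z) + p * (fst y - fst z)
        + X/2 * (fst y - fst z)^2 + c * (snd y - snd z)^2)
     \<longrightarrow> \<tau> \<le> f (g p * X))"

section \<open>Test functions of the form \<open>A x + B t\<close>\<close>

lemma eventually_nhds_fst: "eventually P (nhds (fst z)) \<Longrightarrow> \<forall>\<^sub>F y in nhds z. P (fst y)"
  by (rule eventually_compose_filterlim[OF _ tendsto_fst]) (auto simp: tendsto_def eventually_nhds)

lemma eventually_nhds_snd: "eventually P (nhds (snd z)) \<Longrightarrow> \<forall>\<^sub>F y in nhds z. P (snd y)"
  by (rule eventually_compose_filterlim[OF _ tendsto_snd]) (auto simp: tendsto_def eventually_nhds)

text \<open>The second derivative is assumed at \<open>x0\<close> only, so there is no remainder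
  formula. With the slack \<open>e\<close> the difference of the two sides has a derivative of sign
  opposite to \<open>x - x0\<close>, hence it peaks at \<open>x0\<close>.\<close>

lemma taylor2_upper:
  fixes A A1 :: "real \<Rightarrow> real"
  assumes A: "\<forall>\<^sub>F x in nhds x0. (A has_real_derivative A1 x) (at x)"
    and A1: "(A1 has_real_derivative A2) (at x0)" and e: "e > 0"
  shows "\<forall>\<^sub>F x in nhds x0. A x \<le> A x0 + A1 x0 * (x - x0) + (A2 + e)/2 * (x - x0)^2"
proof -
  obtain d1 where d1: "d1 > 0" "\<And>x. dist x x0 < d1 \<Longrightarrow> (A has_real_derivative A1 x) (at x)"
    using A unfolding eventually_nhds_metric by blast
  have "(A1 has_derivative (\<lambda>h. h * A2)) (at x0)"
    using A1 unfolding has_field_derivative_def by (simp add: mult.commute[of _ A2])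
  then obtain d2 where d2: "d2 > 0" "\<And>y. norm (y - x0) < d2 \<Longrightarrow> norm (A1 y - A1 x0 - (y - x0) * A2) \<le> e * norm (y - x0)"
    unfolding has_derivative_at_alt using e by blast
  define D where "D x = A x - A1 x0 * (x - x0) - (A2 + e)/2 * (x - x0)^2" for x
  define d where "d = min d1 d2"
  have D: "(D has_real_derivative (A1 x - A1 x0 - (A2 + e) * (x - x0))) (at x)" if "dist x x0 < d" for x
    unfolding D_def using d1(2)[of x] that d_def
    by (auto intro!: derivative_eq_intros simp: field_simps)
  have est: "\<bar>A1 x - A1 x0 - (x - x0) * A2\<bar> \<le> e * \<bar>x - x0\<bar>" if "dist x x0 < d" for x
    using d2(2)[of x] that by (auto simp: d_def dist_real_def)
  have "D x \<le> D x0" if x: "dist x x0 < d" for x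
  proof (cases "x \<ge> x0")
    case True
    show ?thesis
    proof (rule DERIV_nonpos_imp_nonincreasing[OF True])
      fix y assume y: "x0 \<le> y" "y \<le> x"
      then have dy: "dist y x0 < d" using x by (auto simp: dist_real_def)
      have "A1 y - A1 x0 - (A2 + e) * (y - x0) \<le> 0" using est[OF dy] y by (simp add: algebra_simps abs_le_iff)
      then show "\<exists>y'. DERIV D y :> y' \<and> y' \<le> 0" using D[OF dy] by blast
    qed
  next
    case False
    then have "x \<le> x0" by simp
    then show ?thesis
    proof (rule DERIV_nonneg_imp_nondecreasing)
      fix y assume y: "x \<le> y" "y \<le> x0"
      then have dy: "dist y x0 < d" using x by (auto simp: dist_real_def)
      have "A1 y - A1 x0 - (A2 + e) * (y - x0) \<ge> 0" using est[OF dy] y by (simp add: algebra_simps abs_le_iff)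
      then show "\<exists>y'. DERIV D y :> y' \<and> y' \<ge> 0" using D[OF dy] by blast
    qed
  qed
  then have "\<forall>x. dist x x0 < d \<longrightarrow> A x \<le> A x0 + A1 x0 * (x - x0) + (A2 + e)/2 * (x - x0)^2"
    by (auto simp: D_def algebra_simps)
  moreover have "d > 0" using d1 d2 d_def by auto
  ultimately show ?thesis unfolding eventually_nhds_metric by blast
qed

text \<open>Testing with \<open>X + e\<close> and letting \<open>e\<close> tend to 0 absorbs the
  slack of Taylor estimates and of maxima made strict.\<close>

lemma le_isCont_limit:
  fixes f :: "real \<Rightarrow> real"
  assumes "isCont f (a * X)" "\<And>e. e > 0 \<Longrightarrow> \<tau> \<le> f (a * (X + e))"
  shows "\<tau> \<le> f (a * X)"
proof (rule tendsto_lowerbound)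
  have "((\<lambda>e. a * (X + e)) \<longlongrightarrow> a * (X + 0)) (at_right 0)" by (intro tendsto_intros)
  then show "((\<lambda>e. f (a * (X + e))) \<longlongrightarrow> f (a * X)) (at_right 0)"
    using isCont_tendsto_compose[OF assms(1)] by simp
  show "\<forall>\<^sub>F e in at_right 0. \<tau> \<le> f (a * (X + e))"
    using assms(2) by (auto simp: eventually_at_right_less eventually_at_filter)
qed auto

text \<open>\<open>A\<close> and \<open>B\<close> are dominated by their Taylor parabolas with slack
  \<open>e\<close>; the sum of these parabolas has no mixed term, so \<open>jet_sub\<close> applies
  to it directly.\<close>

lemma jet_sub_separated:
  assumes u: "jet_sub b f g u" and f: "continuous_on UNIV f" and z: "(x0, t0) \<in> Q b"
    and max: "\<forall>\<^sub>F y in nhds (x0, t0). u y - A (fst y) - B (snd y) \<le> u (x0, t0) - A x0 - B t0"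
    and A: "\<forall>\<^sub>F x in nhds x0. (A has_real_derivative A1 x) (at x)"
    and A1: "(A1 has_real_derivative A2) (at x0)"
    and B: "\<forall>\<^sub>F t in nhds t0. (B has_real_derivative B1 t) (at t)"
    and B1: "(B1 has_real_derivative B2) (at t0)"
  shows "B1 t0 \<le> f (g (A1 x0) * A2)"
proof (rule le_isCont_limit)
  show "isCont f (g (A1 x0) * A2)" using f by (simp add: continuous_on_eq_continuous_at)
  fix e :: real assume e: "e > 0"
  have 1: "\<forall>\<^sub>F y in nhds (x0, t0). A (fst y) \<le> A x0 + A1 x0 * (fst y - x0) + (A2 + e)/2 * (fst y - x0)^2"
    using eventually_nhds_fst[of _ "(x0, t0)"] taylor2_upper[OF A A1 e] by simp
  have 2: "\<forall>\<^sub>F y in nhds (x0, t0). B (snd y) \<le> B t0 + B1 t0 * (snd y - t0) + (B2 + e)/2 * (snd y - t0)^2"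
    using eventually_nhds_snd[of _ "(x0, t0)"] taylor2_upper[OF B B1 e] by simp
  have "\<forall>\<^sub>F y in nhds (x0, t0). u y \<le> u (x0, t0) + B1 t0 * (snd y - t0) + A1 x0 * (fst y - x0)
        + (A2 + e)/2 * (fst y - x0)^2 + (B2 + e)/2 * (snd y - t0)^2"
    using 1 2 max by eventually_elim (auto simp: algebra_simps)
  then show "B1 t0 \<le> f (g (A1 x0) * (A2 + e))"
    using u[unfolded jet_sub_def, rule_format, OF z, of "B1 t0" "A1 x0" "A2 + e" "(B2 + e)/2"] by simp
qed

lemma Q_subset_Q0: "Q b \<subseteq> Q0 b"
  by (auto simp: Q_def Q0_def)

lemma interior_maximum:
  fixes l r T :: real
  assumes "l < x0" "x0 < r" "t1 < t0" "t0 < T"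
    and "\<And>x t. l \<le> x \<Longrightarrow> x \<le> r \<Longrightarrow> t1 \<le> t \<Longrightarrow> t \<le> T \<Longrightarrow> P (x, t)"
  shows "\<forall>\<^sub>F y in nhds (x0, t0). P y"
proof -
  have "open ({l<..<r} \<times> {t1<..<T})" by (intro open_Times) auto
  moreover have "(x0, t0) \<in> {l<..<r} \<times> {t1<..<T}" using assms by auto
  ultimately have "\<forall>\<^sub>F y in nhds (x0, t0). y \<in> {l<..<r} \<times> {t1<..<T}" by (rule eventually_nhds_in_open)
  then show ?thesis by eventually_elim (use assms(5) in auto)
qed

text \<open>The penalty \<open>\<sigma> / (T - t)\<close> keeps the maximum of the difference away
  from time \<open>T\<close>, and its derivative makes the inequality at the maximum strict: a
  quantity bounded by \<open>\<delta>\<close> would have to be at least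
  \<open>\<delta> + \<sigma> / (T - t0)^2\<close>. The barrier lives on \<open>[l, r]\<close> only,
  which allows profiles that are singular just beyond \<open>r\<close>.\<close>

lemma jet_sub_le_barrier:
  assumes u: "jet_sub b f g u" "usc_on (Q0 b) u" and f: "continuous_on UNIV f"
    and lr: "-b < l" "l \<le> r" "r < b" and t1: "0 \<le> t1"
    and Ac: "continuous_on {l..r} A"
    and A: "\<And>x. l < x \<Longrightarrow> x < r \<Longrightarrow> (A has_real_derivative A1 x) (at x)"
    and A1: "\<And>x. l < x \<Longrightarrow> x < r \<Longrightarrow> (A1 has_real_derivative A2 x) (at x)"
    and super: "\<And>x. l < x \<Longrightarrow> x < r \<Longrightarrow> f (g (A1 x) * A2 x) \<le> \<delta>"
    and init: "\<And>x. l \<le> x \<Longrightarrow> x \<le> r \<Longrightarrow> u (x, t1) \<le> A x"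
    and lat: "\<And>t. t1 \<le> t \<Longrightarrow> t < T \<Longrightarrow> u (l, t) \<le> A l + \<delta> * (t - t1)"
             "\<And>t. t1 \<le> t \<Longrightarrow> t < T \<Longrightarrow> u (r, t) \<le> A r + \<delta> * (t - t1)"
    and xt: "l \<le> x" "x \<le> r" "t1 \<le> t" "t < T"
  shows "u (x, t) \<le> A x + \<delta> * (t - t1)"
proof (rule ccontr)
  assume neg: "\<not> ?thesis"
  define m where "m = u (x, t) - A x - \<delta> * (t - t1)"
  have m: "m > 0" using neg by (simp add: m_def)
  \<comment> \<open>With this \<open>\<sigma>\<close> the penalty at \<open>(x, t)\<close> costs
    exactly \<open>m / 2\<close>, half of the assumed violation.\<close>
  define \<sigma> where "\<sigma> = m / 2 * (T - t)"
  have \<sigma>: "\<sigma> > 0" using m xt by (simp add: \<sigma>_def)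
  define B where "B s = \<delta> * (s - t1) + \<sigma> / (T - s)" for s
  define \<Psi> where "\<Psi> y = u y - (A (fst y) + B (snd y))" for y
  have K0: "{l..r} \<times> {t1..T'} \<subseteq> Q0 b" for T' using lr t1 by (auto simp: Q0_def)
  have Ccont: "continuous_on ({l..r} \<times> S) (\<lambda>y. A (fst y))" for S :: "real set"
    by (rule continuous_on_compose2[OF Ac]) (auto intro!: continuous_intros)
  have "usc_on ({l..r} \<times> {t1..T}) (\<lambda>y. u y - (A (fst y) + \<delta> * (snd y - t1)))"
    by (intro usc_on_diff_continuous usc_on_subset[OF u(2) K0] continuous_intros Ccont)
  moreover have "compact ({l..r} \<times> {t1..T})" by (intro compact_Times) auto
  ultimately obtain M where M: "\<And>y. y \<in> {l..r} \<times> {t1..T} \<Longrightarrow> u y - (A (fst y) + \<delta> * (snd y - t1)) \<le> M"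
    using usc_bounded_above by blast
  define M' where "M' = max M 1"
  \<comment> \<open>Between \<open>T'\<close> and \<open>T\<close> the penalty is at least
    \<open>M'\<close>, so the penalised difference is not positive there; its maximum over the
    compact slab is then a maximum over all times below \<open>T\<close>.\<close>
  define T' where "T' = max t (T - \<sigma> / M')"
  have M': "M' > 0" "M \<le> M'" by (auto simp: M'_def)
  have T': "t \<le> T'" "T' < T" "T - T' \<le> \<sigma> / M'" using \<sigma> M' xt by (auto simp: T'_def)
  have "usc_on ({l..r} \<times> {t1..T'}) \<Psi>"
    unfolding \<Psi>_def B_def
    by (intro usc_on_diff_continuous usc_on_subset[OF u(2) K0] continuous_intros Ccont) (use T' in auto)
  moreover have "compact ({l..r} \<times> {t1..T'})" by (intro compact_Times) auto
  moreover have "{l..r} \<times> {t1..T'} \<noteq> {}" using xt T' by auto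
  ultimately obtain z where z: "z \<in> {l..r} \<times> {t1..T'}" and zm: "\<And>y. y \<in> {l..r} \<times> {t1..T'} \<Longrightarrow> \<Psi> y \<le> \<Psi> z"
    by (metis usc_attains_max)
  obtain x0 t0 where z0: "z = (x0, t0)" by fastforce
  have x0: "l \<le> x0" "x0 \<le> r" "t1 \<le> t0" "t0 \<le> T'" using z z0 by auto
  have \<Psi>xt: "\<Psi> (x, t) = m / 2" using xt by (simp add: \<Psi>_def B_def m_def \<sigma>_def field_simps)
  have "\<Psi> (x, t) \<le> \<Psi> z" using zm xt T' by auto
  then have pos: "\<Psi> (x0, t0) > 0" using \<Psi>xt m z0 by simp
  have zm': "\<Psi> y \<le> \<Psi> (x0, t0)" if "y \<in> {l..r} \<times> {t1..<T}" for y
  proof (cases "snd y \<le> T'")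
    case True
    then show ?thesis using zm that z0 by force
  next
    case False
    then have s: "snd y > T'" "snd y < T" using that by auto
    then have "T - snd y \<le> \<sigma> / M'" "T - snd y > 0" using T' by auto
    then have "\<sigma> / (T - snd y) \<ge> M'" using M' by (simp add: field_simps)
    moreover have "u y - (A (fst y) + \<delta> * (snd y - t1)) \<le> M" using M that by force
    ultimately have "\<Psi> y \<le> 0" using M' by (simp add: \<Psi>_def B_def)
    then show ?thesis using pos by simp
  qed
  have posT: "\<sigma> / (T - t0) > 0" using \<sigma> T' x0 by simp
  have upos: "u (x0, t0) > A x0 + \<delta> * (t0 - t1)" using pos posT by (simp add: \<Psi>_def B_def)
  have "x0 \<noteq> l" "x0 \<noteq> r" using lat[of t0] upos x0 T' by auto
  moreover have "t0 \<noteq> t1" using init[of x0] upos x0 by auto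
  ultimately have int: "l < x0" "x0 < r" "t1 < t0" "t0 < T" using x0 T' by auto
  have zQ: "(x0, t0) \<in> Q b" using int lr t1 by (auto simp: Q_def)
  have "\<delta> + \<sigma> / (T - t0)^2 \<le> f (g (A1 x0) * A2 x0)"
  proof (rule jet_sub_separated[OF u(1) f zQ, where A = A and B = B and ?B1.0 = "\<lambda>s. \<delta> + \<sigma> / (T - s)^2"
        and ?B2.0 = "2 * \<sigma> / (T - t0)^3"])
    have "t0 < (t0 + T)/2" "(t0 + T)/2 < T" using int by auto
    then show "\<forall>\<^sub>F y in nhds (x0, t0). u y - A (fst y) - B (snd y) \<le> u (x0, t0) - A x0 - B t0"
      using zm' by (intro interior_maximum[OF int(1-3), of "(t0 + T)/2"]) (auto simp: \<Psi>_def algebra_simps)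
    have "\<forall>\<^sub>F x in nhds x0. x \<in> {l<..<r}" using int by (intro eventually_nhds_in_open) auto
    then show "\<forall>\<^sub>F x in nhds x0. (A has_real_derivative A1 x) (at x)"
      by eventually_elim (use A in auto)
    show "(A1 has_real_derivative A2 x0) (at x0)" using A1 int by auto
    have "\<forall>\<^sub>F s in nhds t0. s \<in> {..<T}" using int by (intro eventually_nhds_in_open) auto
    then show "\<forall>\<^sub>F s in nhds t0. (B has_real_derivative (\<delta> + \<sigma> / (T - s)^2)) (at s)"
      unfolding B_def
      by eventually_elim (auto intro!: derivative_eq_intros simp: power2_eq_square field_simps)
    show "((\<lambda>s. \<delta> + \<sigma> / (T - s)^2) has_real_derivative 2 * \<sigma> / (T - t0)^3) (at t0)"
    proof -
      define y where "y = T - t0"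
      have y: "y \<noteq> 0" using int by (simp add: y_def)
      have "((\<lambda>s. \<delta> + \<sigma> / (T - s)^2) has_real_derivative (- (\<sigma> * (2 * (y * - 1)))) / (y^2 * y^2)) (at t0)"
        using y unfolding y_def by (auto intro!: derivative_eq_intros)
      moreover have "(- (\<sigma> * (2 * (y * - 1)))) / (y^2 * y^2) = 2 * \<sigma> / y^3"
        using y by (simp add: field_simps power2_eq_square power3_eq_cube)
      ultimately show ?thesis by (simp only: y_def)
    qed
  qed
  moreover have "\<sigma> / (T - t0)^2 > 0" using \<sigma> int by simp
  ultimately show False using super[OF int(1,2)] by simp
qed

section \<open>Shooting for a two-point boundary value problem\<close>

locale shooting =
  fixes l r A LH LN :: real and H :: "real \<Rightarrow> real" and N :: "real \<Rightarrow> real \<Rightarrow> real"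
  assumes lr: "l < r"
    and LH: "\<And>p q. \<bar>H p - H q\<bar> \<le> LH * \<bar>p - q\<bar>" "0 \<le> LH"
    and LN: "\<And>x y z. x \<in> {l..r} \<Longrightarrow> \<bar>N x y - N x z\<bar> \<le> LN * \<bar>y - z\<bar>" "0 \<le> LN"
    and N_cont: "\<And>Y. continuous_on {l..r} Y \<Longrightarrow> continuous_on {l..r} (\<lambda>x. N x (Y x))"
begin

text \<open>In the application \<open>H\<close> is the inverse of an antiderivative \<open>G\<close>
  of \<open>g\<close>. Integrating \<open>g (U') * U'' = N x U\<close> shows that this expression is
  \<open>G (U')\<close>, not \<open>U'\<close> itself; the derivative is
  \<open>H (slope P U x)\<close>, and \<open>P\<close> is the value of \<open>G (U')\<close> at
  \<open>l\<close>.\<close>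

definition slope :: "real \<Rightarrow> (real \<Rightarrow> real) \<Rightarrow> real \<Rightarrow> real" where
  "slope P Y s = P + integral {l..s} (\<lambda>x. N x (Y x))"

definition picard :: "real \<Rightarrow> (real \<Rightarrow> real) \<Rightarrow> real \<Rightarrow> real" where
  "picard P Y x = A + integral {l..x} (\<lambda>s. H (slope P Y s))"

lemma H_cont: "continuous_on S H"
proof -
  have "LH-lipschitz_on UNIV H" using LH by (auto simp: lipschitz_on_def dist_real_def)
  then show ?thesis using lipschitz_on_continuous_on continuous_on_subset by blast
qed

lemma slope_deriv:
  assumes "continuous_on {l..r} Y" "x \<in> {l..r}"
  shows "(slope P Y has_real_derivative N x (Y x)) (at x within {l..r})"
  unfolding slope_def
  by (auto intro!: derivative_eq_intros integral_has_real_derivative N_cont assms)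

lemma slope_cont: "continuous_on {l..r} Y \<Longrightarrow> continuous_on {l..r} (slope P Y)"
  by (rule DERIV_continuous_on[OF slope_deriv])

lemma H_slope_cont: "continuous_on {l..r} Y \<Longrightarrow> continuous_on {l..r} (\<lambda>s. H (slope P Y s))"
  by (rule continuous_on_compose2[OF H_cont slope_cont]) auto

lemma picard_deriv:
  assumes "continuous_on {l..r} Y" "x \<in> {l..r}"
  shows "(picard P Y has_real_derivative H (slope P Y x)) (at x within {l..r})"
  unfolding picard_def
  by (auto intro!: derivative_eq_intros integral_has_real_derivative H_slope_cont assms)

lemma picard_cont: "continuous_on {l..r} Y \<Longrightarrow> continuous_on {l..r} (picard P Y)"
  by (rule DERIV_continuous_on[OF picard_deriv])

lemma exp_integral:
  assumes "L > 0" "l \<le> x"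
  shows "((\<lambda>s. exp (L * (s - l))) has_integral (exp (L * (x - l)) - 1) / L) {l..x}"
proof -
  have "((\<lambda>s. exp (L * (s - l))) has_integral (exp (L * (x - l)) / L - exp (L * (l - l)) / L)) {l..x}"
    using assms
    by (intro fundamental_theorem_of_calculus)
       (auto intro!: derivative_eq_intros simp flip: has_real_derivative_iff_has_vector_derivative)
  then show ?thesis by (simp add: diff_divide_distrib)
qed

text \<open>Each integration against the weight \<open>exp (L * (x - l))\<close> gains a factor
  \<open>1 / L\<close>. The two integrations, in \<open>slope\<close> and in \<open>picard\<close>,
  give the \<open>L^2\<close> that makes the map a contraction for large \<open>L\<close> on an
  interval of any length.\<close>

lemma picard_dist:
  assumes Y: "continuous_on {l..r} Y" "continuous_on {l..r} Z" and L: "L > 0"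
    and m: "\<And>x. x \<in> {l..r} \<Longrightarrow> \<bar>Y x - Z x\<bar> \<le> m * exp (L * (x - l))" "m \<ge> 0" and x: "x \<in> {l..r}"
  shows "\<bar>picard P Y x - picard P' Z x\<bar> \<le> LH * \<bar>P - P'\<bar> * (x - l) + LH * LN * m / L^2 * exp (L * (x - l))"
proof -
  have slopes: "\<bar>slope P Y s - slope P' Z s\<bar> \<le> \<bar>P - P'\<bar> + LN * m / L * exp (L * (s - l))"
    if s: "s \<in> {l..r}" for s
  proof -
    have sub: "{l..s} \<subseteq> {l..r}" using s by auto
    have int: "(\<lambda>x. N x (Y x)) integrable_on {l..s}" "(\<lambda>x. N x (Z x)) integrable_on {l..s}"
      using N_cont[OF Y(1)] N_cont[OF Y(2)] sub continuous_on_subset integrable_continuous_real by blast+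
    have "norm (integral {l..s} (\<lambda>x. N x (Y x) - N x (Z x)))
          \<le> integral {l..s} (\<lambda>x. LN * m * exp (L * (x - l)))"
    proof (rule integral_norm_bound_integral)
      show "(\<lambda>x. N x (Y x) - N x (Z x)) integrable_on {l..s}" using int by (rule integrable_diff)
      show "(\<lambda>x. LN * m * exp (L * (x - l))) integrable_on {l..s}"
        by (intro integrable_continuous_real continuous_intros)
      fix y assume "y \<in> {l..s}"
      then have y: "y \<in> {l..r}" using sub by auto
      have "\<bar>N y (Y y) - N y (Z y)\<bar> \<le> LN * \<bar>Y y - Z y\<bar>" by (rule LN(1)[OF y])
      also have "\<dots> \<le> LN * (m * exp (L * (y - l)))" using m(1)[OF y] LN(2) by (rule mult_left_mono)
      finally show "norm (N y (Y y) - N y (Z y)) \<le> LN * m * exp (L * (y - l))" by (simp add: mult_ac)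
    qed
    also have "\<dots> = LN * m * ((exp (L * (s - l)) - 1) / L)"
      by (rule integral_unique[OF has_integral_mult_right[OF exp_integral[OF L]]]) (use s in auto)
    also have "\<dots> \<le> LN * m * (exp (L * (s - l)) / L)"
      using L LN m by (intro mult_left_mono divide_right_mono) auto
    finally have "\<bar>integral {l..s} (\<lambda>x. N x (Y x)) - integral {l..s} (\<lambda>x. N x (Z x))\<bar> \<le> LN * m / L * exp (L * (s - l))"
      using int by (simp add: integral_diff)
    then show ?thesis unfolding slope_def by linarith
  qed
  have sub: "{l..x} \<subseteq> {l..r}" using x by auto
  have int: "(\<lambda>x. H (slope P Y x)) integrable_on {l..x}" "(\<lambda>x. H (slope P' Z x)) integrable_on {l..x}"
    using H_slope_cont[OF Y(1)] H_slope_cont[OF Y(2)] sub continuous_on_subset integrable_continuous_real by blast+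
  define c where "c = LH * (LN * m / L)"
  have c: "c \<ge> 0" using LH LN m L by (simp add: c_def)
  have "norm (integral {l..x} (\<lambda>s. H (slope P Y s) - H (slope P' Z s)))
        \<le> integral {l..x} (\<lambda>s. LH * \<bar>P - P'\<bar> + c * exp (L * (s - l)))"
  proof (rule integral_norm_bound_integral)
    show "(\<lambda>x. H (slope P Y x) - H (slope P' Z x)) integrable_on {l..x}" using int by (rule integrable_diff)
    show "(\<lambda>s. LH * \<bar>P - P'\<bar> + c * exp (L * (s - l))) integrable_on {l..x}"
      by (intro integrable_continuous_real continuous_intros)
    fix y assume "y \<in> {l..x}"
    then have y: "y \<in> {l..r}" using sub by auto
    have "\<bar>H (slope P Y y) - H (slope P' Z y)\<bar> \<le> LH * \<bar>slope P Y y - slope P' Z y\<bar>" by (rule LH(1))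
    also have "\<dots> \<le> LH * (\<bar>P - P'\<bar> + LN * m / L * exp (L * (y - l)))"
      using slopes[OF y] LH(2) by (rule mult_left_mono)
    finally show "norm (H (slope P Y y) - H (slope P' Z y)) \<le> LH * \<bar>P - P'\<bar> + c * exp (L * (y - l))"
      by (simp add: c_def algebra_simps)
  qed
  also have "\<dots> = LH * \<bar>P - P'\<bar> * (x - l) + c * ((exp (L * (x - l)) - 1) / L)"
  proof (rule integral_unique, rule has_integral_add)
    show "((\<lambda>s. LH * \<bar>P - P'\<bar>) has_integral LH * \<bar>P - P'\<bar> * (x - l)) {l..x}"
      using has_integral_const_real[of "LH * \<bar>P - P'\<bar>" l x] x by (simp add: mult.commute)
    show "((\<lambda>s. c * exp (L * (s - l))) has_integral c * ((exp (L * (x - l)) - 1) / L)) {l..x}"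
      using has_integral_mult_right[OF exp_integral[OF L, of x]] x by auto
  qed
  also have "\<dots> \<le> LH * \<bar>P - P'\<bar> * (x - l) + c * (exp (L * (x - l)) / L)"
    using L c by (intro add_left_mono mult_left_mono divide_right_mono) auto
  finally have "\<bar>picard P Y x - picard P' Z x\<bar> \<le> LH * \<bar>P - P'\<bar> * (x - l) + c * (exp (L * (x - l)) / L)"
    using int by (simp add: picard_def integral_diff)
  also have "c * (exp (L * (x - l)) / L) = LH * LN * m / L^2 * exp (L * (x - l))"
    by (simp add: c_def power2_eq_square)
  finally show ?thesis .
qed

text \<open>Since \<open>rate\<close> is at least 1 and at least \<open>2 * LH * LN\<close>, its
  square is at least \<open>2 * LH * LN\<close>, and the contraction factor
  \<open>LH * LN / rate^2\<close> is at most one half.\<close>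

definition rate :: real where "rate = 2 * LH * LN + 1"

lemma rate: "rate > 0" "LH * LN * m / rate^2 \<le> m / 2" if "m \<ge> 0"
proof -
  have nn: "LH * LN \<ge> 0" using LH LN by simp
  show "rate > 0" using nn by (simp add: rate_def)
  have "2 * (LH * LN) \<le> rate" by (simp add: rate_def)
  also have "rate \<le> rate^2" using nn by (simp add: rate_def power2_eq_square)
  finally have "2 * (LH * LN) * m \<le> rate^2 * m" using that by (rule mult_right_mono)
  then show "LH * LN * m / rate^2 \<le> m / 2" using \<open>rate > 0\<close> by (simp add: field_simps)
qed

lemma picard_fixpoint: "\<exists>U. continuous_on {l..r} U \<and> (\<forall>x\<in>{l..r}. U x = picard P U x)"
proof -
  \<comment> \<open>Clamping to \<open>[l, r]\<close> extends functions to the whole line, where the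
    complete space of bounded continuous functions is available.\<close>
  define c where "c x = max l (min r x)" for x
  have c: "c x \<in> {l..r}" "x \<in> {l..r} \<Longrightarrow> c x = x" for x using lr by (auto simp: c_def)
  have ccont: "continuous_on UNIV c" unfolding c_def by (intro continuous_intros)
  \<comment> \<open>Elements of the space are the unknown functions divided by the weight.
    \<open>W\<close> multiplies the weight back, so the sup distance of the space is the weighted
    distance.\<close>
  define W where "W Y x = exp (rate * (x - l)) * (Y :: real \<Rightarrow> real) x" for Y x
  define T where "T Y = Bcontfun (\<lambda>x. exp (- (rate * (c x - l))) * picard P (W (apply_bcontfun Y)) (c x))" for Y
  have Wc: "continuous_on {l..r} (W (apply_bcontfun Y))" for Y
    unfolding W_def by (intro continuous_intros continuous_on_apply_bcontfun)
  have mem: "(\<lambda>x. exp (- (rate * (c x - l))) * picard P (W (apply_bcontfun Y)) (c x)) \<in> bcontfun" for Y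
  proof -
    define F where "F x = exp (- (rate * (x - l))) * picard P (W (apply_bcontfun Y)) x" for x
    have F: "continuous_on {l..r} F" unfolding F_def by (intro continuous_intros picard_cont Wc)
    have "bounded (F ` {l..r})" using compact_continuous_image[OF F] compact_imp_bounded by auto
    then obtain B where "\<forall>y\<in>F ` {l..r}. norm y \<le> B" unfolding bounded_iff by blast
    then have "norm (F (c x)) \<le> B" for x using c(1)[of x] by auto
    moreover have "continuous_on UNIV (\<lambda>x. F (c x))" by (rule continuous_on_compose2[OF F ccont]) (use c in auto)
    ultimately have "(\<lambda>x. F (c x)) \<in> bcontfun" by (intro bcontfun_normI) auto
    then show ?thesis by (simp add: F_def)
  qed
  have T: "apply_bcontfun (T Y) x = exp (- (rate * (c x - l))) * picard P (W (apply_bcontfun Y)) (c x)" for Y x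
    unfolding T_def using mem by (simp add: Bcontfun_inverse)
  have "dist (T Y) (T Z) \<le> 1/2 * dist Y Z" for Y Z
  proof (rule dist_bound)
    fix x
    have "\<bar>W (apply_bcontfun Y) y - W (apply_bcontfun Z) y\<bar> \<le> dist Y Z * exp (rate * (y - l))" for y
    proof -
      have "\<bar>W (apply_bcontfun Y) y - W (apply_bcontfun Z) y\<bar>
          = exp (rate * (y - l)) * \<bar>apply_bcontfun Y y - apply_bcontfun Z y\<bar>"
        unfolding W_def by (simp add: abs_mult flip: right_diff_distrib)
      also have "\<dots> \<le> exp (rate * (y - l)) * dist Y Z"
        using dist_bounded[of Y y Z] by (intro mult_left_mono) (auto simp: dist_real_def)
      finally show ?thesis by (simp add: mult.commute)
    qed
    then have "\<bar>picard P (W (apply_bcontfun Y)) (c x) - picard P (W (apply_bcontfun Z)) (c x)\<bar>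
       \<le> LH * \<bar>P - P\<bar> * (c x - l) + LH * LN * dist Y Z / rate^2 * exp (rate * (c x - l))"
      using rate(1)[of 0] by (intro picard_dist Wc c) auto
    also have "\<dots> \<le> dist Y Z / 2 * exp (rate * (c x - l))"
      using mult_right_mono[OF rate(2)[of "dist Y Z"], of "exp (rate * (c x - l))"] by simp
    finally have "exp (- (rate * (c x - l))) * \<bar>picard P (W (apply_bcontfun Y)) (c x) - picard P (W (apply_bcontfun Z)) (c x)\<bar>
       \<le> exp (- (rate * (c x - l))) * (dist Y Z / 2 * exp (rate * (c x - l)))"
      by (intro mult_left_mono) auto
    also have "\<dots> = dist Y Z / 2 * (exp (- (rate * (c x - l))) * exp (rate * (c x - l)))" by (simp only: mult_ac)
    also have "\<dots> = dist Y Z / 2" by (simp add: exp_minus)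
    finally show "dist (apply_bcontfun (T Y) x) (apply_bcontfun (T Z) x) \<le> 1/2 * dist Y Z"
      unfolding T dist_real_def by (simp add: abs_mult flip: right_diff_distrib)
  qed
  then have "\<exists>!Y. T Y = Y"
    by (intro banach_fix_type[of "1/2"]) auto
  then obtain Y where Y: "T Y = Y" by blast
  have "W (apply_bcontfun Y) x = picard P (W (apply_bcontfun Y)) x" if "x \<in> {l..r}" for x
  proof -
    have "W (apply_bcontfun Y) x = exp (rate * (x - l)) * apply_bcontfun (T Y) x" using Y by (simp add: W_def)
    also have "\<dots> = picard P (W (apply_bcontfun Y)) x" unfolding T c(2)[OF that] by (simp add: exp_minus)
    finally show ?thesis .
  qed
  then show ?thesis using Wc by blast
qed

text \<open>Lipschitz dependence of the end value on the shooting parameter, in preparation for the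
  intermediate value theorem. At the maximum of the weighted difference, \<open>picard_dist\<close>
  bounds this maximum by half of itself plus a multiple of \<open>|P - P'|\<close>.\<close>

lemma picard_fixpoints_dist:
  assumes U: "continuous_on {l..r} U" "\<And>x. x \<in> {l..r} \<Longrightarrow> U x = picard P U x"
    and V: "continuous_on {l..r} V" "\<And>x. x \<in> {l..r} \<Longrightarrow> V x = picard P' V x"
  shows "\<bar>U r - V r\<bar> \<le> 2 * LH * (r - l) * exp (rate * (r - l)) * \<bar>P - P'\<bar>"
proof -
  define D where "D x = exp (- (rate * (x - l))) * \<bar>U x - V x\<bar>" for x
  have "continuous_on {l..r} D" unfolding D_def by (intro continuous_intros U V)
  then obtain x0 where x0: "x0 \<in> {l..r}" "\<And>x. x \<in> {l..r} \<Longrightarrow> D x \<le> D x0"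
    using continuous_attains_sup[of "{l..r}" D] lr by auto
  define m where "m = D x0"
  have m0: "m \<ge> 0" by (simp add: m_def D_def)
  have UV: "\<bar>U x - V x\<bar> = D x * exp (rate * (x - l))" for x 
  proof -
    have "exp (- (rate * (x - l))) * exp (rate * (x - l)) = 1" by (simp add: exp_minus)
    then show ?thesis unfolding D_def by (metis mult.assoc mult.commute mult.right_neutral)
  qed
  have dm: "\<bar>U x - V x\<bar> \<le> m * exp (rate * (x - l))" if "x \<in> {l..r}" for x
    unfolding UV m_def using x0(2)[OF that] by simp
  have "\<bar>U x0 - V x0\<bar> = \<bar>picard P U x0 - picard P' V x0\<bar>" using U V x0 by simp
  also have "\<dots> \<le> LH * \<bar>P - P'\<bar> * (x0 - l) + LH * LN * m / rate^2 * exp (rate * (x0 - l))"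
    using rate(1)[of 0] by (intro picard_dist U V dm m0 x0) auto
  also have "\<dots> \<le> LH * \<bar>P - P'\<bar> * (r - l) + m / 2 * exp (rate * (x0 - l))"
    using rate(2)[OF m0] x0 LH by (intro add_mono mult_left_mono mult_right_mono) auto
  finally have "m * exp (rate * (x0 - l)) \<le> LH * \<bar>P - P'\<bar> * (r - l) + m / 2 * exp (rate * (x0 - l))"
    unfolding UV m_def .
  then have "m * exp (rate * (x0 - l)) \<le> 2 * LH * \<bar>P - P'\<bar> * (r - l)" by simp
  moreover have "m * 1 \<le> m * exp (rate * (x0 - l))"
    using m0 x0 rate(1)[of 0] by (intro mult_left_mono) auto
  ultimately have "m \<le> 2 * LH * \<bar>P - P'\<bar> * (r - l)" by simp
  then have "m * exp (rate * (r - l)) \<le> 2 * LH * \<bar>P - P'\<bar> * (r - l) * exp (rate * (r - l))"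
    by (rule mult_right_mono) simp
  moreover have "\<bar>U r - V r\<bar> \<le> m * exp (rate * (r - l))" using dm[of r] lr by simp
  ultimately have "\<bar>U r - V r\<bar> \<le> 2 * LH * \<bar>P - P'\<bar> * (r - l) * exp (rate * (r - l))" by linarith
  then show ?thesis by (simp only: mult_ac)
qed

end

text \<open>The lower bound \<open>c\<close> makes the antiderivative grow at least linearly in both
  directions, so it is a bijection of the line with inverse of Lipschitz constant
  \<open>1 / c\<close>. The \<open>g\<close> of the theorem is integrable at infinity and has a
  bounded antiderivative; this is why it is frozen outside a compact set before this lemma is
  applied.\<close>

lemma inverse_antiderivative:
  fixes g :: "real \<Rightarrow> real"
  assumes g: "continuous_on UNIV g" and c: "c > 0" "\<And>p. g p \<ge> c"
  obtains H where "\<And>y. (H has_real_derivative 1 / g (H y)) (at y)" "surj H" "strict_mono H"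
    "\<And>x y. \<bar>H x - H y\<bar> \<le> 1 / c * \<bar>x - y\<bar>"
proof -
  have "\<exists>G. \<forall>x::real. -\<infinity> < ereal x \<longrightarrow> ereal x < \<infinity> \<longrightarrow> (G has_vector_derivative g x) (at x)"
    using g by (intro einterval_antiderivative) (auto simp: continuous_on_eq_continuous_at)
  then obtain G where G: "\<And>x. (G has_real_derivative g x) (at x)"
    by (auto simp: has_real_derivative_iff_has_vector_derivative)
  have grow: "G y - G x \<ge> c * (y - x)" if "x \<le> y" for x y
  proof (cases "x = y")
    case False
    then have "x < y" using that by simp
    then obtain z where "G y - G x = (y - x) * g z" using MVT2[of x y G g] G by auto
    then show ?thesis using c(2)[of z] that by (simp add: mult.commute mult_left_mono mult_right_mono)
  qed auto
  have inj: "strict_mono G"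
  proof (rule strict_monoI)
    fix x y :: real assume "x < y"
    then have "c * (y - x) > 0" using c by simp
    then show "G x < G y" using grow[of x y] \<open>x < y\<close> by simp
  qed
  have cont: "continuous_on UNIV G" using G DERIV_isCont by (auto simp: continuous_on_eq_continuous_at)
  have "surj G"
    unfolding surj_def
  proof
    fix y
    define M where "M = \<bar>y - G 0\<bar> / c"
    have "c * M = \<bar>y - G 0\<bar>" using c by (simp add: M_def)
    moreover have M: "M \<ge> 0" using c by (simp add: M_def)
    ultimately have "G M \<ge> y" "G (- M) \<le> y" using grow[of 0 M] grow[of "- M" 0] by auto
    then have "\<exists>x\<ge>-M. x \<le> M \<and> G x = y"
      using M cont continuous_on_subset by (intro IVT') auto
    then show "\<exists>x. y = G x" by auto
  qed
  then have bij: "bij G" using inj strict_mono_imp_inj_on bij_def by blast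
  define H where "H = inv G"
  have GH: "G (H y) = y" "H (G x) = x" for x y
    using bij by (auto simp: H_def bij_def surj_f_inv_f)
  have Hmono: "strict_mono H"
    by (rule strict_monoI) (metis GH(1) inj strict_mono_less)
  have lip: "\<bar>H x - H y\<bar> \<le> 1 / c * \<bar>x - y\<bar>" for x y
  proof -
    have "H x \<le> H y \<or> H y \<le> H x" by auto
    then have "c * \<bar>H x - H y\<bar> \<le> \<bar>x - y\<bar>" using grow[of "H x" "H y"] grow[of "H y" "H x"] by (auto simp: GH)
    then show ?thesis using c by (simp add: field_simps)
  qed
  have "lipschitz_on (1/c) UNIV H" using lip c by (auto simp: lipschitz_on_def dist_real_def)
  then have Hc: "isCont H y" for y
    using lipschitz_on_continuous_on continuous_on_eq_continuous_at by blast
  have "(H has_real_derivative inverse (g (H y))) (at y)" for y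
    using c(2)[of "H y"] c(1)
    by (intro DERIV_inverse_function[where f = G and a = "y - 1" and b = "y + 1"] G Hc) (auto simp: GH)
  then have "\<And>y. (H has_real_derivative 1 / g (H y)) (at y)" by (simp add: inverse_eq_divide)
  moreover have "surj H" by (metis GH(2) surj_def)
  ultimately show ?thesis using lip Hmono by (intro that) auto
qed

text \<open>Shooting with slope \<open>S + 1\<close> overshoots data of slope at most \<open>S\<close>: as long as \<open>U \<ge> w\<close>, the equation makes
  the slope of \<open>U\<close> nondecreasing.\<close>

lemma shot_stays_above:
  fixes U V w :: "real \<Rightarrow> real"
  assumes lr: "l < r" and U: "\<And>x. x \<in> {l..r} \<Longrightarrow> (U has_real_derivative V x) (at x within {l..r})"
    and V: "continuous_on {l..r} V" and w: "continuous_on {l..r} w"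
    and wS: "\<And>x y. l \<le> x \<Longrightarrow> x \<le> y \<Longrightarrow> y \<le> r \<Longrightarrow> w y - w x \<le> S * (y - x)"
    and init: "U l \<ge> w l"
    and V0: "\<And>x. x \<in> {l..r} \<Longrightarrow> (\<And>y. l \<le> y \<Longrightarrow> y \<le> x \<Longrightarrow> U y \<ge> w y) \<Longrightarrow> V x \<ge> S + 1"
    and x: "x \<in> {l..r}"
  shows "U x \<ge> w x"
proof (rule ccontr)
  assume neg: "\<not> ?thesis"
  define E where "E = {y \<in> {l..r}. U y < w y}"
  \<comment> \<open>At the first violation point \<open>a\<close> the inequality still holds, so the
    slope is at least \<open>S + 1\<close> there, more than \<open>w\<close> can climb. By
    continuity this persists slightly beyond \<open>a\<close>, and no violation can start at
    \<open>a\<close>.\<close>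
  define a where "a = Inf E"
  have xE: "x \<in> E" using neg x by (simp add: E_def)
  have bdd: "bdd_below E" by (rule bdd_belowI[of _ l]) (auto simp: E_def)
  have Uc: "continuous_on {l..r} U" by (rule DERIV_continuous_on[OF U])
  have a: "l \<le> a" "a \<le> x" "a \<le> r"
  proof -
    show "l \<le> a" unfolding a_def using xE by (intro cInf_greatest) (auto simp: E_def)
    show "a \<le> x" unfolding a_def using xE bdd by (rule cInf_lower)
    then show "a \<le> r" using x by simp
  qed
  have below: "U y \<ge> w y" if "l \<le> y" "y < a" for y
  proof (rule ccontr)
    assume "\<not> ?thesis"
    then have "y \<in> E" using that a by (auto simp: E_def)
    then have "a \<le> y" unfolding a_def using bdd by (rule cInf_lower)
    then show False using that by simp
  qed
  have Ua: "U a \<ge> w a"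
  proof (cases "a = l")
    case False
    have "continuous_on {l..r} (\<lambda>y. U y - w y)" by (intro continuous_intros Uc w)
    then have "((\<lambda>y. U y - w y) \<longlongrightarrow> U a - w a) (at a within {l..r})" using a by (simp add: continuous_on)
    then have 1: "((\<lambda>y. U y - w y) \<longlongrightarrow> U a - w a) (at a within {l..a})"
      by (rule tendsto_within_subset) (use a in auto)
    have 2: "at a within {l..a} \<noteq> bot" using False a by (simp add: at_within_Icc_at_left)
    have 3: "\<forall>\<^sub>F y in at a within {l..a}. 0 \<le> U y - w y"
      using below by (auto simp: eventually_at_filter)
    have "0 \<le> U a - w a" by (rule tendsto_lowerbound[OF 1 3 2])
    then show ?thesis by simp
  qed (use init in simp)
  have "V a \<ge> S + 1"
  proof (rule V0)
    show "U y \<ge> w y" if "l \<le> y" "y \<le> a" for y using below[of y] Ua that by (cases "y = a") auto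
  qed (use a in auto)
  then have "V a > S" by simp
  moreover have "(V \<longlongrightarrow> V a) (at a within {l..r})" using V a by (simp add: continuous_on)
  ultimately have "\<forall>\<^sub>F y in at a within {l..r}. V y > S" using order_tendstoD(1) by blast
  then obtain d where d: "d > 0" "\<And>y. y \<in> {l..r} \<Longrightarrow> y \<noteq> a \<Longrightarrow> dist y a < d \<Longrightarrow> V y > S"
    unfolding eventually_at by blast
  have ok: "U y \<ge> w y" if y: "a < y" "y < a + d" "y \<le> r" for y
  proof -
    have "\<exists>z\<in>{a<..<y}. U y - U a = V z * (y - a)"
    proof (rule mvt_simple[OF y(1), where f' = "\<lambda>z h. V z * h"])
      fix z assume z: "a \<le> z" "z \<le> y"
      have "(U has_real_derivative V z) (at z within {a..y})"
      proof (rule DERIV_subset[OF U])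
        show "z \<in> {l..r}" using z a y by simp
        show "{a..y} \<subseteq> {l..r}" using a y by simp
      qed
      then show "(U has_derivative (\<lambda>h. V z * h)) (at z within {a..y})" by (simp add: has_field_derivative_def)
    qed
    then obtain z where z: "a < z" "z < y" "U y - U a = (y - a) * V z" by (metis greaterThanLessThan_iff mult.commute)
    have "V z > S" using d(2)[of z] z y a by (auto simp: dist_real_def)
    then have "(y - a) * S \<le> (y - a) * V z" using y by (intro mult_left_mono) auto
    moreover have "w y - w a \<le> (y - a) * S" using wS[of a y] a y by (simp add: mult.commute)
    ultimately show ?thesis using Ua z(3) by linarith
  qed
  have "a + d \<le> y" if "y \<in> E" for y
  proof (rule ccontr)
    assume n: "\<not> ?thesis"
    have "a \<le> y" unfolding a_def using that bdd by (rule cInf_lower)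
    moreover have "U y < w y" "y \<le> r" using that by (auto simp: E_def)
    ultimately show False using ok[of y] Ua n by (cases "y = a") auto
  qed
  then have "a + d \<le> a" unfolding a_def using xE by (intro cInf_greatest) auto
  then show False using d by simp
qed

section \<open>The implicit time scheme\<close>

lemma second_derivative_local_max:
  fixes A A1 :: "real \<Rightarrow> real"
  assumes max: "\<forall>\<^sub>F x in nhds x0. A x \<le> A x0"
    and A: "\<forall>\<^sub>F x in nhds x0. (A has_real_derivative A1 x) (at x)"
    and A1: "(A1 has_real_derivative A2) (at x0)"
  shows "A1 x0 = 0" "A2 \<le> 0"
proof -
  obtain d where d: "d > 0" "\<And>x. dist x x0 < d \<Longrightarrow> A x \<le> A x0"
    using max unfolding eventually_nhds_metric by blast
  have "(A has_real_derivative A1 x0) (at x0)" using eventually_nhds_x_imp_x[OF A] .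
  then show z: "A1 x0 = 0" by (rule DERIV_local_max[OF _ d(1)]) (use d in \<open>auto simp: dist_real_def\<close>)
  show "A2 \<le> 0"
  proof (rule ccontr)
    assume "\<not> A2 \<le> 0"
    then have p: "A2 > 0" by simp
    have "\<forall>\<^sub>F x in nhds x0. ((\<lambda>x. - A x) has_real_derivative - A1 x) (at x)"
      using A by eventually_elim (auto intro!: derivative_eq_intros)
    moreover have "((\<lambda>x. - A1 x) has_real_derivative - A2) (at x0)"
      using A1 by (auto intro!: derivative_eq_intros)
    \<comment> \<open>The slack \<open>A2 / 2\<close> still leaves the coefficient
      \<open>- A2 / 4\<close>, so \<open>A\<close> would rise quadratically next to
      \<open>x0\<close>.\<close>
    ultimately have "\<forall>\<^sub>F x in nhds x0. - A x \<le> - A x0 + (- A1 x0) * (x - x0) + (- A2 + A2/2)/2 * (x - x0)^2"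
      using p by (intro taylor2_upper) auto
    then obtain d' where d': "d' > 0" "\<And>x. dist x x0 < d' \<Longrightarrow> - A x \<le> - A x0 + (- A2 + A2/2)/2 * (x - x0)^2"
      unfolding eventually_nhds_metric using z by auto
    define x where "x = x0 + min d d' / 2"
    have x: "dist x x0 < d" "dist x x0 < d'" "x \<noteq> x0" using d d' by (auto simp: x_def dist_real_def)
    have "A2 * (x - x0)^2 > 0" using p x by simp
    then show False using d(2)[OF x(1)] d'(2)[OF x(2)] by (simp add: algebra_simps)
  qed
qed

lemma second_derivative_interior_max:
  fixes A A1 A2 :: "real \<Rightarrow> real"
  assumes x0: "l < x0" "x0 < r" and max: "\<And>x. l < x \<Longrightarrow> x < r \<Longrightarrow> A x \<le> A x0"
    and A: "\<And>x. l < x \<Longrightarrow> x < r \<Longrightarrow> (A has_real_derivative A1 x) (at x)"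
    and A1: "(A1 has_real_derivative A2') (at x0)"
  shows "A1 x0 = 0" "A2' \<le> 0"
proof -
  have ev: "\<forall>\<^sub>F x in nhds x0. x \<in> {l<..<r}" using x0 by (intro eventually_nhds_in_open) auto
  have 1: "\<forall>\<^sub>F x in nhds x0. A x \<le> A x0" using ev by eventually_elim (use max in auto)
  have 2: "\<forall>\<^sub>F x in nhds x0. (A has_real_derivative A1 x) (at x)" using ev by eventually_elim (use A in auto)
  show "A1 x0 = 0" "A2' \<le> 0" using second_derivative_local_max[OF 1 2 A1] by auto
qed

text \<open>By \<open>sgn\<close>, \<open>U\<close> lies below \<open>w\<close> where its second
  derivative is nonpositive and above \<open>w\<close> where it is nonnegative. If \<open>U\<close>
  climbed faster than \<open>S\<close>, take a maximum \<open>y'\<close> of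
  \<open>U z - S * z\<close> to the right of \<open>x\<close> and then a minimum \<open>x'\<close>
  to the left of \<open>y'\<close>. Each is an endpoint or a point covered by \<open>sgn\<close>, so
  \<open>w\<close> climbs from \<open>x'\<close> to \<open>y'\<close> at least as much as
  \<open>U\<close>, which is too much.\<close>

lemma slope_bound_preserved:
  fixes U U1 U2 w :: "real \<Rightarrow> real"
  assumes U: "continuous_on {l..r} U" and bd: "U l = w l" "U r = w r"
    and d: "\<And>x. l < x \<Longrightarrow> x < r \<Longrightarrow> (U has_real_derivative U1 x) (at x)"
      "\<And>x. l < x \<Longrightarrow> x < r \<Longrightarrow> (U1 has_real_derivative U2 x) (at x)"
    and sgn: "\<And>x. l < x \<Longrightarrow> x < r \<Longrightarrow> U2 x \<le> 0 \<Longrightarrow> U x \<le> w x"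
      "\<And>x. l < x \<Longrightarrow> x < r \<Longrightarrow> U2 x \<ge> 0 \<Longrightarrow> U x \<ge> w x"
    and wS: "\<And>x y. l \<le> x \<Longrightarrow> x \<le> y \<Longrightarrow> y \<le> r \<Longrightarrow> w y - w x \<le> S * (y - x)"
    and xy: "l \<le> x" "x \<le> y" "y \<le> r"
  shows "U y - U x \<le> S * (y - x)"
proof (rule ccontr)
  assume neg: "\<not> ?thesis"
  define E where "E z = U z - S * z" for z
  have Ec: "continuous_on {l..r} E" unfolding E_def by (intro continuous_intros U)
  have E1: "(E has_real_derivative (U1 z - S)) (at z)" if "l < z" "z < r" for z
    unfolding E_def using d(1)[OF that] by (auto intro!: derivative_eq_intros)
  have E2: "((\<lambda>z. U1 z - S) has_real_derivative U2 z) (at z)" if "l < z" "z < r" for z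
    using d(2)[OF that] by (auto intro!: derivative_eq_intros)
  have lt: "E x < E y" using neg by (simp add: E_def algebra_simps)
  have "continuous_on {x..r} E" by (rule continuous_on_subset[OF Ec]) (use xy in auto)
  then obtain y' where y': "y' \<in> {x..r}" "\<And>z. z \<in> {x..r} \<Longrightarrow> E z \<le> E y'"
    using continuous_attains_sup[of "{x..r}" E] xy by auto
  have lt': "E x < E y'" using lt y'(2)[of y] xy by auto
  have Uy: "U y' \<le> w y'"
  proof (cases "y' = r")
    case False
    then have in': "x < y'" "y' < r" using y' lt' by (auto simp: order_le_less)
    have "U2 y' \<le> 0"
      by (rule second_derivative_interior_max(2)[OF in', of E "\<lambda>z. U1 z - S"]) (use y' E1 E2 in' xy in auto)
    then show ?thesis using sgn(1)[of y'] in' xy by auto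
  qed (use bd in simp)
  have "continuous_on {l..y'} E" by (rule continuous_on_subset[OF Ec]) (use xy y' in auto)
  then obtain x' where x': "x' \<in> {l..y'}" "\<And>z. z \<in> {l..y'} \<Longrightarrow> E x' \<le> E z"
    using continuous_attains_inf[of "{l..y'}" E] xy y' by auto
  have lt'': "E x' < E y'" using lt' x'(2)[of x] xy y' by auto
  have Ux: "U x' \<ge> w x'"
  proof (cases "x' = l")
    case False
    then have in': "l < x'" "x' < y'" using x' lt'' by (auto simp: order_le_less)
    have "- U2 x' \<le> 0"
    proof (rule second_derivative_interior_max(2)[OF in', of "\<lambda>z. - E z" "\<lambda>z. - (U1 z - S)"])
      show "- E z \<le> - E x'" if "l < z" "z < y'" for z using x'(2)[of z] that by simp
      show "((\<lambda>z. - E z) has_real_derivative - (U1 z - S)) (at z)" if "l < z" "z < y'" for z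
        by (rule DERIV_minus, rule E1) (use that y' in auto)
      show "((\<lambda>z. - (U1 z - S)) has_real_derivative - U2 x') (at x')"
        by (rule DERIV_minus, rule E2) (use in' y' in auto)
    qed
    then show ?thesis using sgn(2)[of x'] in' y' by auto
  qed (use bd in simp)
  have "w y' - w x' \<le> S * (y' - x')" using wS[of x' y'] x' y' by auto
  then have "E y' \<le> E x'" using Uy Ux by (simp add: E_def algebra_simps)
  then show False using lt'' by simp
qed

text \<open>Every initial slope gives a solution of the integrated equation that starts at
  \<open>w l\<close>. Initial slopes just above \<open>S\<close> and just below \<open>- S\<close>
  miss \<open>w r\<close> on opposite sides, and the end value depends continuously on the
  parameter.\<close>

lemma implicit_step:
  fixes g \<beta> w :: "real \<Rightarrow> real"
  assumes lr: "l < r" and g: "continuous_on UNIV g" and c: "c > 0" "\<And>p. g p \<ge> c"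
    and \<beta>: "strict_mono \<beta>" "\<beta> 0 = 0" "\<And>x y. \<bar>\<beta> x - \<beta> y\<bar> \<le> L * \<bar>x - y\<bar>" and h: "h > 0"
    and w: "continuous_on {l..r} w"
    and wS: "\<And>x y. l \<le> x \<Longrightarrow> x \<le> y \<Longrightarrow> y \<le> r \<Longrightarrow> \<bar>w y - w x\<bar> \<le> S * (y - x)"
  obtains U U1 U2 where "continuous_on {l..r} U" "U l = w l" "U r = w r"
    "\<And>x. l < x \<Longrightarrow> x < r \<Longrightarrow> (U has_real_derivative U1 x) (at x)"
    "\<And>x. l < x \<Longrightarrow> x < r \<Longrightarrow> (U1 has_real_derivative U2 x) (at x)"
    "\<And>x. l < x \<Longrightarrow> x < r \<Longrightarrow> g (U1 x) * U2 x = \<beta> ((U x - w x) / h)"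
    "\<And>x y. l \<le> x \<Longrightarrow> x \<le> y \<Longrightarrow> y \<le> r \<Longrightarrow> \<bar>U y - U x\<bar> \<le> S * (y - x)"
proof -
  obtain H where H: "\<And>y. (H has_real_derivative 1 / g (H y)) (at y)" "surj H" "strict_mono H"
      "\<And>x y. \<bar>H x - H y\<bar> \<le> 1 / c * \<bar>x - y\<bar>"
    using inverse_antiderivative[OF g c] by metis
  have "\<bar>\<beta> 0 - \<beta> 1\<bar> \<le> L" using \<beta>(3)[of 0 1] by simp
  then have L: "L \<ge> 0" by linarith
  have \<beta>c: "continuous_on UNIV \<beta>"
    using lipschitz_on_continuous_on[of L UNIV \<beta>] \<beta>(3) L by (auto simp: lipschitz_on_def dist_real_def)
  interpret shooting l r "w l" "1 / c" "L / h" H "\<lambda>x y. \<beta> ((y - w x) / h)"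
  proof
    show "\<bar>\<beta> ((y - w x) / h) - \<beta> ((z - w x) / h)\<bar> \<le> L / h * \<bar>y - z\<bar>" for x y z
    proof -
      have "(y - w x) / h - (z - w x) / h = (y - z) / h" by (simp add: diff_divide_distrib)
      then show ?thesis using \<beta>(3)[of "(y - w x) / h" "(z - w x) / h"] h by simp
    qed
    show "continuous_on {l..r} (\<lambda>x. \<beta> ((Y x - w x) / h))" if "continuous_on {l..r} Y" for Y
      by (rule continuous_on_compose2[OF \<beta>c]) (use that w h in \<open>auto intro!: continuous_intros\<close>)
  qed (use lr H L h c in auto)
  have "\<forall>P. \<exists>U. continuous_on {l..r} U \<and> (\<forall>x\<in>{l..r}. U x = picard P U x)" using picard_fixpoint by blast
  then obtain shot where shot: "\<And>P. continuous_on {l..r} (shot P)" "\<And>P x. x \<in> {l..r} \<Longrightarrow> shot P x = picard P (shot P) x"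
    by metis
  have shot_l: "shot P l = w l" for P using shot(2)[of l P] lr by (simp add: picard_def)
  define V where "V P x = H (slope P (shot P) x)" for P x
  have Vc: "continuous_on {l..r} (V P)" for P unfolding V_def by (rule H_slope_cont[OF shot(1)])
  have shot_deriv: "(shot P has_real_derivative V P x) (at x within {l..r})" if "x \<in> {l..r}" for P x
    unfolding V_def
    by (rule has_field_derivative_transform_within[OF picard_deriv[OF shot(1) that], of 1])
       (simp_all only: that shot(2) zero_less_one)
  have "continuous_on UNIV (\<lambda>P. shot P r)"
  proof -
    define K where "K = 2 * (1 / c) * (r - l) * exp (rate * (r - l))"
    have "\<bar>shot P r - shot P' r\<bar> \<le> K * \<bar>P - P'\<bar>" for P P'
      unfolding K_def by (rule picard_fixpoints_dist) (use shot in auto)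
    moreover have "K \<ge> 0" using c lr by (simp add: K_def)
    ultimately have "lipschitz_on K UNIV (\<lambda>P. shot P r)" by (auto simp: lipschitz_on_def dist_real_def)
    then show ?thesis by (rule lipschitz_on_continuous_on)
  qed
  \<comment> \<open>The parameter is the value at \<open>l\<close> to which \<open>H\<close> is
    applied, so these two shots start with the derivatives \<open>S + 1\<close> and
    \<open>- (S + 1)\<close>.\<close>
  obtain Pp Pm where P: "H Pp = S + 1" "H Pm = - (S + 1)" using H(2) by (metis surjD)
  have int: "(\<lambda>x. \<beta> ((shot P x - w x) / h)) integrable_on {l..x}" if "x \<in> {l..r}" for P x
    by (intro integrable_continuous_real continuous_on_subset[OF N_cont[OF shot(1)]]) (use that in auto)
  have up: "shot Pp r \<ge> w r"
  proof (rule shot_stays_above[OF lr shot_deriv Vc w])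
    show "w y - w x \<le> S * (y - x)" if "l \<le> x" "x \<le> y" "y \<le> r" for x y using wS[OF that] by simp
    show "V Pp x \<ge> S + 1" if x: "x \<in> {l..r}" and pos: "\<And>y. l \<le> y \<Longrightarrow> y \<le> x \<Longrightarrow> shot Pp y \<ge> w y" for x
    proof -
      have "0 \<le> \<beta> ((shot Pp y - w y) / h)" if "y \<in> {l..x}" for y
        using \<beta>(1,2) pos[of y] that h strict_mono_less_eq[OF \<beta>(1), of 0] by auto
      then have "integral {l..x} (\<lambda>x. \<beta> ((shot Pp x - w x) / h)) \<ge> 0" by (intro integral_nonneg int x) auto
      then have "slope Pp (shot Pp) x \<ge> Pp" by (simp add: slope_def)
      then have "H Pp \<le> H (slope Pp (shot Pp) x)" using H(3) by (simp add: strict_mono_less_eq)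
      then show ?thesis using P by (simp add: V_def)
    qed
  qed (use lr shot_l in auto)
  have "- shot Pm r \<ge> - w r"
  proof (rule shot_stays_above[OF lr, where U = "\<lambda>x. - shot Pm x" and w = "\<lambda>x. - w x" and V = "\<lambda>x. - V Pm x"])
    show "((\<lambda>x. - shot Pm x) has_real_derivative - V Pm x) (at x within {l..r})" if "x \<in> {l..r}" for x
      using shot_deriv[OF that] by (rule DERIV_minus)
    show "- w y - - w x \<le> S * (y - x)" if "l \<le> x" "x \<le> y" "y \<le> r" for x y using wS[OF that] by simp
    show "- V Pm x \<ge> S + 1" if x: "x \<in> {l..r}" and pos: "\<And>y. l \<le> y \<Longrightarrow> y \<le> x \<Longrightarrow> - shot Pm y \<ge> - w y" for x
    proof -
      have "0 \<ge> \<beta> ((shot Pm y - w y) / h)" if "y \<in> {l..x}" for y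
      proof -
        have "(shot Pm y - w y) / h \<le> 0" using pos[of y] that h by (simp add: divide_nonpos_pos)
        then show ?thesis using strict_mono_less_eq[OF \<beta>(1), of _ 0] \<beta>(2) by metis
      qed
      then have "integral {l..x} (\<lambda>x. \<beta> ((shot Pm x - w x) / h)) \<le> integral {l..x} (\<lambda>_. 0)"
        by (intro integral_le int[OF x]) auto
      then have "slope Pm (shot Pm) x \<le> Pm" by (simp add: slope_def)
      then have "H Pm \<ge> H (slope Pm (shot Pm) x)" using H(3) by (simp add: strict_mono_less_eq)
      then show ?thesis using P by (simp add: V_def)
    qed
  qed (use lr shot_l in \<open>auto intro!: continuous_intros Vc w\<close>)
  then have down: "shot Pm r \<le> w r" by simp
  have S: "S \<ge> 0" using wS[of l r] lr by (smt (verit) zero_le_mult_iff)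
  have "Pm \<le> Pp" using P S H(3) by (metis add_increasing2 neg_le_0_iff_le order_trans strict_mono_less_eq zero_le_one)
  then obtain P0 where P0: "shot P0 r = w r"
    using IVT'[of "\<lambda>P. shot P r" Pm "w r" Pp] up down \<open>continuous_on UNIV (\<lambda>P. shot P r)\<close>
    by (meson continuous_on_subset subset_UNIV)
  define U where "U = shot P0"
  define U1 where "U1 = V P0"
  define U2 where "U2 x = 1 / g (U1 x) * \<beta> ((U x - w x) / h)" for x
  have at: "at x within {l..r} = at x" if "l < x" "x < r" for x using that by (rule at_within_Icc_at)
  have d1: "(U has_real_derivative U1 x) (at x)" if "l < x" "x < r" for x
  proof -
    have "(shot P0 has_real_derivative V P0 x) (at x within {l..r})" by (rule shot_deriv) (use that in simp)
    then show ?thesis unfolding at[OF that] U_def U1_def .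
  qed
  have d2: "(U1 has_real_derivative U2 x) (at x)" if "l < x" "x < r" for x
  proof -
    have "(slope P0 U has_real_derivative \<beta> ((U x - w x) / h)) (at x within {l..r})"
      unfolding U_def by (rule slope_deriv[OF shot(1)]) (use that in simp)
    then have "(slope P0 U has_real_derivative \<beta> ((U x - w x) / h)) (at x)" unfolding at[OF that] .
    then show ?thesis unfolding U1_def V_def U2_def U_def by (rule DERIV_chain2[OF H(1)])
  qed
  have gp: "g p > 0" for p using c(1) c(2)[of p] by linarith
  have eq: "g (U1 x) * U2 x = \<beta> ((U x - w x) / h)" for x using gp[of "U1 x"] by (simp add: U2_def)
  have neg: "U x \<le> w x" if "U2 x \<le> 0" for x
  proof -
    have "\<beta> ((U x - w x) / h) \<le> \<beta> 0" using eq[of x] gp[of "U1 x"] that \<beta>(2) by (metis mult_nonneg_nonpos less_imp_le)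
    then have "(U x - w x) / h \<le> 0" using \<beta>(1) by (simp add: strict_mono_less_eq)
    then show ?thesis using h by (simp add: field_simps)
  qed
  have pos: "U x \<ge> w x" if "U2 x \<ge> 0" for x
  proof -
    have "\<beta> ((U x - w x) / h) \<ge> \<beta> 0" using eq[of x] gp[of "U1 x"] that \<beta>(2) by (metis mult_nonneg_nonneg less_imp_le)
    then have "(U x - w x) / h \<ge> 0" using \<beta>(1) by (simp add: strict_mono_less_eq)
    then show ?thesis using h by (simp add: field_simps)
  qed
  have Uc: "continuous_on {l..r} U" and bd: "U l = w l" "U r = w r" using shot P0 shot_l by (auto simp: U_def)
  have "\<bar>U y - U x\<bar> \<le> S * (y - x)" if "l \<le> x" "x \<le> y" "y \<le> r" for x y
  proof (rule abs_leI)
    show "U y - U x \<le> S * (y - x)"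
      by (rule slope_bound_preserved[OF Uc bd d1 d2 neg pos _ that]) (use wS in force)+
    have "- U y - - U x \<le> S * (y - x)"
    proof (rule slope_bound_preserved[OF _ _ _ _ _ _ _ _ that, where U = "\<lambda>x. - U x" and ?U1.0 = "\<lambda>x. - U1 x"
          and ?U2.0 = "\<lambda>x. - U2 x" and w = "\<lambda>x. - w x"])
      show "- w y - - w x \<le> S * (y - x)" if "l \<le> x" "x \<le> y" "y \<le> r" for x y using wS[OF that] by simp
    qed (use Uc bd d1 d2 neg pos in \<open>auto intro!: continuous_intros DERIV_minus\<close>)
    then show "- (U y - U x) \<le> S * (y - x)" by simp
  qed
  then show ?thesis using that[OF Uc bd d1 d2 eq] by blast
qed

lemma inverse_of_expanding:
  fixes F :: "real \<Rightarrow> real"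
  assumes F: "continuous_on UNIV F" and k: "k > 0" "\<And>x y. x \<le> y \<Longrightarrow> k * (y - x) \<le> F y - F x" and F0: "F 0 = 0"
  obtains \<beta> where "strict_mono \<beta>" "\<beta> 0 = 0" "\<And>x y. \<bar>\<beta> x - \<beta> y\<bar> \<le> 1 / k * \<bar>x - y\<bar>"
    "\<And>y. F (\<beta> y) = y" "\<And>x. \<beta> (F x) = x"
proof -
  have mono: "strict_mono F"
  proof (rule strict_monoI)
    fix x y :: real assume "x < y"
    then have "k * (y - x) > 0" using k by simp
    then show "F x < F y" using k(2)[of x y] \<open>x < y\<close> by simp
  qed
  have "surj F"
    unfolding surj_def
  proof
    fix y
    define M where "M = \<bar>y\<bar> / k"
    have "k * M = \<bar>y\<bar>" using k by (simp add: M_def)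
    moreover have M: "M \<ge> 0" using k by (simp add: M_def)
    ultimately have "F M \<ge> y" "F (- M) \<le> y" using k(2)[of 0 M] k(2)[of "- M" 0] F0 by auto
    then have "\<exists>x\<ge>-M. x \<le> M \<and> F x = y"
      using M F continuous_on_subset by (intro IVT') auto
    then show "\<exists>x. y = F x" by auto
  qed
  then have bij: "bij F" using mono strict_mono_imp_inj_on bij_def by blast
  define \<beta> where "\<beta> = inv F"
  have F\<beta>: "F (\<beta> y) = y" "\<beta> (F x) = x" for x y
    using bij by (auto simp: \<beta>_def bij_def surj_f_inv_f)
  have "strict_mono \<beta>" by (rule strict_monoI) (metis F\<beta>(1) mono strict_mono_less)
  moreover have "\<beta> 0 = 0" using F\<beta>(2)[of 0] F0 by simp
  moreover have "\<bar>\<beta> x - \<beta> y\<bar> \<le> 1 / k * \<bar>x - y\<bar>" for x y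
  proof -
    have "\<beta> x \<le> \<beta> y \<or> \<beta> y \<le> \<beta> x" by auto
    then have "k * \<bar>\<beta> x - \<beta> y\<bar> \<le> \<bar>x - y\<bar>"
      using k(2)[of "\<beta> x" "\<beta> y"] k(2)[of "\<beta> y" "\<beta> x"] by (auto simp: F\<beta>)
    then show ?thesis using k by (simp add: field_simps)
  qed
  ultimately show ?thesis using F\<beta> that by blast
qed

lemma lipschitz_deriv_bound:
  fixes U :: "real \<Rightarrow> real"
  assumes x: "l < x" "x < r" and d: "(U has_real_derivative D) (at x)"
    and lip: "\<And>x y. l \<le> x \<Longrightarrow> x \<le> y \<Longrightarrow> y \<le> r \<Longrightarrow> \<bar>U y - U x\<bar> \<le> S * (y - x)"
  shows "\<bar>D\<bar> \<le> S"
proof (rule tendsto_upperbound)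
  have "((\<lambda>y. (U y - U x) / (y - x)) \<longlongrightarrow> D) (at x)" using d by (simp add: has_field_derivative_iff)
  then show "((\<lambda>y. \<bar>(U y - U x) / (y - x)\<bar>) \<longlongrightarrow> \<bar>D\<bar>) (at x)" by (rule tendsto_rabs)
  have "\<forall>\<^sub>F y in nhds x. y \<in> {l<..<r}" using x by (intro eventually_nhds_in_open) auto
  then have "\<forall>\<^sub>F y in at x. y \<in> {l<..<r} \<and> y \<noteq> x" 
    unfolding eventually_at_filter by (rule eventually_mono) auto
  then show "\<forall>\<^sub>F y in at x. \<bar>(U y - U x) / (y - x)\<bar> \<le> S"
  proof eventually_elim
    case (elim y)
    show ?case
    proof (cases "x < y")
      case True
      then show ?thesis using lip[of x y] x elim by (simp add: field_simps)
    next
      case False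
      then have "y < x" using elim by simp
      then show ?thesis using lip[of y x] x elim by (simp add: abs_minus_commute field_simps)
    qed
  qed
qed auto

text \<open>One step \<open>(U - W)/h = f(g(U') U'') + k g(U') U''\<close>. The small multiple of the identity added to \<open>f\<close> makes
  the inverse Lipschitz; \<open>g\<close> may be frozen outside \<open>[-S, S]\<close> because \<open>U\<close> stays \<open>S\<close>-Lipschitz.\<close>

lemma implicit_step_bounds:
  fixes f g W W1 W2 :: "real \<Rightarrow> real"
  assumes lr: "l < r" and f: "continuous_on UNIV f" "strict_mono f" "f 0 = 0"
    and g: "continuous_on UNIV g" "\<And>s. g s > 0"
    and k: "0 < k" "k \<le> 1" and h: "h > 0" and S: "S \<ge> 0"
    and W: "continuous_on {l..r} W"
    and WS: "\<And>x y. l \<le> x \<Longrightarrow> x \<le> y \<Longrightarrow> y \<le> r \<Longrightarrow> \<bar>W y - W x\<bar> \<le> S * (y - x)"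
    and W1: "\<And>x. l < x \<Longrightarrow> x < r \<Longrightarrow> (W has_real_derivative W1 x) (at x)"
    and W2: "\<And>x. l < x \<Longrightarrow> x < r \<Longrightarrow> (W1 has_real_derivative W2 x) (at x)"
    and K: "\<And>x. l < x \<Longrightarrow> x < r \<Longrightarrow> \<bar>g (W1 x) * W2 x\<bar> \<le> K" "K \<ge> 0"
  obtains U U1 U2 where "continuous_on {l..r} U" "U l = W l" "U r = W r"
    "\<And>x y. l \<le> x \<Longrightarrow> x \<le> y \<Longrightarrow> y \<le> r \<Longrightarrow> \<bar>U y - U x\<bar> \<le> S * (y - x)"
    "\<And>x. l < x \<Longrightarrow> x < r \<Longrightarrow> (U has_real_derivative U1 x) (at x)"
    "\<And>x. l < x \<Longrightarrow> x < r \<Longrightarrow> (U1 has_real_derivative U2 x) (at x)"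
    "\<And>x. l < x \<Longrightarrow> x < r \<Longrightarrow> \<bar>g (U1 x) * U2 x\<bar> \<le> K"
    "\<And>x. l < x \<Longrightarrow> x < r \<Longrightarrow> \<bar>f (g (U1 x) * U2 x) - (U x - W x) / h\<bar> \<le> k * K"
    "\<And>x. l \<le> x \<Longrightarrow> x \<le> r \<Longrightarrow> \<bar>U x - W x\<bar> \<le> (\<bar>f K\<bar> + \<bar>f (- K)\<bar> + K) * h"
proof -
  define F where "F s = f s + k * s" for s
  have "f x \<le> f y" if "x \<le> y" for x y using f(2) that by (simp add: strict_mono_less_eq)
  then have "\<And>x y. x \<le> y \<Longrightarrow> k * (y - x) \<le> F y - F x" by (simp add: F_def algebra_simps)
  moreover have "continuous_on UNIV F" unfolding F_def by (intro continuous_intros f)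
  ultimately obtain \<beta> where \<beta>: "strict_mono \<beta>" "\<beta> 0 = 0" "\<And>x y. \<bar>\<beta> x - \<beta> y\<bar> \<le> 1 / k * \<bar>x - y\<bar>"
      "\<And>y. F (\<beta> y) = y" "\<And>x. \<beta> (F x) = x"
    using k f(3) inverse_of_expanding[of F k] by (auto simp: F_def)
  define G where "G p = g (max (- S) (min S p))" for p
  have Gc: "continuous_on UNIV G" unfolding G_def
    by (rule continuous_on_compose2[OF g(1)]) (auto intro!: continuous_intros)
  have "continuous_on {- S..S} g" by (rule continuous_on_subset[OF g(1)]) auto
  then have "\<exists>x\<in>{- S..S}. \<forall>y\<in>{- S..S}. g x \<le> g y"
    using S by (intro continuous_attains_inf) auto
  then obtain p0 where p0: "\<And>p. p \<in> {- S..S} \<Longrightarrow> g p0 \<le> g p" by blast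
  have Gg: "G p \<ge> g p0" for p unfolding G_def by (rule p0) (use S in auto)
  have Geq: "G p = g p" if "\<bar>p\<bar> \<le> S" for p using that by (auto simp: G_def max_def min_def)
  obtain U U1 U2 where U: "continuous_on {l..r} U" "U l = W l" "U r = W r"
    "\<And>x. l < x \<Longrightarrow> x < r \<Longrightarrow> (U has_real_derivative U1 x) (at x)"
    "\<And>x. l < x \<Longrightarrow> x < r \<Longrightarrow> (U1 has_real_derivative U2 x) (at x)"
    "\<And>x. l < x \<Longrightarrow> x < r \<Longrightarrow> G (U1 x) * U2 x = \<beta> ((U x - W x) / h)"
    "\<And>x y. l \<le> x \<Longrightarrow> x \<le> y \<Longrightarrow> y \<le> r \<Longrightarrow> \<bar>U y - U x\<bar> \<le> S * (y - x)"
    by (rule implicit_step[OF lr Gc g(2)[of p0] Gg \<beta>(1-3) h W WS]) (assumption | rule that)+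
  have eq: "g (U1 x) * U2 x = \<beta> ((U x - W x) / h)" if "l < x" "x < r" for x
    using Geq[OF lipschitz_deriv_bound[OF that U(4)[OF that] U(7)]] U(6)[OF that] by simp
  have Dc: "continuous_on {l..r} (\<lambda>x. U x - W x)" by (intro continuous_intros U W)
  have \<beta>le: "\<beta> y \<le> \<beta> z \<longleftrightarrow> y \<le> z" for y z using \<beta>(1) by (rule strict_mono_less_eq)
  have FK: "F K \<ge> 0" "F (- K) \<le> 0"
  proof -
    have 1: "0 \<le> k * K" using k K(2) by simp
    have "f 0 \<le> f K" "f (- K) \<le> f 0" using f(2) K(2) by (simp_all add: strict_mono_less_eq)
    then show "F K \<ge> 0" "F (- K) \<le> 0" using 1 f(3) by (simp_all add: F_def)
  qed
  \<comment> \<open>At an interior maximum of \<open>U - W\<close> the slopes agree and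
    \<open>U2 \<le> W2\<close>, so \<open>\<beta> ((U - W) / h) = g W1 * U2 \<le> g W1 * W2 \<le> K
    = \<beta> (F K)\<close>. At the ends \<open>U = W\<close>. The lower bound is the same argument
    at a minimum.\<close>
  have up: "U x - W x \<le> F K * h" if x: "x \<in> {l..r}" for x
  proof -
    obtain x0 where x0: "x0 \<in> {l..r}" "\<And>x. x \<in> {l..r} \<Longrightarrow> U x - W x \<le> U x0 - W x0"
      using continuous_attains_sup[of "{l..r}", OF _ _ Dc] lr by auto
    have "U x0 - W x0 \<le> F K * h"
    proof (cases "x0 = l \<or> x0 = r")
      case False
      then have in': "l < x0" "x0 < r" using x0 by auto
      have m2: "((\<lambda>x. U1 x - W1 x) has_real_derivative (U2 x0 - W2 x0)) (at x0)"
        using U(5)[OF in'] W2[OF in'] by (rule DERIV_diff)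
      have m1: "((\<lambda>x. U x - W x) has_real_derivative (U1 x - W1 x)) (at x)" if "l < x" "x < r" for x
        using U(4)[OF that] W1[OF that] by (rule DERIV_diff)
      have m0: "U x - W x \<le> U x0 - W x0" if "l < x" "x < r" for x using x0(2)[of x] that by simp
      have *: "U1 x0 - W1 x0 = 0" "U2 x0 - W2 x0 \<le> 0"
        using second_derivative_interior_max[OF in' m0 m1 m2] by auto
      have "\<beta> ((U x0 - W x0) / h) = g (W1 x0) * U2 x0" using eq[OF in'] * by simp
      also have "\<dots> \<le> g (W1 x0) * W2 x0" using * g(2)[of "W1 x0"] by (intro mult_left_mono) auto
      also have "\<dots> \<le> \<beta> (F K)" using K(1)[OF in'] \<beta>(5) by simp
      finally show ?thesis using h by (simp add: \<beta>le field_simps)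
    qed (use U FK h in auto)
    then show ?thesis using x0(2)[OF x] by simp
  qed
  have down: "U x - W x \<ge> F (- K) * h" if x: "x \<in> {l..r}" for x
  proof -
    obtain x0 where x0: "x0 \<in> {l..r}" "\<And>x. x \<in> {l..r} \<Longrightarrow> U x - W x \<ge> U x0 - W x0"
      using continuous_attains_inf[of "{l..r}", OF _ _ Dc] lr by auto
    have "U x0 - W x0 \<ge> F (- K) * h"
    proof (cases "x0 = l \<or> x0 = r")
      case False
      then have in': "l < x0" "x0 < r" using x0 by auto
      have m2: "((\<lambda>x. W1 x - U1 x) has_real_derivative (W2 x0 - U2 x0)) (at x0)"
        using W2[OF in'] U(5)[OF in'] by (rule DERIV_diff)
      have m1: "((\<lambda>x. W x - U x) has_real_derivative (W1 x - U1 x)) (at x)" if "l < x" "x < r" for x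
        using W1[OF that] U(4)[OF that] by (rule DERIV_diff)
      have m0: "W x - U x \<le> W x0 - U x0" if "l < x" "x < r" for x using x0(2)[of x] that by simp
      have *: "W1 x0 - U1 x0 = 0" "W2 x0 - U2 x0 \<le> 0"
        using second_derivative_interior_max[OF in' m0 m1 m2] by auto
      have "\<beta> (F (- K)) \<le> g (W1 x0) * W2 x0" using K(1)[OF in'] \<beta>(5) by (simp add: abs_le_iff)
      also have "\<dots> \<le> g (W1 x0) * U2 x0" using * g(2)[of "W1 x0"] by (intro mult_left_mono) auto
      also have "\<dots> = \<beta> ((U x0 - W x0) / h)" using eq[OF in'] * by simp
      finally show ?thesis using h by (simp add: \<beta>le field_simps)
    qed (use U FK h in \<open>auto simp: mult_nonpos_nonneg\<close>)
    then show ?thesis using x0(2)[OF x] by simp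
  qed
  \<comment> \<open>The bounds for \<open>(U - W) / h\<close> come back through
    \<open>\<beta>\<close> as the bound \<open>K\<close> for the new iterate. This is the invariant
    that survives any number of steps.\<close>
  have b: "\<bar>g (U1 x) * U2 x\<bar> \<le> K" if "l < x" "x < r" for x
  proof -
    have "F (- K) \<le> (U x - W x) / h" "(U x - W x) / h \<le> F K"
      using up[of x] down[of x] that h by (auto simp: field_simps)
    then have "\<beta> (F (- K)) \<le> g (U1 x) * U2 x" "g (U1 x) * U2 x \<le> \<beta> (F K)" unfolding eq[OF that] by (auto simp: \<beta>le)
    then show ?thesis by (simp add: \<beta>(5) abs_le_iff)
  qed
  have res: "\<bar>f (g (U1 x) * U2 x) - (U x - W x) / h\<bar> \<le> k * K" if "l < x" "x < r" for x
  proof -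
    have "F (g (U1 x) * U2 x) = (U x - W x) / h" by (simp add: eq[OF that] \<beta>(4))
    then have "f (g (U1 x) * U2 x) - (U x - W x) / h = - (k * (g (U1 x) * U2 x))" by (simp add: F_def)
    then have "\<bar>f (g (U1 x) * U2 x) - (U x - W x) / h\<bar> = k * \<bar>g (U1 x) * U2 x\<bar>" using k by (simp add: abs_mult)
    also have "\<dots> \<le> k * K" using b[OF that] k by (intro mult_left_mono) auto
    finally show ?thesis .
  qed
  have "\<bar>U x - W x\<bar> \<le> (\<bar>f K\<bar> + \<bar>f (- K)\<bar> + K) * h" if "l \<le> x" "x \<le> r" for x
  proof -
    have "k * K \<le> K" using k K(2) by (simp add: mult_left_le_one_le)
    then have F': "F K \<le> \<bar>f K\<bar> + \<bar>f (- K)\<bar> + K" "- F (- K) \<le> \<bar>f K\<bar> + \<bar>f (- K)\<bar> + K" by (auto simp: F_def)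
    have "F K * h \<le> (\<bar>f K\<bar> + \<bar>f (- K)\<bar> + K) * h" "- F (- K) * h \<le> (\<bar>f K\<bar> + \<bar>f (- K)\<bar> + K) * h"
      using mult_right_mono[OF F'(1), of h] mult_right_mono[OF F'(2), of h] h by simp_all
    then show ?thesis using up[of x] down[of x] that by (simp add: abs_le_iff)
  qed
  then show ?thesis using that[OF U(1-3,7) U(4,5) b res] by blast
qed

text \<open>The interface between construction and comparison. \<open>C\<close> bounds both the
  initial speed and all increments per unit of time; the implicit equation is asked for only up to
  \<open>\<epsilon>\<close>, to leave room for the identity term added to \<open>f\<close>.\<close>

definition time_scheme :: "real \<Rightarrow> real \<Rightarrow> (real \<Rightarrow> real) \<Rightarrow> (real \<Rightarrow> real) \<Rightarrow> (real \<Rightarrow> real) \<Rightarrow> real \<Rightarrow> real \<Rightarrow> real \<Rightarrow>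
    (nat \<Rightarrow> real \<Rightarrow> real) \<Rightarrow> (nat \<Rightarrow> real \<Rightarrow> real) \<Rightarrow> (nat \<Rightarrow> real \<Rightarrow> real) \<Rightarrow> bool" where
  "time_scheme l r f g w0 C h \<epsilon> U U1 U2 \<longleftrightarrow>
      U 0 = w0 \<and> (\<forall>n. U n l = w0 l \<and> U n r = w0 r \<and> continuous_on {l..r} (U n)) \<and>
      (\<forall>n x. l < x \<and> x < r \<longrightarrow> (U n has_real_derivative U1 n x) (at x) \<and> (U1 n has_real_derivative U2 n x) (at x)) \<and>
      (\<forall>n x. l \<le> x \<and> x \<le> r \<longrightarrow> \<bar>U (Suc n) x - U n x\<bar> \<le> C * h) \<and>
      (\<forall>x. l < x \<and> x < r \<longrightarrow> \<bar>f (g (U1 0 x) * U2 0 x)\<bar> \<le> C) \<and>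
      (\<forall>n x. l < x \<and> x < r \<longrightarrow> \<bar>f (g (U1 (Suc n) x) * U2 (Suc n) x) - (U (Suc n) x - U n x) / h\<bar> \<le> \<epsilon>)"

text \<open>\<open>C\<close> is fixed before \<open>h\<close> and \<open>\<epsilon>\<close>: the
  Lipschitz bound \<open>S\<close> and the bound \<open>K\<close> for \<open>g W1 * W2\<close> are
  read off from the initial data and pass unchanged from one iterate to the next.\<close>

lemma implicit_scheme:
  fixes f g w0 w1 w2 :: "real \<Rightarrow> real"
  assumes lr: "l < r" and f: "continuous_on UNIV f" "strict_mono f" "f 0 = 0"
    and g: "continuous_on UNIV g" "\<And>s. g s > 0"
    and w1: "\<And>x. (w0 has_real_derivative w1 x) (at x)"
    and w2: "\<And>x. (w1 has_real_derivative w2 x) (at x)" "continuous_on {l..r} w2"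
  obtains C where "C \<ge> 0" "\<And>h \<epsilon>. h > 0 \<Longrightarrow> \<epsilon> > 0 \<Longrightarrow> \<exists>U U1 U2. time_scheme l r f g w0 C h \<epsilon> U U1 U2"
proof -
  have w0c: "continuous_on UNIV w0" and w1c: "continuous_on UNIV w1"
    by (auto simp: continuous_on_eq_continuous_at intro: DERIV_isCont[OF w1] DERIV_isCont[OF w2(1)])
  have "bounded (w1 ` {l..r})"
    using compact_continuous_image[of "{l..r}" w1] w1c continuous_on_subset compact_imp_bounded by blast
  then obtain S where "\<forall>y\<in>w1 ` {l..r}. norm y \<le> S" unfolding bounded_iff by blast
  then have S: "\<And>x. x \<in> {l..r} \<Longrightarrow> \<bar>w1 x\<bar> \<le> S" by auto
  have S0: "S \<ge> 0" using S[of l] lr by simp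
  have "continuous_on {l..r} (\<lambda>x. g (w1 x) * w2 x)"
    by (intro continuous_intros w2 continuous_on_compose2[OF g(1)] continuous_on_subset[OF w1c]) auto
  then have "bounded ((\<lambda>x. g (w1 x) * w2 x) ` {l..r})"
    using compact_continuous_image[of "{l..r}"] compact_imp_bounded by blast
  then obtain K where "\<forall>y\<in>(\<lambda>x. g (w1 x) * w2 x) ` {l..r}. norm y \<le> K" unfolding bounded_iff by blast
  then have K: "\<And>x. x \<in> {l..r} \<Longrightarrow> \<bar>g (w1 x) * w2 x\<bar> \<le> K" by auto
  have K0: "K \<ge> 0" using K[of l] lr by simp
  define C where "C = \<bar>f K\<bar> + \<bar>f (- K)\<bar> + K"
  have lip0: "\<bar>w0 y - w0 x\<bar> \<le> S * (y - x)" if "l \<le> x" "x \<le> y" "y \<le> r" for x y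
  proof (cases "x = y")
    case False
    then have "x < y" using that by simp
    then obtain z where z: "x < z" "z < y" "w0 y - w0 x = (y - x) * w1 z" using MVT2[of x y w0 w1] w1 by auto
    then have "\<bar>w0 y - w0 x\<bar> = (y - x) * \<bar>w1 z\<bar>" using that by (simp add: abs_mult)
    also have "\<dots> \<le> (y - x) * S" using S[of z] z that by (intro mult_left_mono) auto
    finally show ?thesis by (simp add: mult.commute)
  qed auto
  have step: "\<exists>U U1 U2. time_scheme l r f g w0 C h \<epsilon> U U1 U2"
    if h: "h > 0" and e: "\<epsilon> > 0" for h \<epsilon>
  proof -
    \<comment> \<open>Chosen so that the residual \<open>k * K\<close> of a step is at most
      \<open>\<epsilon>\<close>; the added 1 covers the case \<open>K = 0\<close>.\<close>
    define k where "k = min 1 (\<epsilon> / (K + 1))"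
    have k: "0 < k" "k \<le> 1" using e K0 by (auto simp: k_def)
    have "k * (K + 1) \<le> \<epsilon> / (K + 1) * (K + 1)" using K0 by (intro mult_right_mono) (auto simp: k_def)
    also have "\<epsilon> / (K + 1) * (K + 1) = \<epsilon>" using K0 by simp
    finally have kK: "k * K \<le> \<epsilon>" using k by (simp add: distrib_left)
    define good where "good s \<longleftrightarrow> (case s of (W, W1, W2) \<Rightarrow> continuous_on {l..r} W \<and> W l = w0 l \<and> W r = w0 r \<and>
        (\<forall>x y. l \<le> x \<longrightarrow> x \<le> y \<longrightarrow> y \<le> r \<longrightarrow> \<bar>W y - W x\<bar> \<le> S * (y - x)) \<and>
        (\<forall>x. l < x \<longrightarrow> x < r \<longrightarrow> (W has_real_derivative W1 x) (at x)) \<and>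
        (\<forall>x. l < x \<longrightarrow> x < r \<longrightarrow> (W1 has_real_derivative W2 x) (at x)) \<and>
        (\<forall>x. l < x \<longrightarrow> x < r \<longrightarrow> \<bar>g (W1 x) * W2 x\<bar> \<le> K))"
      for s :: "(real \<Rightarrow> real) \<times> (real \<Rightarrow> real) \<times> (real \<Rightarrow> real)"
    define next_step where "next_step s s' \<longleftrightarrow> (case s of (W, W1, W2) \<Rightarrow> case s' of (U, U1, U2) \<Rightarrow>
        (\<forall>x. l < x \<longrightarrow> x < r \<longrightarrow> \<bar>f (g (U1 x) * U2 x) - (U x - W x) / h\<bar> \<le> k * K) \<and>
        (\<forall>x. l \<le> x \<longrightarrow> x \<le> r \<longrightarrow> \<bar>U x - W x\<bar> \<le> C * h))"
      for s s' :: "(real \<Rightarrow> real) \<times> (real \<Rightarrow> real) \<times> (real \<Rightarrow> real)"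
    have "\<exists>s. \<forall>n. (good (s n) \<and> (n = 0 \<longrightarrow> s n = (w0, w1, w2))) \<and> next_step (s n) (s (Suc n))"
    proof (rule dependent_nat_choice)
      have "good (w0, w1, w2)"
        using lip0 w1 w2 K continuous_on_subset[OF w0c] by (auto simp: good_def)
      then show "\<exists>s. good s \<and> (0 = (0::nat) \<longrightarrow> s = (w0, w1, w2))" by blast
      fix s and n :: nat assume "good s \<and> (n = 0 \<longrightarrow> s = (w0, w1, w2))"
      moreover obtain W W1 W2 where s: "s = (W, W1, W2)" by (cases s) auto
      ultimately have W: "continuous_on {l..r} W" "W l = w0 l" "W r = w0 r"
        "\<And>x y. l \<le> x \<Longrightarrow> x \<le> y \<Longrightarrow> y \<le> r \<Longrightarrow> \<bar>W y - W x\<bar> \<le> S * (y - x)"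
        "\<And>x. l < x \<Longrightarrow> x < r \<Longrightarrow> (W has_real_derivative W1 x) (at x)"
        "\<And>x. l < x \<Longrightarrow> x < r \<Longrightarrow> (W1 has_real_derivative W2 x) (at x)"
        "\<And>x. l < x \<Longrightarrow> x < r \<Longrightarrow> \<bar>g (W1 x) * W2 x\<bar> \<le> K"
        by (simp_all add: good_def)
      obtain U U1 U2 where "continuous_on {l..r} U" "U l = W l" "U r = W r"
        "\<And>x y. l \<le> x \<Longrightarrow> x \<le> y \<Longrightarrow> y \<le> r \<Longrightarrow> \<bar>U y - U x\<bar> \<le> S * (y - x)"
        "\<And>x. l < x \<Longrightarrow> x < r \<Longrightarrow> (U has_real_derivative U1 x) (at x)"
        "\<And>x. l < x \<Longrightarrow> x < r \<Longrightarrow> (U1 has_real_derivative U2 x) (at x)"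
        "\<And>x. l < x \<Longrightarrow> x < r \<Longrightarrow> \<bar>g (U1 x) * U2 x\<bar> \<le> K"
        "\<And>x. l < x \<Longrightarrow> x < r \<Longrightarrow> \<bar>f (g (U1 x) * U2 x) - (U x - W x) / h\<bar> \<le> k * K"
        "\<And>x. l \<le> x \<Longrightarrow> x \<le> r \<Longrightarrow> \<bar>U x - W x\<bar> \<le> (\<bar>f K\<bar> + \<bar>f (- K)\<bar> + K) * h"
        by (rule implicit_step_bounds[OF lr f g k h S0 W(1,4,5,6,7) K0]) (assumption | rule that)+
      then have "good (U, U1, U2) \<and> next_step s (U, U1, U2)"
        using W(2,3) by (simp add: good_def next_step_def s C_def)
      then show "\<exists>s'. (good s' \<and> (Suc n = 0 \<longrightarrow> s' = (w0, w1, w2))) \<and> next_step s s'" by blast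
    qed
    then obtain s where s: "\<And>n. good (s n)" "s 0 = (w0, w1, w2)" "\<And>n. next_step (s n) (s (Suc n))" by blast
    define U where "U n = fst (s n)" for n
    define U1 where "U1 n = fst (snd (s n))" for n
    define U2 where "U2 n = snd (snd (s n))" for n
    have sU: "s n = (U n, U1 n, U2 n)" for n by (simp add: U_def U1_def U2_def)
    have f0: "\<bar>f (g (U1 0 x) * U2 0 x)\<bar> \<le> C" if x: "l < x" "x < r" for x
    proof -
      have "- K \<le> g (U1 0 x) * U2 0 x" "g (U1 0 x) * U2 0 x \<le> K"
        using K[of x] x s(2) sU[of 0] by (auto simp: abs_le_iff)
      then have "f (- K) \<le> f (g (U1 0 x) * U2 0 x)" "f (g (U1 0 x) * U2 0 x) \<le> f K"
        using f(2) by (auto simp: strict_mono_less_eq)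
      then show ?thesis using K0 by (auto simp: C_def)
    qed
    have g': "continuous_on {l..r} (U n) \<and> U n l = w0 l \<and> U n r = w0 r"
      "l < x \<Longrightarrow> x < r \<Longrightarrow> (U n has_real_derivative U1 n x) (at x)"
      "l < x \<Longrightarrow> x < r \<Longrightarrow> (U1 n has_real_derivative U2 n x) (at x)" for n x
      using s(1)[of n] by (auto simp: good_def sU)
    have n': "l < x \<Longrightarrow> x < r \<Longrightarrow> \<bar>f (g (U1 (Suc n) x) * U2 (Suc n) x) - (U (Suc n) x - U n x) / h\<bar> \<le> k * K"
      "l \<le> x \<Longrightarrow> x \<le> r \<Longrightarrow> \<bar>U (Suc n) x - U n x\<bar> \<le> C * h" for n x
      using s(3)[of n] by (auto simp: next_step_def sU)
    have "U 0 = w0" using s(2) sU[of 0] by simp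
    have res: "l < x \<Longrightarrow> x < r \<Longrightarrow> \<bar>f (g (U1 (Suc n) x) * U2 (Suc n) x) - (U (Suc n) x - U n x) / h\<bar> \<le> \<epsilon>" for n x
      using n'(1)[of x n] kK by linarith
    show ?thesis
      unfolding time_scheme_def
      by (intro exI[of _ U] exI[of _ U1] exI[of _ U2] conjI allI impI)
         (use \<open>U 0 = w0\<close> g' n'(2) f0 res in \<open>simp_all del: abs_le_iff\<close>)
  qed
  have "C \<ge> 0" using K0 by (simp add: C_def)
  then show ?thesis using step by (rule that)
qed

section \<open>Comparison in the interior\<close>

text \<open>Completing the square: a drift of speed \<open>C\<close> is outweighed by the quadratic
  penalty of the doubled time up to an error of order \<open>\<delta>\<close>.\<close>

lemma linear_minus_square:
  fixes C s \<delta> :: real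
  assumes "\<delta> > 0"
  shows "C * s - s^2 / (2 * \<delta>) \<le> C^2 * \<delta> / 2"
proof -
  have "0 \<le> (s - C * \<delta>)^2 / (2 * \<delta>)" using assms by simp
  also have "(s - C * \<delta>)^2 / (2 * \<delta>) = s^2 / (2 * \<delta>) - C * s + C^2 * \<delta> / 2"
    using assms by (simp add: field_simps power2_eq_square)
  finally show ?thesis by simp
qed

text \<open>Maximise \<open>u(x, t) - U n x - (t - n h)\<^sup>2/(2\<delta>) - \<sigma>/(T - t)\<close> over \<open>x\<close>, \<open>t\<close> and \<open>n\<close>.\<close>

lemma jet_sub_le_scheme:
  fixes U U1 U2 :: "nat \<Rightarrow> real \<Rightarrow> real"
  assumes u: "jet_sub b f g u" "usc_on (Q0 b) u" and f: "continuous_on UNIV f"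
    and lr: "-b < l" "l < r" "r < b" and T: "T > 0" and C: "C \<ge> 0"
    and U: "\<And>n. continuous_on {l..r} (U n)" "\<And>n. U n l = U 0 l" "\<And>n. U n r = U 0 r"
    and U1: "\<And>n x. l < x \<Longrightarrow> x < r \<Longrightarrow> (U n has_real_derivative U1 n x) (at x)"
    and U2: "\<And>n x. l < x \<Longrightarrow> x < r \<Longrightarrow> (U1 n has_real_derivative U2 n x) (at x)"
    and lip: "\<And>n x. l \<le> x \<Longrightarrow> x \<le> r \<Longrightarrow> U n x - U (Suc n) x \<le> C * h"
    and f0: "\<And>x. l < x \<Longrightarrow> x < r \<Longrightarrow> f (g (U1 0 x) * U2 0 x) \<le> C"
    and step: "\<And>n x. l < x \<Longrightarrow> x < r \<Longrightarrow> f (g (U1 (Suc n) x) * U2 (Suc n) x) \<le> (U (Suc n) x - U n x) / h + \<epsilon>"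
    and h: "h > 0" and \<delta>: "\<delta> > 0" and \<sigma>: "\<sigma> > 0" and small: "h / (2 * \<delta>) + \<epsilon> < \<sigma> / T^2" and e: "e \<ge> 0"
    and lat: "\<And>t. 0 \<le> t \<Longrightarrow> t < T \<Longrightarrow> u (l, t) \<le> U 0 l + e" "\<And>t. 0 \<le> t \<Longrightarrow> t < T \<Longrightarrow> u (r, t) \<le> U 0 r + e"
    and init: "\<And>x. l \<le> x \<Longrightarrow> x \<le> r \<Longrightarrow> u (x, 0) \<le> U 0 x + e"
    and xt: "l \<le> x" "x \<le> r" "0 \<le> t" "t < T"
  shows "u (x, t) \<le> U n x + e + (t - real n * h)^2 / (2 * \<delta>) + \<sigma> / (T - t) + C^2 * \<delta> / 2"
proof (rule ccontr)
  assume neg: "\<not> ?thesis"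
  \<comment> \<open>The first iterate moves with speed at most \<open>C\<close>, so adding
    \<open>C * t\<close> to it gives a classical barrier. This handles the index 0, which has no
    implicit equation.\<close>
  have early: "u (x, t) \<le> U 0 x + e + C * t" if "l \<le> x" "x \<le> r" "0 \<le> t" "t < T" for x t
  proof -
    have "u (x, t) \<le> (U 0 x + e) + C * (t - 0)"
    proof (rule jet_sub_le_barrier[OF u f lr(1) _ lr(3), where A = "\<lambda>x. U 0 x + e" and ?A1.0 = "U1 0" and ?A2.0 = "U2 0"])
      show "u (l, t) \<le> U 0 l + e + C * (t - 0)" if "0 \<le> t" "t < T" for t
        using lat(1)[OF that] mult_nonneg_nonneg[OF C that(1)] by simp
      show "u (r, t) \<le> U 0 r + e + C * (t - 0)" if "0 \<le> t" "t < T" for t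
        using lat(2)[OF that] mult_nonneg_nonneg[OF C that(1)] by simp
      show "((\<lambda>x. U 0 x + e) has_real_derivative U1 0 x) (at x)" if "l < x" "x < r" for x
        using U1[OF that, of 0] by (auto intro!: derivative_eq_intros)
    qed (use that lr U U2 f0 init in \<open>auto intro!: continuous_intros\<close>)
    then show ?thesis by simp
  qed
  define E where "E = e + C^2 * \<delta> / 2"
  have E: "E \<ge> e" "E \<ge> 0" using \<delta> e by (auto simp: E_def)
  define B where "B n t = (t - real n * h)^2 / (2 * \<delta>) + \<sigma> / (T - t)" for n t
  define \<Psi> where "\<Psi> n y = u y - (U n (fst y) + B n (snd y))" for n y
  have lipn: "U 0 x - U n x \<le> C * (real n * h)" if "l \<le> x" "x \<le> r" for n x
  proof (induction n)
    case (Suc n)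
    then show ?case using lip[OF that, of n] by (simp add: algebra_simps)
  qed auto
  have Ucont: "continuous_on ({l..r} \<times> S) (\<lambda>y. U n (fst y))" for n and S :: "real set"
    by (rule continuous_on_compose2[OF U(1)]) (auto intro!: continuous_intros)
  have K0: "{l..r} \<times> {0..T'} \<subseteq> Q0 b" for T' using lr by (auto simp: Q0_def)
  have "\<exists>M. \<forall>y\<in>{l..r} \<times> {0..T}. u y - U k (fst y) \<le> M" for k
  proof -
    have "usc_on ({l..r} \<times> {0..T}) (\<lambda>y. u y - U k (fst y))"
      by (intro usc_on_diff_continuous usc_on_subset[OF u(2) K0] Ucont)
    moreover have "compact ({l..r} \<times> {0..T})" by (intro compact_Times) auto
    ultimately show ?thesis by (meson usc_bounded_above)
  qed
  then obtain M where M: "\<And>k y. y \<in> {l..r} \<times> {0..T} \<Longrightarrow> u y - U k (fst y) \<le> M k" by metis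
  \<comment> \<open>Restricting to indices at most \<open>n\<close> makes the bound uniform and the
    maximum over the index a finite one. Nothing is lost: the argument compares the maximal index
    only with its predecessor.\<close>
  define M' where "M' = (\<Sum>k\<le>n. \<bar>M k\<bar>) + 1"
  have M': "M' > 0" "\<And>k. k \<le> n \<Longrightarrow> M k \<le> M'"
  proof -
    show "M' > 0" unfolding M'_def by (intro add_nonneg_pos sum_nonneg) auto
    show "M k \<le> M'" if "k \<le> n" for k
      using member_le_sum[of k "{..n}" "\<lambda>k. \<bar>M k\<bar>"] that by (auto simp: M'_def)
  qed
  define T' where "T' = max t (T - \<sigma> / M')"
  have T': "t \<le> T'" "T' < T" "T - T' \<le> \<sigma> / M'" using \<sigma> M' xt by (auto simp: T'_def)
  let ?K = "{l..r} \<times> {0..T'}"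
  have "\<exists>z\<in>?K. \<forall>y\<in>?K. \<Psi> k y \<le> \<Psi> k z" for k
  proof -
    have "usc_on ?K (\<Psi> k)"
      unfolding \<Psi>_def B_def
      by (intro usc_on_diff_continuous usc_on_subset[OF u(2) K0] continuous_intros Ucont) (use T' \<delta> in auto)
    moreover have "compact ?K" by (intro compact_Times) auto
    moreover have "?K \<noteq> {}" using xt T' by auto
    ultimately show ?thesis by (metis usc_attains_max)
  qed
  then obtain z where z: "\<And>k. z k \<in> ?K" "\<And>k y. y \<in> ?K \<Longrightarrow> \<Psi> k y \<le> \<Psi> k (z k)" by metis
  have "\<exists>m\<in>{..n}. \<forall>k\<in>{..n}. \<Psi> k (z k) \<le> \<Psi> m (z m)"
  proof -
    have "\<exists>m. is_arg_min (\<lambda>k. - \<Psi> k (z k)) (\<lambda>k. k \<in> {..n}) m"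
      by (rule ex_is_arg_min_if_finite) auto
    then show ?thesis unfolding is_arg_min_linorder by auto
  qed
  then obtain m where m: "m \<le> n" "\<And>k. k \<le> n \<Longrightarrow> \<Psi> k (z k) \<le> \<Psi> m (z m)" by auto
  obtain x0 t0 where z0: "z m = (x0, t0)" by fastforce
  have x0: "l \<le> x0" "x0 \<le> r" "0 \<le> t0" "t0 \<le> T'" using z(1)[of m] z0 by auto
  have "\<Psi> n (x, t) > E" using neg by (simp add: \<Psi>_def B_def E_def)
  then have pos: "\<Psi> m (x0, t0) > E" using z(2)[of "(x, t)" n] m(2)[of n] xt T' z0 by auto
  have zm: "\<Psi> k y \<le> \<Psi> m (x0, t0)" if "k \<le> n" "y \<in> {l..r} \<times> {0..<T}" for k y
  proof (cases "snd y \<le> T'")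
    case True
    then have "y \<in> ?K" using that by auto
    then show ?thesis using z(2)[of y k] m(2)[OF that(1)] z0 by simp
  next
    case False
    then have s: "snd y > T'" "snd y < T" using that by auto
    then have "T - snd y \<le> \<sigma> / M'" "T - snd y > 0" using T' by auto
    then have "\<sigma> / (T - snd y) \<ge> M'" using M' by (simp add: field_simps)
    moreover have "0 \<le> (snd y - real k * h)^2 / (2 * \<delta>)" using \<delta> by simp
    moreover have "u y - U k (fst y) \<le> M k" using M[of y k] that by force
    ultimately have "\<Psi> k y \<le> 0" using M'(2)[OF that(1)] unfolding \<Psi>_def B_def by linarith
    then show ?thesis using pos E by simp
  qed
  have t0T: "t0 < T" using x0 T' by simp
  have \<Psi>le: "\<Psi> m (x0, t0) \<le> u (x0, t0) - U m x0 - (t0 - real m * h)^2 / (2 * \<delta>)"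
    using \<sigma> t0T by (simp add: \<Psi>_def B_def)
  have sq: "0 \<le> (t0 - real m * h)^2 / (2 * \<delta>)" using \<delta> by simp
  have "x0 \<noteq> l" "x0 \<noteq> r"
    using lat(1)[OF x0(3) t0T] lat(2)[OF x0(3) t0T] U(2,3)[of m] pos \<Psi>le sq E by auto
  \<comment> \<open>At time 0 the \<open>m\<close>-th iterate is at most \<open>C * (m * h)\<close>
    below the first one, and the quadratic penalty pays for this up to
    \<open>C^2 * \<delta> / 2\<close>. The case \<open>m = 0\<close> below is its mirror image, with
    \<open>early\<close> in place of \<open>lipn\<close>.\<close>
  moreover have "t0 \<noteq> 0"
  proof
    assume 0: "t0 = 0"
    have "\<Psi> m (x0, t0) \<le> e + (C * (real m * h) - (real m * h)^2 / (2 * \<delta>))"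
      using \<Psi>le init[OF x0(1,2)] lipn[OF x0(1,2), of m] by (simp add: 0)
    then show False using linear_minus_square[OF \<delta>, of C "real m * h"] pos E_def by simp
  qed
  moreover have "m \<noteq> 0"
  proof
    assume 0: "m = 0"
    have "\<Psi> m (x0, t0) \<le> e + (C * t0 - t0^2 / (2 * \<delta>))"
      using \<Psi>le early[OF x0(1-3) t0T] by (simp add: 0)
    then show False using linear_minus_square[OF \<delta>, of C t0] pos E_def by simp
  qed
  ultimately have int: "l < x0" "x0 < r" "0 < t0" and "m \<noteq> 0" using x0 by auto
  then obtain k where k: "m = Suc k" using not0_implies_Suc by blast
  have zQ: "(x0, t0) \<in> Q b" using int lr by (auto simp: Q_def)
  have "(t0 - real m * h) / \<delta> + \<sigma> / (T - t0)^2 \<le> f (g (U1 m x0) * U2 m x0)"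
  proof (rule jet_sub_separated[OF u(1) f zQ, where A = "U m" and B = "B m"
        and ?B1.0 = "\<lambda>s. (s - real m * h) / \<delta> + \<sigma> / (T - s)^2" and ?B2.0 = "1 / \<delta> + 2 * \<sigma> / (T - t0)^3"])
    have "t0 < (t0 + T)/2" "(t0 + T)/2 < T" using t0T by auto
    then show "\<forall>\<^sub>F y in nhds (x0, t0). u y - U m (fst y) - B m (snd y) \<le> u (x0, t0) - U m x0 - B m t0"
      using zm[OF m(1)] by (intro interior_maximum[OF int(1-3), of "(t0 + T)/2"]) (auto simp: \<Psi>_def algebra_simps)
    have "\<forall>\<^sub>F x in nhds x0. x \<in> {l<..<r}" using int by (intro eventually_nhds_in_open) auto
    then show "\<forall>\<^sub>F x in nhds x0. (U m has_real_derivative U1 m x) (at x)"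
      by eventually_elim (use U1 in auto)
    show "(U1 m has_real_derivative U2 m x0) (at x0)" using U2 int by auto
    have "\<forall>\<^sub>F s in nhds t0. s \<in> {..<T}" using t0T by (intro eventually_nhds_in_open) auto
    then show "\<forall>\<^sub>F s in nhds t0. (B m has_real_derivative ((s - real m * h) / \<delta> + \<sigma> / (T - s)^2)) (at s)"
    proof eventually_elim
      case (elim s)
      define y where "y = T - s"
      have y: "y \<noteq> 0" using elim by (simp add: y_def)
      have "(B m has_real_derivative (2 * (s - real m * h) / (2 * \<delta>) + - (\<sigma> * - 1) / (y * y))) (at s)"
        unfolding B_def y_def using y \<delta> y_def
        by (auto intro!: derivative_eq_intros) (simp add: field_simps)
      moreover have "2 * (s - real m * h) / (2 * \<delta>) + - (\<sigma> * - 1) / (y * y) = (s - real m * h) / \<delta> + \<sigma> / y^2"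
      proof -
        have "2 * (s - real m * h) / (2 * \<delta>) = (s - real m * h) / \<delta>" by (rule mult_divide_mult_cancel_left) simp
        then show ?thesis by (simp only: power2_eq_square mult_minus_right mult_1_right minus_minus minus_divide_left)
      qed
      ultimately show ?case by (simp only: y_def)
    qed
    show "((\<lambda>s. (s - real m * h) / \<delta> + \<sigma> / (T - s)^2) has_real_derivative 1 / \<delta> + 2 * \<sigma> / (T - t0)^3) (at t0)"
    proof -
      define y where "y = T - t0"
      have y: "y \<noteq> 0" using t0T by (simp add: y_def)
      have "((\<lambda>s. (s - real m * h) / \<delta> + \<sigma> / (T - s)^2) has_real_derivative
          1 / \<delta> + (- (\<sigma> * (2 * (y * - 1)))) / (y^2 * y^2)) (at t0)"
        using y \<delta> unfolding y_def by (auto intro!: derivative_eq_intros)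
      moreover have "(- (\<sigma> * (2 * (y * - 1)))) / (y^2 * y^2) = 2 * \<sigma> / y^3"
        using y by (simp add: field_simps power2_eq_square power3_eq_cube)
      ultimately show ?thesis by (simp only: y_def)
    qed
  qed
  also have "\<dots> \<le> (U m x0 - U k x0) / h + \<epsilon>" using step[OF int(1,2), of k] k by simp
  \<comment> \<open>Comparing the indices \<open>m\<close> and \<open>m - 1\<close> at the same
    point bounds the difference quotient of the iterates by that of the penalty. The two time
    derivatives cancel, and only \<open>\<sigma> / (T - t0)^2\<close> remains to contradict
    \<open>small\<close>.\<close>
  also have "(U m x0 - U k x0) / h \<le> (t0 - real m * h) / \<delta> + h / (2 * \<delta>)"
  proof -
    have "\<Psi> k (x0, t0) \<le> \<Psi> m (x0, t0)" using zm[of k "(x0, t0)"] k m(1) x0 t0T by auto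
    then have "U m x0 - U k x0 \<le> (t0 - real k * h)^2 / (2 * \<delta>) - (t0 - real m * h)^2 / (2 * \<delta>)"
      by (simp add: \<Psi>_def B_def)
    also have "\<dots> = ((t0 - real m * h) / \<delta> + h / (2 * \<delta>)) * h"
      using \<delta> by (simp add: k field_simps power2_eq_square)
    finally show ?thesis using h by (simp add: pos_divide_le_eq)
  qed
  finally have "\<sigma> / (T - t0)^2 \<le> h / (2 * \<delta>) + \<epsilon>" by simp
  moreover have "\<sigma> / T^2 \<le> \<sigma> / (T - t0)^2"
    using \<sigma> t0T int by (intro divide_left_mono power_mono) auto
  ultimately show False using small by simp
qed

text \<open>An iterate separates the two functions: \<open>u\<close> is at most \<open>U n\<close>
  and \<open>v\<close> is at least \<open>U n\<close>, each up to \<open>e\<close> and a part of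
  \<open>\<eta>\<close>. The second bound is the first one applied to \<open>- v\<close> and
  \<open>- U\<close>, which belong to the reflected equation.\<close>

lemma interior_comparison:
  assumes u: "jet_sub b f g u" "usc_on (Q0 b) u"
    and v: "jet_sub b (\<lambda>s. - f (- s)) (\<lambda>p. g (- p)) (\<lambda>z. - v z)" "usc_on (Q0 b) (\<lambda>z. - v z)"
    and f: "continuous_on UNIV f" "strict_mono f" "f 0 = 0"
    and g: "continuous_on UNIV g" "\<And>s. g s > 0"
    and lr: "-b < l" "l < r" "r < b" and T: "T > 0" and e: "e \<ge> 0"
    and w0: "continuous_on {l..r} w0"
    and lat: "\<And>t. 0 \<le> t \<Longrightarrow> t < T \<Longrightarrow> u (l, t) \<le> w0 l + e" "\<And>t. 0 \<le> t \<Longrightarrow> t < T \<Longrightarrow> u (r, t) \<le> w0 r + e"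
      "\<And>t. 0 \<le> t \<Longrightarrow> t < T \<Longrightarrow> v (l, t) \<ge> w0 l - e" "\<And>t. 0 \<le> t \<Longrightarrow> t < T \<Longrightarrow> v (r, t) \<ge> w0 r - e"
    and init: "\<And>x. l \<le> x \<Longrightarrow> x \<le> r \<Longrightarrow> u (x, 0) \<le> w0 x + e" "\<And>x. l \<le> x \<Longrightarrow> x \<le> r \<Longrightarrow> v (x, 0) \<ge> w0 x - e"
    and xt: "l \<le> x" "x \<le> r" "0 \<le> t" "t < T"
  shows "u (x, t) - v (x, t) \<le> 2 * e"
proof (rule field_le_epsilon)
  fix \<eta> :: real assume \<eta>: "\<eta> > 0"
  \<comment> \<open>The scheme starts from twice differentiable data; a polynomial close to
    \<open>w0\<close> provides them.\<close>
  obtain p where p: "real_polynomial_function p" "\<And>x. x \<in> {l..r} \<Longrightarrow> \<bar>w0 x - p x\<bar> < \<eta> / 8"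
    using Stone_Weierstrass_real_polynomial_function[OF _ w0, of "\<eta> / 8"] \<eta> by auto
  have "\<exists>p'. real_polynomial_function p' \<and> (\<forall>x. (p has_real_derivative p' x) (at x))"
    if "real_polynomial_function p" for p :: "real \<Rightarrow> real"
    using has_real_derivative_polynomial_function[OF that] by blast
  then obtain p1 p2 where p1: "real_polynomial_function p1" "\<And>x. (p has_real_derivative p1 x) (at x)"
    and p2: "real_polynomial_function p2" "\<And>x. (p1 has_real_derivative p2 x) (at x)"
    using p(1) by meson
  have p2c: "continuous_on {l..r} p2" using p2(1) by (intro continuous_on_polymonial_function) (simp add: real_polynomial_function_eq)
  obtain C where C: "C \<ge> 0" "\<And>h \<epsilon>. h > 0 \<Longrightarrow> \<epsilon> > 0 \<Longrightarrow> \<exists>U U1 U2. time_scheme l r f g p C h \<epsilon> U U1 U2"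
    by (rule implicit_scheme[OF lr(2) f g p1(2) p2(2) p2c]) (rule that)
  \<comment> \<open>Each of the two bounds spends \<open>\<eta> / 8\<close> on the polynomial and
    \<open>\<eta> / 16\<close> on each of the terms controlled by \<open>\<sigma>\<close>,
    \<open>\<delta>\<close> and \<open>h\<close>, altogether less than
    \<open>\<eta> / 2\<close>.\<close>
  define \<sigma> where "\<sigma> = \<eta> / 16 * (T - t)"
  have \<sigma>: "\<sigma> > 0" "\<sigma> / (T - t) = \<eta> / 16"
  proof -
    show "\<sigma> > 0" using \<eta> xt by (simp add: \<sigma>_def)
    show "\<sigma> / (T - t) = \<eta> / 16" unfolding \<sigma>_def by (rule nonzero_mult_div_cancel_right) (use xt in simp)
  qed
  define c where "c = C^2 + 1"
  have c: "c > 0" unfolding c_def by (intro add_nonneg_pos) auto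
  define \<delta> where "\<delta> = \<eta> / (8 * c)"
  have \<delta>: "\<delta> > 0" using \<eta> c by (simp add: \<delta>_def)
  have C\<delta>: "C^2 * \<delta> / 2 \<le> \<eta> / 16"
  proof -
    have "C^2 * \<delta> \<le> c * \<delta>" using \<delta> by (intro mult_right_mono) (auto simp: c_def)
    also have "\<dots> = \<eta> / 8" using c by (simp add: \<delta>_def)
    finally show ?thesis by linarith
  qed
  define \<epsilon> where "\<epsilon> = \<sigma> / T^2 / 4"
  have \<epsilon>: "\<epsilon> > 0" using \<sigma> T by (simp add: \<epsilon>_def)
  \<comment> \<open>The first entry gives \<open>h / (2 * \<delta>) \<le> \<epsilon>\<close>, the
    other two give \<open>h^2 / (2 * \<delta>) \<le> \<eta> / 16\<close>.\<close>
  define h where "h = min (2 * \<delta> * \<epsilon>) (min 1 (\<delta> * \<eta> / 8))"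
  have h: "h > 0" "h \<le> 2 * \<delta> * \<epsilon>" "h \<le> 1" "h \<le> \<delta> * \<eta> / 8" using \<delta> \<epsilon> \<eta> by (auto simp: h_def)
  have "h / (2 * \<delta>) \<le> \<epsilon>" using h(2) \<delta> by (simp add: pos_divide_le_eq mult.commute)
  then have small: "h / (2 * \<delta>) + \<epsilon> < \<sigma> / T^2" 
    using \<epsilon> \<epsilon>_def by (simp add: field_simps)
  have "h^2 \<le> h" using h by (simp add: power2_eq_square mult_left_le_one_le)
  then have "h^2 / (2 * \<delta>) \<le> (\<delta> * \<eta> / 8) / (2 * \<delta>)" using h \<delta> by (intro divide_right_mono) auto
  then have h2: "h^2 / (2 * \<delta>) \<le> \<eta> / 16" using \<delta> by simp
  obtain U U1 U2 where U0: "U 0 = p"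
    and SU: "\<forall>n. U n l = p l \<and> U n r = p r \<and> continuous_on {l..r} (U n)"
    and SD: "\<forall>n x. l < x \<and> x < r \<longrightarrow> (U n has_real_derivative U1 n x) (at x) \<and> (U1 n has_real_derivative U2 n x) (at x)"
    and SL: "\<forall>n x. l \<le> x \<and> x \<le> r \<longrightarrow> \<bar>U (Suc n) x - U n x\<bar> \<le> C * h"
    and SF: "\<forall>x. l < x \<and> x < r \<longrightarrow> \<bar>f (g (U1 0 x) * U2 0 x)\<bar> \<le> C"
    and SS: "\<forall>n x. l < x \<and> x < r \<longrightarrow> \<bar>f (g (U1 (Suc n) x) * U2 (Suc n) x) - (U (Suc n) x - U n x) / h\<bar> \<le> \<epsilon>"
    using C(2)[OF h(1) \<epsilon>] unfolding time_scheme_def by (elim exE conjE) (rule that)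
  have U: "U n l = p l" "U n r = p r" "continuous_on {l..r} (U n)" for n using SU by blast+
  have U1: "(U n has_real_derivative U1 n x) (at x)" and U2: "(U1 n has_real_derivative U2 n x) (at x)"
    if "l < x" "x < r" for n x using SD that by blast+
  have lip: "\<bar>U (Suc n) x - U n x\<bar> \<le> C * h" if "l \<le> x" "x \<le> r" for n x using SL that by blast
  have f0: "\<bar>f (g (U1 0 x) * U2 0 x)\<bar> \<le> C" if "l < x" "x < r" for x using SF that by blast
  have st: "\<bar>f (g (U1 (Suc n) x) * U2 (Suc n) x) - (U (Suc n) x - U n x) / h\<bar> \<le> \<epsilon>"
    if "l < x" "x < r" for n x using SS that by blast
  \<comment> \<open>The last time level not after \<open>t\<close>, so that \<open>t - n * h\<close>
    lies between 0 and \<open>h\<close>.\<close>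
  define n where "n = nat \<lfloor>t / h\<rfloor>"
  have "real n \<le> t / h" "t / h < real n + 1" using xt h by (auto simp: n_def)
  then have "0 \<le> t - real n * h" "t - real n * h \<le> h" using h by (auto simp: field_simps)
  then have "(t - real n * h)^2 \<le> h^2" by (intro power_mono)
  then have "(t - real n * h)^2 / (2 * \<delta>) \<le> h^2 / (2 * \<delta>)" using \<delta> by (intro divide_right_mono) auto
  then have tn: "(t - real n * h)^2 / (2 * \<delta>) \<le> \<eta> / 16" using h2 by linarith
  define e' where "e' = e + \<eta> / 8"
  have e': "e' \<ge> 0" using e \<eta> by (simp add: e'_def)
  have pl: "\<bar>w0 x - p x\<bar> \<le> \<eta> / 8" if "l \<le> x" "x \<le> r" for x using p(2)[of x] that by simp
  have plr: "\<bar>w0 l - p l\<bar> \<le> \<eta> / 8" "\<bar>w0 r - p r\<bar> \<le> \<eta> / 8" using pl lr by auto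
  have up: "u (x, t) \<le> U n x + e' + (t - real n * h)^2 / (2 * \<delta>) + \<sigma> / (T - t) + C^2 * \<delta> / 2"
  proof (rule jet_sub_le_scheme[OF u f(1) lr T C(1) U(3) _ _ U1 U2 _ _ _ h(1) \<delta> \<sigma>(1) small e' _ _ _ xt])
    show "U n x - U (Suc n) x \<le> C * h" if "l \<le> x" "x \<le> r" for n x using lip[OF that, of n] by linarith
    show "f (g (U1 0 x) * U2 0 x) \<le> C" if "l < x" "x < r" for x using f0[OF that] by linarith
    show "f (g (U1 (Suc n) x) * U2 (Suc n) x) \<le> (U (Suc n) x - U n x) / h + \<epsilon>" if "l < x" "x < r" for n x
      using st[OF that, of n] by linarith
    show "u (l, t) \<le> U 0 l + e'" if "0 \<le> t" "t < T" for t
      using lat(1)[OF that] plr(1) unfolding U0 e'_def by linarith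
    show "u (r, t) \<le> U 0 r + e'" if "0 \<le> t" "t < T" for t
      using lat(2)[OF that] plr(2) unfolding U0 e'_def by linarith
    show "u (x, 0) \<le> U 0 x + e'" if "l \<le> x" "x \<le> r" for x
      using init(1)[OF that] pl[OF that] unfolding U0 e'_def by linarith
  qed (simp_all add: U)
  have fd: "continuous_on UNIV (\<lambda>s. - f (- s))"
    by (intro continuous_intros continuous_on_compose2[OF f(1)]) auto
  have down: "- v (x, t) \<le> - U n x + e' + (t - real n * h)^2 / (2 * \<delta>) + \<sigma> / (T - t) + C^2 * \<delta> / 2"
  proof (rule jet_sub_le_scheme[OF v fd lr T C(1) _ _ _ _ _ _ _ _ h(1) \<delta> \<sigma>(1) small e' _ _ _ xt,
        where U = "\<lambda>n x. - U n x" and ?U1.0 = "\<lambda>n x. - U1 n x" and ?U2.0 = "\<lambda>n x. - U2 n x"])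
    show "((\<lambda>x. - U n x) has_real_derivative - U1 n x) (at x)" if "l < x" "x < r" for n x
      using U1[OF that] by (rule DERIV_minus)
    show "((\<lambda>x. - U1 n x) has_real_derivative - U2 n x) (at x)" if "l < x" "x < r" for n x
      using U2[OF that] by (rule DERIV_minus)
    show "- U n x - - U (Suc n) x \<le> C * h" if "l \<le> x" "x \<le> r" for n x using lip[OF that, of n] by linarith
    show "- f (- (g (- (- U1 0 x)) * - U2 0 x)) \<le> C" if "l < x" "x < r" for x using f0[OF that] by simp
    show "- f (- (g (- (- U1 (Suc n) x)) * - U2 (Suc n) x)) \<le> (- U (Suc n) x - - U n x) / h + \<epsilon>" if "l < x" "x < r" for n x
    proof -
      have "(- U (Suc n) x - - U n x) / h = - ((U (Suc n) x - U n x) / h)" by (simp add: diff_divide_distrib)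
      then show ?thesis using st[OF that, of n] by simp
    qed
    show "- v (l, t) \<le> - U 0 l + e'" if "0 \<le> t" "t < T" for t
      using lat(3)[OF that] plr(1) unfolding U0 e'_def by linarith
    show "- v (r, t) \<le> - U 0 r + e'" if "0 \<le> t" "t < T" for t
      using lat(4)[OF that] plr(2) unfolding U0 e'_def by linarith
    show "- v (x, 0) \<le> - U 0 x + e'" if "l \<le> x" "x \<le> r" for x
      using init(2)[OF that] pl[OF that] unfolding U0 e'_def by linarith
    show "continuous_on {l..r} (\<lambda>x. - U n x)" for n by (intro continuous_intros U)
  qed (simp_all add: U)
  show "u (x, t) - v (x, t) \<le> 2 * e + \<eta>"
    using up down tn C\<delta> \<sigma>(2) \<eta> unfolding e'_def by linarith
qed

section \<open>Barriers at the lateral boundary\<close>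

text \<open>All that the barriers take from the asymptotics of \<open>g\<close>. A single upper
  bound in \<open>|p|\<close> also makes the reflection of \<open>p\<close> immediate.\<close>

definition power_decay :: "real \<Rightarrow> (real \<Rightarrow> real) \<Rightarrow> bool" where
  "power_decay \<alpha> g \<longleftrightarrow> (\<exists>C R. 0 < R \<and> (\<forall>p. R \<le> \<bar>p\<bar> \<longrightarrow> g p \<le> C * \<bar>p\<bar> powr (-\<alpha>)))"

lemma power_decay_reflect: "power_decay \<alpha> g \<Longrightarrow> power_decay \<alpha> (\<lambda>p. g (- p))"
  unfolding power_decay_def by (metis abs_minus_cancel)

lemma power_decay_of_limits:
  fixes g :: "real \<Rightarrow> real"
  assumes "((\<lambda>s. \<bar>s\<bar> powr \<alpha> * g s) \<longlongrightarrow> Cp) at_top" "((\<lambda>s. \<bar>s\<bar> powr \<alpha> * g s) \<longlongrightarrow> Cm) at_bot"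
  shows "power_decay \<alpha> g"
proof -
  define C where "C = max (Cp + 1) (Cm + 1)"
  have "\<forall>\<^sub>F s in at_top. \<bar>s\<bar> powr \<alpha> * g s < C"
    by (rule order_tendstoD(2)[OF assms(1)]) (simp add: C_def)
  then obtain R1 where R1: "\<And>s. R1 \<le> s \<Longrightarrow> \<bar>s\<bar> powr \<alpha> * g s < C" by (auto simp: eventually_at_top_linorder)
  have "\<forall>\<^sub>F s in at_bot. \<bar>s\<bar> powr \<alpha> * g s < C"
    by (rule order_tendstoD(2)[OF assms(2)]) (simp add: C_def)
  then obtain R2 where R2: "\<And>s. s \<le> R2 \<Longrightarrow> \<bar>s\<bar> powr \<alpha> * g s < C" by (auto simp: eventually_at_bot_linorder)
  define R where "R = max 1 (max R1 (- R2))"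
  have "g p \<le> C * \<bar>p\<bar> powr (-\<alpha>)" if p: "R \<le> \<bar>p\<bar>" for p
  proof -
    have "R1 \<le> p \<or> p \<le> R2" using p by (auto simp: R_def abs_if split: if_splits)
    then have "\<bar>p\<bar> powr \<alpha> * g p < C" using R1 R2 by blast
    moreover have "\<bar>p\<bar> powr \<alpha> > 0" using p by (auto simp: R_def)
    ultimately show ?thesis by (simp add: powr_minus field_simps)
  qed
  moreover have "R > 0" by (simp add: R_def)
  ultimately show ?thesis unfolding power_decay_def by blast
qed

text \<open>Steep profiles are almost stationary: this is where \<open>\<alpha> > 2\<close> enters.\<close>

lemma near_stationary:
  fixes f g :: "real \<Rightarrow> real"
  assumes f: "continuous_on UNIV f" "f 0 = 0" and g: "\<And>s. g s > 0" "power_decay \<alpha> g"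
    and e: "e > 0" "e * (\<alpha> - 1) > 1" and m: "m > 0" and K: "K \<ge> 0" and \<delta>: "\<delta> > 0"
  obtains s1 where "0 < s1" "s1 \<le> 1"
    "\<And>s p z. 0 < s \<Longrightarrow> s \<le> s1 \<Longrightarrow> m * s powr (- e) \<le> \<bar>p\<bar> \<Longrightarrow> \<bar>z\<bar> \<le> K * \<bar>p\<bar> / s \<Longrightarrow> \<bar>f (g p * z)\<bar> \<le> \<delta>"
proof -
  obtain C R where C: "0 < R" "\<And>p. R \<le> \<bar>p\<bar> \<Longrightarrow> g p \<le> C * \<bar>p\<bar> powr (-\<alpha>)"
    using g(2) unfolding power_decay_def by blast
  have C0: "C > 0"
  proof -
    have "0 < C * R powr (-\<alpha>)" using C(2)[of R] C(1) g(1)[of R] by simp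
    then show ?thesis using C(1) by (simp add: zero_less_mult_iff)
  qed
  have \<alpha>: "\<alpha> > 1" using e by (smt (verit) zero_less_mult_iff)
  have "isCont f 0" using f(1) by (simp add: continuous_on_eq_continuous_at)
  then obtain \<rho> where \<rho>: "\<rho> > 0" "\<And>y. \<bar>y\<bar> < \<rho> \<Longrightarrow> \<bar>f y\<bar> < \<delta>"
    unfolding continuous_at_eps_delta using f(2) \<delta> by (metis diff_zero dist_real_def)
  define c where "c = C * K * m powr (1 - \<alpha>)"
  \<comment> \<open>Decay of \<open>g\<close>, steepness of \<open>p\<close> and the bound on
    \<open>z\<close> combine to \<open>|g p * z| \<le> c * s powr q\<close>; the assumption on
    \<open>e\<close> says exactly that this exponent is positive.\<close>
  define q where "q = e * (\<alpha> - 1) - 1"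
  have q: "q > 0" using e by (simp add: q_def)
  have "((\<lambda>s. c * s powr q) \<longlongrightarrow> c * 0) (at_right 0)"
    using q by (intro tendsto_intros tendsto_zero_powrI[OF tendsto_ident_at tendsto_const]) (auto simp: eventually_at_filter)
  then have 1: "\<forall>\<^sub>F s in at_right 0. c * s powr q < \<rho>" using \<rho> by (intro order_tendstoD) auto
  \<comment> \<open>Smallness of this expression means \<open>R < m * s powr (- e)\<close>, which
    puts the slope into the range where the decay of \<open>g\<close> is known.\<close>
  have "((\<lambda>s. R / m * s powr e) \<longlongrightarrow> R / m * 0) (at_right 0)"
    using e by (intro tendsto_intros tendsto_zero_powrI[OF tendsto_ident_at tendsto_const]) (auto simp: eventually_at_filter)
  then have 2: "\<forall>\<^sub>F s in at_right 0. R / m * s powr e < 1" by (intro order_tendstoD) auto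
  have "\<forall>\<^sub>F s in at_right 0. c * s powr q < \<rho> \<and> R / m * s powr e < 1" using 1 2 by (rule eventually_conj)
  then obtain s0 where s0: "s0 > 0" "\<And>s. 0 < s \<Longrightarrow> s < s0 \<Longrightarrow> c * s powr q < \<rho> \<and> R / m * s powr e < 1"
    unfolding eventually_at_right_field by blast
  have main: "\<bar>f (g p * z)\<bar> \<le> \<delta>"
    if s: "0 < s" "s < s0" and p: "m * s powr (- e) \<le> \<bar>p\<bar>" and z: "\<bar>z\<bar> \<le> K * \<bar>p\<bar> / s" for s p z
  proof -
    have P: "m * s powr (- e) > 0" using m s by simp
    then have p0: "\<bar>p\<bar> > 0" using p by linarith
    have "R / m * s powr e < 1" using s0(2) s by blast
    then have "R < m * s powr (- e)" using m s by (simp add: powr_minus field_simps)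
    then have "R \<le> \<bar>p\<bar>" using p by simp
    then have "g p \<le> C * \<bar>p\<bar> powr (-\<alpha>)" by (rule C(2))
    then have "\<bar>g p * z\<bar> \<le> (C * \<bar>p\<bar> powr (-\<alpha>)) * (K * \<bar>p\<bar> / s)"
      unfolding abs_mult using g(1)[of p] z by (intro mult_mono) auto
    also have "\<dots> = C * K / s * (\<bar>p\<bar> powr (-\<alpha>) * \<bar>p\<bar> powr 1)" using p0 by simp
    also have "\<bar>p\<bar> powr (-\<alpha>) * \<bar>p\<bar> powr 1 = \<bar>p\<bar> powr (1 - \<alpha>)"
      unfolding powr_add[symmetric] by (simp add: algebra_simps)
    also have "C * K / s * \<bar>p\<bar> powr (1 - \<alpha>) \<le> C * K / s * (m * s powr (- e)) powr (1 - \<alpha>)"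
      using p P \<alpha> C0 K s by (intro mult_left_mono powr_mono2') auto
    also have "\<dots> = c * (s powr (- e * (1 - \<alpha>)) * s powr (- 1))"
    proof -
      have "(m * s powr (- e)) powr (1 - \<alpha>) = m powr (1 - \<alpha>) * s powr (- e * (1 - \<alpha>))"
        using m s by (simp add: powr_mult powr_powr)
      moreover have "s powr (- 1) = 1 / s" using s by (simp add: powr_minus field_simps)
      ultimately show ?thesis by (simp only: c_def) (simp add: mult_ac)
    qed
    also have "s powr (- e * (1 - \<alpha>)) * s powr (- 1) = s powr q"
      unfolding powr_add[symmetric] by (simp add: q_def algebra_simps)
    also have "c * s powr q < \<rho>" using s0(2) s by blast
    finally have "\<bar>f (g p * z)\<bar> < \<delta>" by (rule \<rho>(2))
    then show ?thesis by simp
  qed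
  show ?thesis
  proof (rule that[of "min 1 (s0 / 2)"])
    show "\<bar>f (g p * z)\<bar> \<le> \<delta>"
      if "0 < s" "s \<le> min 1 (s0 / 2)" "m * s powr (- e) \<le> \<bar>p\<bar>" "\<bar>z\<bar> \<le> K * \<bar>p\<bar> / s" for s p z
      using main[of s p z] that s0(1) by auto
  qed (use s0 in auto)
qed

section \<open>Reflection in space, which carries statements at \<open>b\<close> over to
  \<open>- b\<close>\<close>

lemma usc_on_reflect:
  fixes u :: "real \<times> real \<Rightarrow> real"
  assumes "usc_on (Q0 b) u"
  shows "usc_on (Q0 b) (\<lambda>z. u (- fst z, snd z))"
  unfolding usc_on_iff
proof (intro ballI allI impI)
  fix z and e :: real assume z: "z \<in> Q0 b" "e > 0"
  have "(- fst z, snd z) \<in> Q0 b" using z by (auto simp: Q0_def)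
  then obtain d where d: "d > 0" "\<And>y. y \<in> Q0 b \<Longrightarrow> dist y (- fst z, snd z) < d \<Longrightarrow> u y < u (- fst z, snd z) + e"
    using usc_onD[OF assms _ z(2)] by metis
  have "u (- fst y, snd y) < u (- fst z, snd z) + e" if "y \<in> Q0 b" "dist y z < d" for y
  proof (rule d(2))
    show "(- fst y, snd y) \<in> Q0 b" using that by (auto simp: Q0_def)
    have "dist (- fst y, snd y) (- fst z, snd z) = dist y z"
      by (cases y; cases z) (simp add: dist_Pair_Pair dist_real_def abs_minus_commute)
    then show "dist (- fst y, snd y) (- fst z, snd z) < d" using that by simp
  qed
  then show "\<exists>d>0. \<forall>y\<in>Q0 b. dist y z < d \<longrightarrow> u (- fst y, snd y) < u (- fst z, snd z) + e" using d by blast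
qed

text \<open>Under \<open>x \<mapsto> - x\<close> first derivatives in space change sign and second
  derivatives do not; hence only \<open>g\<close> is reflected.\<close>

lemma jet_sub_reflect:
  assumes "jet_sub b f g u"
  shows "jet_sub b f (\<lambda>p. g (- p)) (\<lambda>z. u (- fst z, snd z))"
  unfolding jet_sub_def
proof (intro ballI allI impI)
  fix z \<tau> p X c
  let ?r = "\<lambda>z::real \<times> real. (- fst z, snd z)"
  assume z: "z \<in> Q b" and le: "\<forall>\<^sub>F y in nhds z. u (?r y) \<le> u (?r z) + \<tau> * (snd y - snd z) + p * (fst y - fst z)
        + X/2 * (fst y - fst z)^2 + c * (snd y - snd z)^2"
  have rz: "?r z \<in> Q b" using z by (auto simp: Q_def)
  have "filterlim ?r (nhds (?r (?r z))) (nhds (?r z))"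
    by (intro tendsto_intros) (auto simp: filterlim_def filtermap_ident intro!: tendsto_fst tendsto_snd)
  then have "filterlim ?r (nhds z) (nhds (?r z))" by simp
  from eventually_compose_filterlim[OF le this]
  have "\<forall>\<^sub>F y in nhds (?r z). u y \<le> u (?r z) + \<tau> * (snd y - snd (?r z)) + (- p) * (fst y - fst (?r z))
        + X/2 * (fst y - fst (?r z))^2 + c * (snd y - snd (?r z))^2"
    by (rule eventually_mono) (simp add: algebra_simps power2_eq_square)
  then show "\<tau> \<le> f (g (- p) * X)" using assms rz unfolding jet_sub_def by blast
qed

text \<open>A supersolution that is infinite at the end \<open>b\<close> at time \<open>t0\<close> stays large there for a short
  time, uniformly.  The barrier is \<open>M + 1 + s\<^sup>\<theta> - \<eta>'/s - (t - t0)\<close> with \<open>s = b - \<eta> - x\<close>: it tends to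
  \<open>-\<infinity>\<close> inside the domain, so that nothing has to be known about the supersolution at \<open>b\<close>, and it is
  so steep that it is almost stationary.\<close>

lemma super_stays_large:
  assumes v: "jet_sub b (\<lambda>s. - f (- s)) (\<lambda>p. g (- p)) (\<lambda>z. - v z)" "usc_on (Q0 b) (\<lambda>z. - v z)"
    and f: "continuous_on UNIV f" "f 0 = 0" and g: "\<And>s. g s > 0" "power_decay \<alpha> g" "\<alpha> > 2"
    and b: "b > 0" and t0: "t0 \<ge> 0" and lim: "filterlim (\<lambda>x. v (x, t0)) at_top (at_left b)"
  shows "\<exists>\<tau>>0. \<exists>d>0. d < b \<and> (\<forall>t x. t0 \<le> t \<longrightarrow> t < t0 + \<tau> \<longrightarrow> b - d < x \<longrightarrow> x < b \<longrightarrow> M \<le> v (x, t))"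
proof -
  \<comment> \<open>This makes \<open>(1 - \<theta>) * (\<alpha> - 1) = \<alpha> / 2 > 1\<close>.
    Slopes of order \<open>s powr (\<theta> - 1)\<close> thus meet the exponent condition of
    \<open>near_stationary\<close>, although \<open>s powr \<theta>\<close> itself stays
    bounded.\<close>
  define \<theta> where "\<theta> = (\<alpha> - 2) / (2 * (\<alpha> - 1))"
  have \<theta>: "0 < \<theta>" "\<theta> < 1" using g(3) by (auto simp: \<theta>_def field_simps)
  have "(1 - \<theta>) * (\<alpha> - 1) = \<alpha> / 2" using g(3) by (simp add: \<theta>_def field_simps)
  then have ex: "(1 - \<theta>) * (\<alpha> - 1) > 1" using g(3) by simp
  obtain s1 where s1: "0 < s1" "s1 \<le> 1" and
    stat: "\<And>s p z. 0 < s \<Longrightarrow> s \<le> s1 \<Longrightarrow> \<theta> * s powr (- (1 - \<theta>)) \<le> \<bar>p\<bar> \<Longrightarrow> \<bar>z\<bar> \<le> 2 * \<bar>p\<bar> / s \<Longrightarrow> \<bar>f (g p * z)\<bar> \<le> 1"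
    by (rule near_stationary[OF f g(1,2) _ ex \<theta>(1), of 2 1]) (use \<theta> in auto)
  have "\<forall>\<^sub>F x in at_left b. M + 3 \<le> v (x, t0)" using lim by (simp add: filterlim_at_top)
  then obtain c where c: "c < b" "\<And>y. c < y \<Longrightarrow> y < b \<Longrightarrow> M + 3 \<le> v (y, t0)"
    unfolding eventually_at_left_field by blast
  define d where "d = min s1 (min (b - c) b) / 2"
  have d: "0 < d" "d < s1" "d < b - c" "d < b" using s1 c b by (auto simp: d_def)
  define l where "l = b - d"
  have l: "-b < l" "c < l" "l < b" using d b by (auto simp: l_def)
  have "(l, t0) \<in> Q0 b" using l t0 by (simp add: Q0_def)
  then obtain \<tau>0 where \<tau>0: "\<tau>0 > 0" "\<And>y. y \<in> Q0 b \<Longrightarrow> dist y (l, t0) < \<tau>0 \<Longrightarrow> - v y < - v (l, t0) + 1"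
    using usc_onD[OF v(2), of "(l, t0)" 1] by auto
  define \<tau> where "\<tau> = min 1 \<tau>0"
  have \<tau>: "0 < \<tau>" "\<tau> \<le> 1" using \<tau>0 by (auto simp: \<tau>_def)
  have latl: "v (l, t) \<ge> M + 2" if "t0 \<le> t" "t < t0 + \<tau>" for t
  proof -
    have "dist (l, t) (l, t0) < \<tau>0" using that by (simp add: dist_Pair_Pair dist_real_def \<tau>_def)
    moreover have "(l, t) \<in> Q0 b" using l t0 that by (simp add: Q0_def)
    ultimately show ?thesis using \<tau>0(2)[of "(l, t)"] c(2)[OF l(2,3)] by simp
  qed
  have main: "v (x, t) \<ge> M - \<zeta>" if x: "l < x" "x < b" and t: "t0 \<le> t" "t < t0 + \<tau>" and \<zeta>: "\<zeta> > 0" for x t \<zeta>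
  proof -
    \<comment> \<open>The singularity is put halfway between \<open>x\<close> and \<open>b\<close>,
      and the strength \<open>k\<close> of the pole is tuned so that it costs exactly
      \<open>\<zeta>\<close> at \<open>x\<close>, where the distance to the singularity is
      \<open>\<eta>\<close>.\<close>
    define \<eta> where "\<eta> = (b - x) / 2"
    have \<eta>: "\<eta> > 0" "\<eta> < d / 2" using x by (auto simp: \<eta>_def l_def)
    define k where "k = \<zeta> * \<eta>"
    have k: "k > 0" using \<zeta> \<eta> by (simp add: k_def)
    have "usc_on ({l..b - \<eta>} \<times> {t0..t0 + \<tau>}) (\<lambda>z. - v z)"
      by (rule usc_on_subset[OF v(2)]) (use l \<eta> t0 in \<open>auto simp: Q0_def\<close>)
    moreover have "compact ({l..b - \<eta>} \<times> {t0..t0 + \<tau>})" by (intro compact_Times) auto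
    ultimately obtain B where B: "\<And>y. y \<in> {l..b - \<eta>} \<times> {t0..t0 + \<tau>} \<Longrightarrow> - v y \<le> B"
      by (metis usc_bounded_above)
    \<comment> \<open>So close to the singularity the pole exceeds any need set by the bound
      \<open>B\<close> for \<open>- v\<close>, and the lateral inequality at \<open>r\<close> holds
      automatically.\<close>
    define sr where "sr = min \<eta> (k / (\<bar>M\<bar> + 2 + \<bar>B\<bar>))"
    have sr: "0 < sr" "sr \<le> \<eta>" "sr \<le> k / (\<bar>M\<bar> + 2 + \<bar>B\<bar>)" using \<eta> k by (auto simp: sr_def)
    have ksr: "\<bar>M\<bar> + 2 + \<bar>B\<bar> \<le> k / sr"
    proof -
      have "sr * (\<bar>M\<bar> + 2 + \<bar>B\<bar>) \<le> k" using sr(3) by (simp add: pos_le_divide_eq)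
      then show ?thesis using sr(1) by (simp add: field_simps)
    qed
    define r where "r = b - \<eta> - sr"
    define S where "S y = b - \<eta> - y" for y
    have S: "0 < S y" "S y \<le> 1" "S y \<le> s1" if "l \<le> y" "y \<le> r" for y
      using that sr \<eta> d s1 by (auto simp: S_def r_def l_def)
    define A where "A y = - (M + 1 + S y powr \<theta> - k / S y)" for y
    define A1 where "A1 y = \<theta> * S y powr (\<theta> - 1) + k / (S y)^2" for y
    define A2 where "A2 y = \<theta> * (1 - \<theta>) * S y powr (\<theta> - 2) + 2 * k / (S y)^3" for y
    have dS: "(S has_real_derivative - 1) (at y)" for y unfolding S_def by (auto intro!: derivative_eq_intros)
    have A1: "(A has_real_derivative A1 y) (at y)" if "l \<le> y" "y \<le> r" for y
      unfolding A_def A1_def using S[OF that]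
      by (auto intro!: derivative_eq_intros dS simp: power2_eq_square)
    have A2: "(A1 has_real_derivative A2 y) (at y)" if "l \<le> y" "y \<le> r" for y
    proof -
      have "(A1 has_real_derivative (\<theta> * ((\<theta> - 1) * S y powr (\<theta> - 1 - 1) * - 1) + - (k * (2 * (S y * - 1))) / ((S y)^2 * (S y)^2))) (at y)"
        unfolding A1_def using S[OF that]
        by (auto intro!: derivative_eq_intros dS)
      moreover have "- (k * (2 * (S y * - 1))) / ((S y)^2 * (S y)^2) = 2 * k / (S y)^3"
        using S(1)[OF that] by (simp add: field_simps power2_eq_square power3_eq_cube)
      moreover have "\<theta> * ((\<theta> - 1) * S y powr (\<theta> - 1 - 1) * - 1) = \<theta> * (1 - \<theta>) * S y powr (\<theta> - 2)"
        by (simp add: algebra_simps)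
      ultimately show ?thesis by (simp only: A2_def)
    qed
    have Apow: "S y powr (\<theta> - 2) = S y powr (\<theta> - 1) / S y" if "l \<le> y" "y \<le> r" for y
      using S(1)[OF that] by (simp add: powr_diff field_simps power2_eq_square)
    have "- v (x, t) \<le> A x + 1 * (t - t0)"
    proof (rule jet_sub_le_barrier[OF v _ l(1), where r = r and T = "t0 + \<tau>" and A = A and ?A1.0 = A1 and ?A2.0 = A2])
      show "continuous_on UNIV (\<lambda>s. - f (- s))"
        by (intro continuous_intros continuous_on_compose2[OF f(1)]) auto
      show "continuous_on {l..r} A" using A1 by (intro DERIV_continuous_on[of _ _ A1]) (auto intro: has_field_derivative_at_within)
      show "l \<le> r" "r < b" using sr \<eta> by (auto simp: r_def l_def)
      show "- f (- (g (- A1 y) * A2 y)) \<le> 1" if y: "l < y" "y < r" for y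
      proof -
        have s: "0 < S y" "S y \<le> s1" using S[of y] y by auto
        have A10: "\<theta> * S y powr (\<theta> - 1) \<le> A1 y" using k by (simp add: A1_def)
        have "0 \<le> A1 y" using A10 \<theta> by (smt (verit) powr_ge_zero zero_le_mult_iff)
        have "A2 y = ((1 - \<theta>) * (\<theta> * S y powr (\<theta> - 1)) + 2 * (k / (S y)^2)) / S y"
          using s y by (simp add: A2_def Apow field_simps power2_eq_square power3_eq_cube)
        moreover have "(1 - \<theta>) * (\<theta> * S y powr (\<theta> - 1)) \<le> 2 * (\<theta> * S y powr (\<theta> - 1))"
          using \<theta> by (intro mult_right_mono) auto
        ultimately have "A2 y \<le> 2 * A1 y / S y" using s by (auto simp: A1_def intro!: divide_right_mono)
        moreover have "0 \<le> A2 y" using \<theta> k s by (auto simp: A2_def)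
        ultimately have "\<bar>f (g (- A1 y) * - A2 y)\<bar> \<le> 1"
          using A10 \<open>0 \<le> A1 y\<close> by (intro stat[OF s]) auto
        then show ?thesis by (simp add: abs_le_iff)
      qed
      have A_ge: "A y \<ge> - (M + 2)" if "l \<le> y" "y \<le> r" for y
      proof -
        have "S y powr \<theta> \<le> 1 powr \<theta>" using S[OF that] \<theta> by (intro powr_mono2) auto
        moreover have "0 \<le> k / S y" using k S[OF that] by simp
        ultimately show ?thesis by (simp add: A_def)
      qed
      show "- v (y, t0) \<le> A y" if "l \<le> y" "y \<le> r" for y
        using A_ge[OF that] c(2)[of y] that l sr \<eta> by (auto simp: r_def)
      have lr: "l \<le> r" using sr \<eta> by (auto simp: r_def l_def)
      show "- v (l, s) \<le> A l + 1 * (s - t0)" if "t0 \<le> s" "s < t0 + \<tau>" for s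
        using latl[OF that] A_ge[of l] lr that by simp
      show "- v (r, s) \<le> A r + 1 * (s - t0)" if "t0 \<le> s" "s < t0 + \<tau>" for s
      proof -
        have "- v (r, s) \<le> B" using B[of "(r, s)"] lr sr that by (auto simp: r_def)
        moreover have "S r = sr" by (simp add: S_def r_def)
        moreover have "sr powr \<theta> \<le> 1 powr \<theta>" using sr \<eta> d s1 \<theta> by (intro powr_mono2) auto
        ultimately show ?thesis using ksr that by (simp add: A_def)
      qed
      have "x = b - 2 * \<eta>" by (simp add: \<eta>_def field_simps)
      then show "x \<le> r" using sr(2) by (simp add: r_def)
      show "l \<le> x" "t0 \<le> t" "t < t0 + \<tau>" "0 \<le> t0" using x t t0 by auto
    qed (use A1 A2 in auto)
    moreover have "S x = \<eta>" by (simp add: S_def \<eta>_def field_simps)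
    moreover have "k / \<eta> = \<zeta>" using \<eta> by (simp add: k_def)
    ultimately have "- v (x, t) \<le> \<zeta> - (M + 1 + \<eta> powr \<theta>) + (t - t0)" by (simp add: A_def)
    then show ?thesis using t \<tau> powr_ge_zero[of \<eta> \<theta>] by linarith
  qed
  \<comment> \<open>The pole served only to settle the lateral inequality; its cost
    \<open>\<zeta>\<close> at the given point is arbitrarily small.\<close>
  have "M \<le> v (x, t)" if "t0 \<le> t" "t < t0 + \<tau>" "b - d < x" "x < b" for t x
    by (rule field_le_epsilon) (use main[of x t] that in \<open>auto simp: l_def algebra_simps\<close>)
  then show ?thesis using \<tau>(1) d by blast
qed

text \<open>Affine functions are stationary solutions.  The first time at which an affine minorant is violated is
  excluded by \<open>super_stays_large\<close>.\<close>

lemma super_ge_affine: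
  assumes v: "jet_sub b (\<lambda>s. - f (- s)) (\<lambda>p. g (- p)) (\<lambda>z. - v z)" "usc_on (Q0 b) (\<lambda>z. - v z)"
    and f: "continuous_on UNIV f" "f 0 = 0" and g: "\<And>s. g s > 0" "power_decay \<alpha> g" "\<alpha> > 2"
    and b: "b > 0"
    and lim: "\<And>t. t \<ge> 0 \<Longrightarrow> filterlim (\<lambda>x. v (x, t)) at_top (at_left b)"
      "\<And>t. t \<ge> 0 \<Longrightarrow> filterlim (\<lambda>x. v (x, t)) at_top (at_right (-b))"
    and init: "\<And>x. -b < x \<Longrightarrow> x < b \<Longrightarrow> p * x + q \<le> v (x, 0)"
    and xt: "-b < x" "x < b" "t \<ge> 0"
  shows "p * x + q \<le> v (x, t)"
proof (rule ccontr)
  assume neg: "\<not> ?thesis"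
  define E where "E = {t. 0 \<le> t \<and> (\<exists>x. -b < x \<and> x < b \<and> v (x, t) < p * x + q)}"
  have tE: "t \<in> E" using neg xt by (auto simp: E_def)
  have bdd: "bdd_below E" by (rule bdd_belowI[of _ 0]) (auto simp: E_def)
  \<comment> \<open>Whether or not this infimum is attained, there is no violation before it, and
    \<open>super_stays_large\<close> covers a time interval that starts at it.\<close>
  define t0 where "t0 = Inf E"
  have t0: "t0 \<ge> 0" unfolding t0_def using tE by (intro cInf_greatest) (auto simp: E_def)
  have before: "p * x + q \<le> v (x, t)" if "0 \<le> t" "t < t0" "-b < x" "x < b" for x t
  proof (rule ccontr)
    assume "\<not> ?thesis"
    then have "t \<in> E" using that by (auto simp: E_def)
    then have "t0 \<le> t" unfolding t0_def using bdd by (rule cInf_lower)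
    then show False using that by simp
  qed
  define M where "M = \<bar>p\<bar> * b + \<bar>q\<bar>"
  have M: "p * x + q \<le> M" if "-b < x" "x < b" for x
  proof -
    have "p * x \<le> \<bar>p\<bar> * \<bar>x\<bar>" by (metis abs_ge_self abs_mult)
    also have "\<dots> \<le> \<bar>p\<bar> * b" using that by (intro mult_left_mono) auto
    finally show ?thesis by (simp add: M_def)
  qed
  obtain \<tau>1 d1 where 1: "\<tau>1 > 0" "d1 > 0" "d1 < b"
    "\<And>t x. t0 \<le> t \<Longrightarrow> t < t0 + \<tau>1 \<Longrightarrow> b - d1 < x \<Longrightarrow> x < b \<Longrightarrow> M \<le> v (x, t)"
    using super_stays_large[OF v f g b t0 lim(1)[OF t0], of M] by blast
  have vr: "jet_sub b (\<lambda>s. - f (- s)) (\<lambda>p. g (- (- p))) (\<lambda>z. - v (- fst z, snd z))"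
    using jet_sub_reflect[OF v(1)] by simp
  have vr2: "usc_on (Q0 b) (\<lambda>z. - v (- fst z, snd z))" using usc_on_reflect[OF v(2)] by simp
  have limr: "filterlim (\<lambda>x. v (- fst (x, t0), snd (x, t0))) at_top (at_left b)"
    using lim(2)[OF t0] by (simp add: filterlim_at_left_to_right[of _ _ b])
  obtain \<tau>2 d2 where 2: "\<tau>2 > 0" "d2 > 0" "d2 < b"
    "\<And>t x. t0 \<le> t \<Longrightarrow> t < t0 + \<tau>2 \<Longrightarrow> b - d2 < x \<Longrightarrow> x < b \<Longrightarrow> M \<le> v (- x, t)"
    using super_stays_large[OF vr vr2 f _ power_decay_reflect[OF g(2)] g(3) b t0 limr, of M] g(1) by auto
  define T where "T = t0 + min \<tau>1 \<tau>2"
  have "t0 < T" using 1 2 by (simp add: T_def)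
  then obtain t1 where t1: "t1 \<in> E" "t1 < T" unfolding t0_def using tE cInf_lessD by (metis empty_iff)
  then obtain x1 where x1: "-b < x1" "x1 < b" "v (x1, t1) < p * x1 + q" "0 \<le> t1" by (auto simp: E_def)
  \<comment> \<open>\<open>l\<close> and \<open>r\<close> lie in the strips where
    \<open>v \<ge> M\<close> from \<open>t0\<close> on; before \<open>t0\<close> nothing is
    violated. So the affine function is below \<open>v\<close> on both lateral lines up to
    \<open>T\<close>.\<close>
  define r where "r = max x1 (b - d1 / 2)"
  define l where "l = min x1 (- b + d2 / 2)"
  have r: "x1 \<le> r" "r < b" "b - d1 < r" using x1 1 by (auto simp: r_def)
  have l: "l \<le> x1" "- b < l" "b - d2 < - l" using x1 2 by (auto simp: l_def)
  have vlr: "p * r + q \<le> v (r, t)" "p * l + q \<le> v (l, t)" if "0 \<le> t" "t < T" for t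
  proof -
    show "p * r + q \<le> v (r, t)"
    proof (cases "t < t0")
      case False
      then have "M \<le> v (r, t)" using 1(4)[of t r] r that by (auto simp: T_def)
      then show ?thesis using M[of r] r x1 by simp
    qed (use before[of t r] r x1 that in simp)
    show "p * l + q \<le> v (l, t)"
    proof (cases "t < t0")
      case False
      then have "M \<le> v (l, t)" using 2(4)[of t "- l"] l that by (auto simp: T_def)
      then show ?thesis using M[of l] l x1 by simp
    qed (use before[of t l] l x1 that in simp)
  qed
  have "- v (x1, t1) \<le> - (p * x1 + q) + 0 * (t1 - 0)"
  proof (rule jet_sub_le_barrier[OF v _ l(2), where r = r and T = T and A = "\<lambda>x. - (p * x + q)" and ?A1.0 = "\<lambda>x. - p" and ?A2.0 = "\<lambda>x. 0"])
    show "continuous_on UNIV (\<lambda>s. - f (- s))"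
      by (intro continuous_intros continuous_on_compose2[OF f(1)]) auto
    show "((\<lambda>x. - (p * x + q)) has_real_derivative - p) (at x)" for x by (auto intro!: derivative_eq_intros)
    show "- v (l, t) \<le> - (p * l + q) + 0 * (t - 0)" if "0 \<le> t" "t < T" for t using vlr(2)[OF that] by simp
    show "- v (r, t) \<le> - (p * r + q) + 0 * (t - 0)" if "0 \<le> t" "t < T" for t using vlr(1)[OF that] by simp
    show "- v (x, 0) \<le> - (p * x + q)" if "l \<le> x" "x \<le> r" for x using init[of x] that l r by simp
  qed (use r l x1 t1 f in \<open>auto intro!: continuous_intros\<close>)
  then show False using x1 by simp
qed

section \<open>The profile \<psi> near its singularity\<close>

definition psi_rate :: "real \<Rightarrow> real" where
  "psi_rate \<gamma> = (if \<gamma> > 0 then \<gamma> else 1)"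

lemma psi_rate_pos: "psi_rate \<gamma> > 0"
  by (simp add: psi_rate_def)

text \<open>\<open>psi_rate\<close> merges the two cases: power and logarithm both have a negative
  multiple of \<open>s powr (-\<gamma> - 1)\<close> as derivative, with factor 1 for the
  logarithm.\<close>

lemma psi_deriv:
  assumes "\<gamma> \<ge> 0" "s > 0"
  shows "(psi \<gamma> has_real_derivative - (psi_rate \<gamma> * s powr (-\<gamma> - 1))) (at s)"
proof (cases "\<gamma> > 0")
  case True
  then have "psi \<gamma> = (\<lambda>s. s powr (-\<gamma>))" by (auto simp: psi_def)
  then show ?thesis using assms True by (auto intro!: derivative_eq_intros simp: psi_rate_def)
next
  case False
  then have "\<gamma> = 0" "psi \<gamma> = (\<lambda>s. - ln s)" using assms by (auto simp: psi_def)
  then show ?thesis using assms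
    by (auto intro!: derivative_eq_intros simp: psi_rate_def powr_minus field_simps)
qed

text \<open>Reduces the blow-up at 0 to that of the logarithm, for every \<open>\<gamma>\<close> at
  once.\<close>

lemma psi_ge_ln:
  assumes "\<gamma> \<ge> 0" "s > 0"
  shows "psi \<gamma> s \<ge> - (psi_rate \<gamma> * ln s)"
proof (cases "\<gamma> > 0")
  case True
  have "psi \<gamma> s = exp (- \<gamma> * ln s)" using True assms by (simp add: psi_def powr_def)
  also have "\<dots> \<ge> 1 + (- \<gamma> * ln s)" by (rule exp_ge_add_one_self)
  finally show ?thesis using True by (simp add: psi_rate_def)
next
  case False
  then show ?thesis by (simp add: psi_def psi_rate_def)
qed

lemma psi_large:
  assumes "\<gamma> \<ge> 0"
  obtains s0 where "s0 > 0" "\<And>s. 0 < s \<Longrightarrow> s \<le> s0 \<Longrightarrow> B \<le> psi \<gamma> s"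
proof (rule that[of "exp (- (B / psi_rate \<gamma>))"])
  fix s assume s: "0 < s" "s \<le> exp (- (B / psi_rate \<gamma>))"
  then have "ln s \<le> - (B / psi_rate \<gamma>)" using ln_mono[of s "exp (- (B / psi_rate \<gamma>))"] by simp
  then have "psi_rate \<gamma> * ln s \<le> psi_rate \<gamma> * - (B / psi_rate \<gamma>)"
    using psi_rate_pos[of \<gamma>] by (intro mult_left_mono) auto
  also have "\<dots> = - B" using psi_rate_pos[of \<gamma>] by simp
  finally show "B \<le> psi \<gamma> s" using psi_ge_ln[OF assms s(1)] by linarith
qed auto

text \<open>Convexity of the profile. After scaling to \<open>y = s / s0\<close> both cases come
  down to \<open>ln y \<le> y - 1\<close>.\<close>

lemma psi_tangent:
  assumes \<gamma>: "\<gamma> \<ge> 0" and s: "s > 0" "s0 > 0"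
  shows "psi \<gamma> s0 - psi_rate \<gamma> * s0 powr (-\<gamma> - 1) * (s - s0) \<le> psi \<gamma> s"
proof -
  define y where "y = s / s0"
  have y: "y > 0" "s = s0 * y" using s by (auto simp: y_def)
  have ln: "ln y \<le> y - 1" using y(1) by (rule ln_le_minus_one)
  show ?thesis
  proof (cases "\<gamma> > 0")
    case True
    have "1 - \<gamma> * (y - 1) \<le> 1 - \<gamma> * ln y" using ln True by simp
    also have "\<dots> \<le> exp (- \<gamma> * ln y)" using exp_ge_add_one_self[of "- \<gamma> * ln y"] by simp
    also have "\<dots> = y powr (-\<gamma>)" using y by (simp add: powr_def)
    finally have "s0 powr (-\<gamma>) * (1 - \<gamma> * (y - 1)) \<le> s0 powr (-\<gamma>) * y powr (-\<gamma>)" by (rule mult_left_mono) simp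
    also have "s0 powr (-\<gamma>) * y powr (-\<gamma>) = s powr (-\<gamma>)" using s y by (simp add: powr_mult)
    also have "s0 powr (-\<gamma>) * (1 - \<gamma> * (y - 1)) = s0 powr (-\<gamma>) - \<gamma> * s0 powr (-\<gamma> - 1) * (s - s0)"
      using s y(2) by (simp add: powr_diff field_simps)
    finally show ?thesis using True by (simp add: psi_def psi_rate_def)
  next
    case False
    then have "\<gamma> = 0" using \<gamma> by simp
    moreover have "ln s = ln s0 + ln y" using s y by (simp add: ln_mult)
    moreover have "s0 powr (- 1) * (s - s0) = y - 1" using s by (simp add: powr_minus y_def field_simps)
    ultimately show ?thesis using ln by (simp add: psi_def psi_rate_def)
  qed
qed

lemma psi_antimono: "\<gamma> \<ge> 0 \<Longrightarrow> 0 < s \<Longrightarrow> s \<le> s' \<Longrightarrow> psi \<gamma> s' \<le> psi \<gamma> s"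
  by (auto simp: psi_def intro: powr_mono2')

text \<open>The minorants are the tangents of the convex function \<open>D \<psi>\<^sub>\<gamma>(b - x)\<close>.\<close>

lemma super_boundary_lower:
  assumes v: "jet_sub b (\<lambda>s. - f (- s)) (\<lambda>p. g (- p)) (\<lambda>z. - v z)" "usc_on (Q0 b) (\<lambda>z. - v z)"
    and f: "continuous_on UNIV f" "f 0 = 0" and g: "\<And>s. g s > 0" "power_decay \<alpha> g" "\<alpha> > 2"
    and b: "b > 0"
    and lim: "\<And>t. t \<ge> 0 \<Longrightarrow> filterlim (\<lambda>x. v (x, t)) at_top (at_left b)"
      "\<And>t. t \<ge> 0 \<Longrightarrow> filterlim (\<lambda>x. v (x, t)) at_top (at_right (-b))"
    and \<gamma>: "\<gamma> \<ge> 0" and D: "D > 0" and d1: "d1 > 0"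
    and init: "\<And>x. - b < x \<Longrightarrow> b - d1 < x \<Longrightarrow> x < b \<Longrightarrow> D * psi \<gamma> (b - x) + C \<le> v (x, 0)"
      "\<And>x. -b < x \<Longrightarrow> x < b \<Longrightarrow> m \<le> v (x, 0)"
  shows "\<exists>d>0. \<forall>x t. - b < x \<longrightarrow> b - d < x \<longrightarrow> x < b \<longrightarrow> t \<ge> 0 \<longrightarrow> D * psi \<gamma> (b - x) + C \<le> v (x, t)"
proof -
  define k where "k = D * psi_rate \<gamma>"
  have k: "k > 0" using D psi_rate_pos by (simp add: k_def)
  define h where "h = \<bar>D * psi \<gamma> (d1 / 2) + C - m\<bar> + 1"
  have h: "h > 0" by (simp add: h_def)
  \<comment> \<open>By the last entry the tangent at any \<open>s0 < d\<close> is so steep that it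
    drops by at least \<open>h\<close> between \<open>d1 / 2\<close> and \<open>d1\<close>. From
    \<open>d1\<close> on it is therefore below \<open>m\<close>, where the expansion of the initial
    values is no longer available.\<close>
  define d where "d = min 1 (min (d1 / 2) (k * (d1 / 2) / h))"
  have d: "0 < d" "d \<le> 1" "d \<le> d1 / 2" "d \<le> k * (d1 / 2) / h" using d1 k h by (auto simp: d_def)
  have main: "D * psi \<gamma> (b - x0) + C \<le> v (x0, t)" if x0: "-b < x0" "b - d < x0" "x0 < b" and t: "t \<ge> 0" for x0 t
  proof -
    define s0 where "s0 = b - x0"
    have s0: "0 < s0" "s0 < d" using x0 by (auto simp: s0_def)
    define p where "p = k * s0 powr (-\<gamma> - 1)"
    have p: "p > 0" using k s0 by (simp add: p_def)
    define L where "L s = D * psi \<gamma> s0 - p * (s - s0)" for s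
    have tangent: "L s \<le> D * psi \<gamma> s" if "s > 0" for s
    proof -
      have "L s = D * (psi \<gamma> s0 - psi_rate \<gamma> * s0 powr (-\<gamma> - 1) * (s - s0))"
        by (simp add: L_def p_def k_def algebra_simps)
      then show ?thesis using psi_tangent[OF \<gamma> that s0(1)] D by (simp add: mult_left_mono)
    qed
    have far: "L s + C \<le> m" if "s \<ge> d1" for s
    proof -
      have "s0 powr 1 \<ge> s0 powr (\<gamma> + 1)" using s0 d \<gamma> by (intro powr_mono') auto
      then have "1 / s0 \<le> 1 / s0 powr (\<gamma> + 1)" using s0 by (intro divide_left_mono) auto
      also have "\<dots> = s0 powr (-\<gamma> - 1)" using powr_minus_divide[of s0 "\<gamma> + 1"] by simp
      finally have "k * (1 / s0) \<le> p" unfolding p_def using k by (intro mult_left_mono) auto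
      then have "k / s0 \<le> p" by simp
      moreover have "h \<le> k / s0 * (d1 / 2)"
      proof -
        have "s0 * h \<le> d * h" using s0 h by (intro mult_right_mono) auto
        also have "d * h \<le> k * (d1 / 2)" using d(4) h by (simp add: pos_le_divide_eq)
        finally have "s0 * h \<le> k * (d1 / 2)" .
        then show ?thesis using s0 by (simp add: field_simps)
      qed
      ultimately have "h \<le> p * (d1 / 2)" using d1 by (smt (verit) mult_right_mono half_gt_zero)
      also have "\<dots> \<le> p * (s - d1 / 2)" using p that by (intro mult_left_mono) auto
      finally have "h \<le> p * (s - d1 / 2)" .
      moreover have "L s = L (d1 / 2) - p * (s - d1 / 2)" by (simp add: L_def algebra_simps)
      moreover have "L (d1 / 2) \<le> D * psi \<gamma> (d1 / 2)" using d1 by (intro tangent) auto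
      ultimately show ?thesis by (auto simp: h_def)
    qed
    have aff: "p * x + (L b + C) = L (b - x) + C" for x by (simp add: L_def algebra_simps)
    have "p * x0 + (L b + C) \<le> v (x0, t)"
    proof (rule super_ge_affine[OF v f g b lim _ _ _ t])
      fix x assume x: "-b < x" "x < b"
      show "p * x + (L b + C) \<le> v (x, 0)"
      proof (cases "b - d1 < x")
        case True
        then show ?thesis unfolding aff using init(1)[OF x(1) True x(2)] tangent[of "b - x"] x by simp
      next
        case False
        then show ?thesis unfolding aff using init(2)[OF x] far[of "b - x"] by simp
      qed
    qed (use x0 in auto)
    then show ?thesis unfolding aff by (simp add: L_def s0_def)
  qed
  then show ?thesis using d(1) by blast
qed

text \<open>The barrier is \<open>D \<psi>\<^sub>\<gamma>(s) + C + K (s/s2)\<^sup>\<theta> + \<delta> t\<close> with \<open>s = b - \<eta> - x\<close>.  It is infinite inside the domain, and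
  \<open>\<theta>\<close> is so small that the correction \<open>K (s/s2)\<^sup>\<theta>\<close> takes at most half of the slope of \<open>D \<psi>\<^sub>\<gamma>\<close>.\<close>

lemma sub_boundary_upper:
  assumes u: "jet_sub b f g u" "usc_on (Q0 b) u"
    and f: "continuous_on UNIV f" "f 0 = 0" and g: "\<And>s. g s > 0" "power_decay \<alpha> g" "\<alpha> > 2"
    and b: "b > 0" and \<gamma>: "\<gamma> \<ge> 0" and D: "D > 0" and T: "T > 0" and d1: "d1 > 0" and \<epsilon>: "\<epsilon> > 0"
    and init: "\<And>x. - b < x \<Longrightarrow> b - d1 < x \<Longrightarrow> x < b \<Longrightarrow> u (x, 0) \<le> D * psi \<gamma> (b - x) + C"
  shows "\<exists>d>0. \<forall>x t. - b < x \<longrightarrow> b - d < x \<longrightarrow> x < b \<longrightarrow> 0 \<le> t \<longrightarrow> t < T \<longrightarrow> u (x, t) \<le> D * psi \<gamma> (b - x) + C + 3 * \<epsilon>"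
proof -
  define k where "k = D * psi_rate \<gamma>"
  have k: "k > 0" using D psi_rate_pos by (simp add: k_def)
  define \<delta> where "\<delta> = \<epsilon> / T"
  have \<delta>: "\<delta> > 0" using \<epsilon> T by (simp add: \<delta>_def)
  \<comment> \<open>The constants anticipate the barrier: its slope is at least half of that of
    \<open>D * psi \<gamma>\<close>, hence at least \<open>k / 2 * s powr (- 1)\<close>, and its
    second derivative is at most \<open>(2 * \<gamma> + 3) / s\<close> times its slope.\<close>
  obtain s1 where s1: "0 < s1" "s1 \<le> 1" and
    stat: "\<And>s p z. 0 < s \<Longrightarrow> s \<le> s1 \<Longrightarrow> k / 2 * s powr (- 1) \<le> \<bar>p\<bar> \<Longrightarrow> \<bar>z\<bar> \<le> (2 * \<gamma> + 3) * \<bar>p\<bar> / s \<Longrightarrow> \<bar>f (g p * z)\<bar> \<le> \<delta>"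
    by (rule near_stationary[OF f g(1,2), of 1 "k / 2" "2 * \<gamma> + 3" \<delta>]) (use g(3) k \<gamma> \<delta> in auto)
  define s2 where "s2 = min s1 (min d1 b) / 3"
  have s2: "0 < s2" "s2 \<le> s1" "s2 \<le> 1" "2 * s2 < d1" "2 * s2 < b" using s1 d1 b by (auto simp: s2_def)
  have "usc_on ({b - 2 * s2..b - s2} \<times> {0..T}) u"
    by (rule usc_on_subset[OF u(2)]) (use s2 b in \<open>auto simp: Q0_def\<close>)
  moreover have "compact ({b - 2 * s2..b - s2} \<times> {0..T})" by (intro compact_Times) auto
  ultimately obtain B where B: "\<And>y. y \<in> {b - 2 * s2..b - s2} \<times> {0..T} \<Longrightarrow> u y \<le> B"
    by (metis usc_bounded_above)
  \<comment> \<open>At the inner end, where \<open>s = s2\<close>, the correction equals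
    \<open>K\<close> and lifts the barrier above the bound \<open>B\<close> for
    \<open>u\<close>.\<close>
  define K where "K = \<bar>B - D * psi \<gamma> s2 - C\<bar>"
  have K: "K \<ge> 0" by (simp add: K_def)
  define \<theta> where "\<theta> = min 1 (k / (2 * (K + 1)))"
  have \<theta>: "0 < \<theta>" "\<theta> \<le> 1" "K * \<theta> \<le> k / 2"
  proof -
    show "0 < \<theta>" "\<theta> \<le> 1" using k K by (auto simp: \<theta>_def)
    have "K * \<theta> \<le> (K + 1) * (k / (2 * (K + 1)))" using k K by (intro mult_mono) (auto simp: \<theta>_def)
    also have "\<dots> = k / 2" using K by (simp add: field_simps)
    finally show "K * \<theta> \<le> k / 2" .
  qed
  have main: "u (x, t) \<le> D * psi \<gamma> (b - \<eta> - x) + C + K * ((b - \<eta> - x) / s2) powr \<theta> + \<delta> * t"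
    if \<eta>: "0 < \<eta>" "\<eta> < s2" and x: "b - \<eta> - s2 \<le> x" "x < b - \<eta>" and t: "0 \<le> t" "t < T" for x t \<eta>
  proof -
    define l where "l = b - \<eta> - s2"
    have l: "-b < l" "b - 2 * s2 \<le> l" "l \<le> b - s2" using \<eta> s2 b by (auto simp: l_def)
    have "usc_on ({l..b - \<eta>} \<times> {0..T}) u"
      by (rule usc_on_subset[OF u(2)]) (use l \<eta> in \<open>auto simp: Q0_def\<close>)
    moreover have "compact ({l..b - \<eta>} \<times> {0..T})" by (intro compact_Times) auto
    ultimately obtain B' where B': "\<And>y. y \<in> {l..b - \<eta>} \<times> {0..T} \<Longrightarrow> u y \<le> B'"
      by (metis usc_bounded_above)
    obtain s0 where s0: "s0 > 0" "\<And>s. 0 < s \<Longrightarrow> s \<le> s0 \<Longrightarrow> (B' - C) / D \<le> psi \<gamma> s"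
      using psi_large[OF \<gamma>] by blast
    \<comment> \<open>At this distance from the singularity the singular term alone exceeds the
      bound \<open>B'\<close> for \<open>u\<close>, so the lateral inequality at \<open>r\<close>
      holds whatever \<open>u\<close> does near \<open>b\<close>.\<close>
    define sr where "sr = min s0 (b - \<eta> - x)"
    have sr: "0 < sr" "sr \<le> s0" "sr \<le> b - \<eta> - x" using s0 x by (auto simp: sr_def)
    define r where "r = b - \<eta> - sr"
    have r: "r < b" "l \<le> r" "x \<le> r" using sr \<eta> x by (auto simp: r_def l_def)
    define S where "S y = b - \<eta> - y" for y
    have S: "0 < S y" "S y \<le> s2" if "l \<le> y" "y \<le> r" for y
      using that sr by (auto simp: S_def l_def r_def)
    define c where "c = K / s2 powr \<theta>"
    have c: "c \<ge> 0" using K by (simp add: c_def)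
    define A where "A y = D * psi \<gamma> (S y) + C + c * S y powr \<theta>" for y
    define A1 where "A1 y = k * S y powr (-\<gamma> - 1) - c * \<theta> * S y powr (\<theta> - 1)" for y
    define A2 where "A2 y = k * (\<gamma> + 1) * S y powr (-\<gamma> - 2) - c * \<theta> * (1 - \<theta>) * S y powr (\<theta> - 2)" for y
    have Ax: "A y = D * psi \<gamma> (b - \<eta> - y) + C + K * ((b - \<eta> - y) / s2) powr \<theta>" if "l \<le> y" "y \<le> r" for y
      using S(1)[OF that] s2 by (simp add: A_def S_def c_def powr_divide)
    have dS: "(S has_real_derivative - 1) (at y)" for y unfolding S_def by (auto intro!: derivative_eq_intros)
    have A1: "(A has_real_derivative A1 y) (at y)" if "l \<le> y" "y \<le> r" for y
      unfolding A_def A1_def k_def using S[OF that]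
      by (auto intro!: derivative_eq_intros dS DERIV_chain2[OF psi_deriv[OF \<gamma>] dS])
    have A2: "(A1 has_real_derivative A2 y) (at y)" if "l \<le> y" "y \<le> r" for y
      unfolding A1_def A2_def using S[OF that]
      by (auto intro!: derivative_eq_intros dS simp: algebra_simps)
    have stn: "\<bar>f (g (A1 y) * A2 y)\<bar> \<le> \<delta>" if y: "l \<le> y" "y \<le> r" for y
    proof -
      have s: "0 < S y" "S y \<le> s1" "S y \<le> 1" using S[OF y] s2 by auto
      define P where "P = k * S y powr (-\<gamma> - 1)"
      define N where "N = c * \<theta> * S y powr (\<theta> - 1)"
      have P: "P \<ge> k * S y powr (- 1)" unfolding P_def using k s \<gamma> by (intro mult_left_mono powr_mono') auto
      have N0: "N \<ge> 0" using c \<theta> by (simp add: N_def)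
      have "(S y / s2) powr \<theta> \<le> 1 powr \<theta>" using S[OF y] s2 \<theta> by (intro powr_mono2) auto
      then have "K * \<theta> * (S y / s2) powr \<theta> \<le> k / 2 * 1" using \<theta> k K by (intro mult_mono) auto
      \<comment> \<open>In this form \<open>N\<close> is \<open>1 / S y\<close> times a factor of at
        most \<open>k / 2\<close>; since \<open>P\<close> is at least \<open>k / S y\<close>, the
        correction takes at most half of the slope.\<close>
      moreover have "N = K * \<theta> * (S y / s2) powr \<theta> * S y powr (- 1)"
        using s s2 by (simp add: N_def c_def powr_divide powr_diff powr_minus field_simps)
      ultimately have "N \<le> k / 2 * S y powr (- 1)" by (metis mult.right_neutral mult_right_mono powr_ge_zero)
      then have NP: "N \<le> P / 2" using P by simp
      have a1: "A1 y = P - N" by (simp add: A1_def P_def N_def)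
      have a2: "A2 y = ((\<gamma> + 1) * P - (1 - \<theta>) * N) / S y"
        using s by (simp add: A2_def P_def N_def powr_diff powr_minus field_simps power2_eq_square)
      have "P > 0" using k s P by (smt (verit) powr_gt_zero zero_less_mult_iff)
      have "\<bar>(\<gamma> + 1) * P - (1 - \<theta>) * N\<bar> \<le> (\<gamma> + 1) * P + N"
      proof -
        have "0 \<le> (1 - \<theta>) * N" "0 \<le> \<theta> * N" using N0 \<theta> by auto
        then have "(1 - \<theta>) * N \<le> N" by (simp add: left_diff_distrib)
        moreover have "0 \<le> (1 - \<theta>) * N" by fact
        moreover have "0 \<le> (\<gamma> + 1) * P" using \<gamma> \<open>P > 0\<close> by simp
        ultimately show ?thesis by linarith
      qed
      also have "\<dots> \<le> (2 * \<gamma> + 3) * (P / 2)" using NP by (simp add: algebra_simps)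
      also have "\<dots> \<le> (2 * \<gamma> + 3) * \<bar>A1 y\<bar>" using NP \<gamma> N0 unfolding a1 by (intro mult_left_mono) linarith+
      finally have "\<bar>A2 y\<bar> \<le> (2 * \<gamma> + 3) * \<bar>A1 y\<bar> / S y"
        unfolding a2 using s by (simp add: abs_divide divide_right_mono)
      moreover have "k / 2 * S y powr (- 1) \<le> \<bar>A1 y\<bar>" unfolding a1 using P NP by simp
      ultimately show ?thesis using s by (intro stat) auto
    qed
    have AD: "A y \<ge> D * psi \<gamma> (S y) + C" for y using c by (simp add: A_def)
    have "u (x, t) \<le> A x + \<delta> * (t - 0)"
    proof (rule jet_sub_le_barrier[OF u f(1) l(1) r(2,1), where A = A and ?A1.0 = A1 and ?A2.0 = A2 and T = T])
      show "continuous_on {l..r} A" using A1 by (intro DERIV_continuous_on[of _ _ A1]) (auto intro: has_field_derivative_at_within)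
      show "f (g (A1 y) * A2 y) \<le> \<delta>" if "l < y" "y < r" for y using stn[of y] that by simp
      show "u (y, 0) \<le> A y" if y: "l \<le> y" "y \<le> r" for y
      proof -
        have "u (y, 0) \<le> D * psi \<gamma> (b - y) + C" by (rule init) (use y l r s2 in auto)
        also have "D * psi \<gamma> (b - y) \<le> D * psi \<gamma> (S y)"
          using S[OF y] D \<gamma> \<eta> by (intro mult_left_mono psi_antimono) (auto simp: S_def)
        finally show ?thesis using AD[of y] by simp
      qed
      show "u (l, s) \<le> A l + \<delta> * (s - 0)" if "0 \<le> s" "s < T" for s
      proof -
        have "u (l, s) \<le> B" using B[of "(l, s)"] l that by simp
        also have "B \<le> A l" unfolding Ax[OF order_refl r(2)] using s2 by (simp add: l_def K_def)
        finally have "u (l, s) \<le> A l" .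
        moreover have "0 \<le> \<delta> * (s - 0)" using \<delta> that by simp
        ultimately show ?thesis by linarith
      qed
      show "u (r, s) \<le> A r + \<delta> * (s - 0)" if "0 \<le> s" "s < T" for s
      proof -
        have "u (r, s) \<le> B'" using B'[of "(r, s)"] r sr that by (simp add: r_def l_def)
        also have "B' \<le> D * psi \<gamma> (S r) + C"
        proof -
          have "(B' - C) / D \<le> psi \<gamma> (S r)" using s0(2)[of "S r"] sr by (simp add: S_def r_def)
          then show ?thesis using D by (simp add: field_simps)
        qed
        finally have "u (r, s) \<le> A r" using AD[of r] by linarith
        moreover have "0 \<le> \<delta> * (s - 0)" using \<delta> that by simp
        ultimately show ?thesis by linarith
      qed
    qed (use A1 A2 x r t in \<open>auto simp: l_def\<close>)
    then show ?thesis using Ax[of x] x r by (simp add: l_def)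
  qed
  have "((\<lambda>d. K * (d / s2) powr \<theta>) \<longlongrightarrow> K * (0 / s2) powr \<theta>) (at_right 0)"
  proof -
    have "((\<lambda>d. d / s2) \<longlongrightarrow> 0 / s2) (at_right 0)" by (intro tendsto_intros) (use s2 in auto)
    then have "((\<lambda>d. (d / s2) powr \<theta>) \<longlongrightarrow> 0) (at_right 0)"
      using \<theta> s2 by (intro tendsto_zero_powrI[where b = \<theta>]) (auto simp: eventually_at_filter)
    then show ?thesis using tendsto_mult_left by fastforce
  qed
  then have "\<forall>\<^sub>F d in at_right 0. K * (d / s2) powr \<theta> < \<epsilon>"
    using \<epsilon> by (intro order_tendstoD) auto
  then obtain d0 where d0: "d0 > 0" "\<And>d. 0 < d \<Longrightarrow> d < d0 \<Longrightarrow> K * (d / s2) powr \<theta> < \<epsilon>"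
    unfolding eventually_at_right_field by blast
  define d where "d = min d0 s2"
  have d: "d > 0" "d \<le> d0" "d \<le> s2" using d0 s2 by (auto simp: d_def)
  have "u (x, t) \<le> D * psi \<gamma> (b - x) + C + 3 * \<epsilon>" if x: "b - d < x" "x < b" and t: "0 \<le> t" "t < T" for x t
  proof -
    define s where "s = b - x"
    have s: "0 < s" "s < d" using x by (auto simp: s_def)
    \<comment> \<open>Moving the singularity from \<open>b - \<eta>\<close> to \<open>b\<close>
      costs one \<open>\<epsilon>\<close>; the correction and the drift cost the other two.\<close>
    have "isCont (psi \<gamma>) s" using psi_deriv[OF \<gamma> s(1)] by (rule DERIV_isCont)
    then have "((\<lambda>\<eta>. D * psi \<gamma> (s - \<eta>)) \<longlongrightarrow> D * psi \<gamma> (s - 0)) (at_right 0)"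
      by (intro tendsto_intros isCont_tendsto_compose[of _ "psi \<gamma>"]) auto
    then have "\<forall>\<^sub>F \<eta> in at_right 0. D * psi \<gamma> (s - \<eta>) < D * psi \<gamma> s + \<epsilon>"
      using \<epsilon> by (intro order_tendstoD) auto
    moreover have "\<forall>\<^sub>F \<eta> in at_right 0. 0 < \<eta> \<and> \<eta> < s"
      using s unfolding eventually_at_right_field by blast
    ultimately have "\<forall>\<^sub>F \<eta> in at_right 0. D * psi \<gamma> (s - \<eta>) < D * psi \<gamma> s + \<epsilon> \<and> 0 < \<eta> \<and> \<eta> < s"
      by eventually_elim auto
    then obtain \<eta> where \<eta>: "D * psi \<gamma> (s - \<eta>) < D * psi \<gamma> s + \<epsilon>" "0 < \<eta>" "\<eta> < s"
      by (metis (mono_tags, lifting) eventually_happens trivial_limit_at_right_real)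
    have "u (x, t) \<le> D * psi \<gamma> (b - \<eta> - x) + C + K * ((b - \<eta> - x) / s2) powr \<theta> + \<delta> * t"
      by (rule main) (use \<eta> s d x t in \<open>auto simp: s_def\<close>)
    moreover have "b - \<eta> - x = s - \<eta>" by (simp add: s_def)
    moreover have "K * ((s - \<eta>) / s2) powr \<theta> < \<epsilon>" using d0(2)[of "s - \<eta>"] \<eta> s d by simp
    moreover have "\<delta> * t \<le> \<epsilon>"
    proof -
      have "\<delta> * t \<le> \<delta> * T" using \<delta> t by (intro mult_left_mono) auto
      then show ?thesis using T by (simp add: \<delta>_def)
    qed
    ultimately show ?thesis using \<eta>(1) by (simp add: s_def)
  qed
  then show ?thesis using d(1) by blast
qed

section \<open>Test functions and semicontinuous envelopes\<close>

lemma open_Q: "open (Q b)"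
  unfolding Q_def by (intro open_Times) auto

section \<open>From C2 test functions to jets\<close>

lemma taylor2_le:
  fixes F F1 F2 :: "real \<Rightarrow> real"
  assumes F: "\<And>y. \<bar>y - x0\<bar> \<le> \<bar>x - x0\<bar> \<Longrightarrow> (F has_real_derivative F1 y) (at y)"
    "\<And>y. \<bar>y - x0\<bar> \<le> \<bar>x - x0\<bar> \<Longrightarrow> (F1 has_real_derivative F2 y) (at y)"
    and M: "\<And>y. \<bar>y - x0\<bar> \<le> \<bar>x - x0\<bar> \<Longrightarrow> F2 y \<le> M"
  shows "F x \<le> F x0 + F1 x0 * (x - x0) + M / 2 * (x - x0)^2"
proof (cases "x = x0")
  case False
  define d where "d = \<bar>x - x0\<bar>"
  define diff where "diff n = (if n = 0 then F else if n = 1 then F1 else F2)" for n :: nat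
  have "\<exists>t. (if x < x0 then x < t \<and> t < x0 else x0 < t \<and> t < x) \<and>
    F x = (\<Sum>m<2. (diff m x0 / fact m) * (x - x0)^m) + (diff 2 t / fact 2) * (x - x0)^2"
  proof (rule Taylor[of 2 diff F "x0 - d" "x0 + d"])
    show "\<forall>m t. m < 2 \<and> x0 - d \<le> t \<and> t \<le> x0 + d \<longrightarrow> (diff m has_real_derivative diff (Suc m) t) (at t)"
      using F by (auto simp: diff_def d_def less_2_cases_iff abs_le_iff)
  qed (use False in \<open>auto simp: diff_def d_def\<close>)
  then obtain t where t: "if x < x0 then x < t \<and> t < x0 else x0 < t \<and> t < x"
    "F x = (\<Sum>m<2. (diff m x0 / fact m) * (x - x0)^m) + (diff 2 t / fact 2) * (x - x0)^2" by blast
  have "F x = F x0 + F1 x0 * (x - x0) + F2 t / 2 * (x - x0)^2"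
    using t(2) by (simp add: diff_def numeral_2_eq_2)
  moreover have "F2 t \<le> M" using t(1) by (intro M) (auto split: if_splits)
  ultimately show ?thesis by (simp add: mult_right_mono divide_right_mono)
qed simp

text \<open>The mixed contribution is at most \<open>M * |k| * |h|\<close>. Young's inequality
  splits it into a small multiple of \<open>h^2\<close>, charged to the second derivative in space,
  and a large multiple of \<open>k^2\<close>, which is harmless because \<open>jet_sub\<close>
  allows every \<open>c\<close>.\<close>

lemma jet_sub_test_function:
  assumes u: "jet_sub b f g u" and f: "continuous_on UNIV f" and z: "z \<in> Q b"
    and P: "has_partials_on (Q b) \<phi> \<phi>x \<phi>t" "has_partials_on (Q b) \<phi>x \<phi>xx \<phi>xt" "has_partials_on (Q b) \<phi>t \<phi>tx \<phi>tt"
    and c: "continuous_on (Q b) \<phi>xx" "continuous_on (Q b) \<phi>xt" "continuous_on (Q b) \<phi>tt"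
    and max: "\<forall>\<^sub>F y in nhds z. u y - \<phi> y \<le> u z - \<phi> z"
  shows "\<phi>t z \<le> f (g (\<phi>x z) * \<phi>xx z)"
proof (rule le_isCont_limit)
  show "isCont f (g (\<phi>x z) * \<phi>xx z)" using f by (simp add: continuous_on_eq_continuous_at)
  fix e :: real assume e: "e > 0"
  define \<epsilon> where "\<epsilon> = e / 2"
  have \<epsilon>: "\<epsilon> > 0" using e by (simp add: \<epsilon>_def)
  obtain x0 t0 where z0: "z = (x0, t0)" by fastforce
  define M where "M = \<bar>\<phi>xt z\<bar> + \<bar>\<phi>tt z\<bar> + 1"
  have at: "isCont \<phi>xx z" "isCont \<phi>xt z" "isCont \<phi>tt z"
    using c z open_Q by (auto simp: continuous_on_eq_continuous_at)
  have "\<forall>\<^sub>F y in nhds z. \<phi>xx y < \<phi>xx z + \<epsilon>"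
    using at(1) \<epsilon> by (intro order_tendstoD(2)) (auto simp: isCont_def tendsto_at_iff_tendsto_nhds)
  moreover have "\<forall>\<^sub>F y in nhds z. \<bar>\<phi>xt y\<bar> < M"
  proof (rule order_tendstoD(2))
    show "((\<lambda>y. \<bar>\<phi>xt y\<bar>) \<longlongrightarrow> \<bar>\<phi>xt z\<bar>) (nhds z)"
      using at(2) by (intro tendsto_rabs) (auto simp: isCont_def tendsto_at_iff_tendsto_nhds)
  qed (simp add: M_def)
  moreover have "\<forall>\<^sub>F y in nhds z. \<phi>tt y < M"
    using at(3) by (intro order_tendstoD(2)) (auto simp: isCont_def tendsto_at_iff_tendsto_nhds M_def)
  moreover have "\<forall>\<^sub>F y in nhds z. y \<in> Q b" using z open_Q by (rule eventually_nhds_in_open[rotated])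
  ultimately have "\<forall>\<^sub>F y in nhds z. y \<in> Q b \<and> \<phi>xx y < \<phi>xx z + \<epsilon> \<and> \<bar>\<phi>xt y\<bar> < M \<and> \<phi>tt y < M \<and> u y - \<phi> y \<le> u z - \<phi> z"
    using max by eventually_elim auto
  then obtain r where r: "r > 0" "\<And>y. dist y z < r \<Longrightarrow> y \<in> Q b \<and> \<phi>xx y < \<phi>xx z + \<epsilon> \<and> \<bar>\<phi>xt y\<bar> < M \<and> \<phi>tt y < M \<and> u y - \<phi> y \<le> u z - \<phi> z"
    unfolding eventually_nhds_metric by blast
  have near: "dist (x, t) z < r" if "\<bar>x - x0\<bar> < r / 2" "\<bar>t - t0\<bar> < r / 2" for x t
  proof -
    have "dist (x, t) z \<le> \<bar>x - x0\<bar> + \<bar>t - t0\<bar>"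
      unfolding z0 dist_Pair_Pair dist_real_def by (rule order_trans[OF sqrt_sum_squares_le_sum]) auto
    then show ?thesis using that by linarith
  qed
  have main: "u y \<le> u z + \<phi>t z * (snd y - snd z) + \<phi>x z * (fst y - fst z)
        + (\<phi>xx z + e) / 2 * (fst y - fst z)^2 + (M / 2 + M^2 / (2 * \<epsilon>)) * (snd y - snd z)^2"
    if "dist y z < r / 2" for y
  proof -
    obtain x t where y: "y = (x, t)" by fastforce
    define h k where "h = x - x0" and "k = t - t0"
    have "\<bar>x - x0\<bar> \<le> dist y z" "\<bar>t - t0\<bar> \<le> dist y z"
      using dist_fst_le[of y z] dist_snd_le[of y z] by (auto simp: y z0 dist_real_def)
    then have hk: "\<bar>x - x0\<bar> < r / 2" "\<bar>t - t0\<bar> < r / 2" using that by auto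
    \<comment> \<open>The expansion goes first in \<open>x\<close> at time \<open>t\<close>, then in
      \<open>t\<close> at \<open>x0\<close>; the mixed term arises when \<open>\<phi>x\<close> is
      moved from time \<open>t\<close> back to \<open>t0\<close>.\<close>
    have 1: "\<phi> (x, t) \<le> \<phi> (x0, t) + \<phi>x (x0, t) * (x - x0) + (\<phi>xx z + \<epsilon>) / 2 * (x - x0)^2"
    proof (rule taylor2_le[of x0 x "\<lambda>x. \<phi> (x, t)" "\<lambda>x. \<phi>x (x, t)" "\<lambda>x. \<phi>xx (x, t)"])
      fix s assume "\<bar>s - x0\<bar> \<le> \<bar>x - x0\<bar>"
      then have "\<bar>s - x0\<bar> < r / 2" using hk by simp
      from r(2)[OF near[OF this hk(2)]] P(1,2)
      show "((\<lambda>x. \<phi> (x, t)) has_real_derivative \<phi>x (s, t)) (at s)"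
        "((\<lambda>x. \<phi>x (x, t)) has_real_derivative \<phi>xx (s, t)) (at s)" "\<phi>xx (s, t) \<le> \<phi>xx z + \<epsilon>"
        unfolding has_partials_on_def by fastforce+
    qed
    have 2: "\<phi> (x0, t) \<le> \<phi> (x0, t0) + \<phi>t (x0, t0) * (t - t0) + M / 2 * (t - t0)^2"
    proof (rule taylor2_le[of t0 t "\<lambda>t. \<phi> (x0, t)" "\<lambda>t. \<phi>t (x0, t)" "\<lambda>t. \<phi>tt (x0, t)"])
      fix s assume "\<bar>s - t0\<bar> \<le> \<bar>t - t0\<bar>"
      then have "\<bar>s - t0\<bar> < r / 2" using hk by simp
      with near[of x0 s] r(1) have "dist (x0, s) z < r" by simp
      from r(2)[OF this] P(1,3)
      show "((\<lambda>t. \<phi> (x0, t)) has_real_derivative \<phi>t (x0, s)) (at s)"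
        "((\<lambda>t. \<phi>t (x0, t)) has_real_derivative \<phi>tt (x0, s)) (at s)" "\<phi>tt (x0, s) \<le> M"
        unfolding has_partials_on_def by fastforce+
    qed
    have 3: "\<bar>\<phi>x (x0, t) - \<phi>x (x0, t0)\<bar> \<le> M * \<bar>t - t0\<bar>"
    proof -
      have "norm (\<phi>x (x0, t) - \<phi>x (x0, t0)) \<le> M * norm (t - t0)"
      proof (rule field_differentiable_bound[of "closed_segment t0 t" "\<lambda>s. \<phi>x (x0, s)" "\<lambda>s. \<phi>xt (x0, s)"])
        fix s assume "s \<in> closed_segment t0 t"
        then have "\<bar>s - t0\<bar> \<le> \<bar>t - t0\<bar>" by (auto simp: closed_segment_eq_real_ivl split: if_splits)
        then have "\<bar>s - t0\<bar> < r / 2" using hk by simp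
        with near[of x0 s] r(1) have "dist (x0, s) z < r" by simp
        from r(2)[OF this] P(2)
        have "((\<lambda>t. \<phi>x (x0, t)) has_real_derivative \<phi>xt (x0, s)) (at s)" "\<bar>\<phi>xt (x0, s)\<bar> \<le> M"
          unfolding has_partials_on_def by fastforce+
        then show "((\<lambda>t. \<phi>x (x0, t)) has_field_derivative \<phi>xt (x0, s)) (at s within closed_segment t0 t)"
          "norm (\<phi>xt (x0, s)) \<le> M" by (auto intro: has_field_derivative_at_within)
      qed auto
      then show ?thesis by simp
    qed
    have "(\<phi>x (x0, t) - \<phi>x (x0, t0)) * h \<le> \<epsilon> / 2 * h^2 + M^2 / (2 * \<epsilon>) * k^2"
    proof -
      have "(\<phi>x (x0, t) - \<phi>x (x0, t0)) * h \<le> \<bar>\<phi>x (x0, t) - \<phi>x (x0, t0)\<bar> * \<bar>h\<bar>"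
        by (metis abs_ge_self abs_mult)
      also have "\<dots> \<le> (M * \<bar>k\<bar>) * \<bar>h\<bar>" using 3 by (intro mult_right_mono) (auto simp: k_def)
      also have "\<dots> \<le> \<epsilon> / 2 * h^2 + M^2 / (2 * \<epsilon>) * k^2"
      proof -
        have "0 \<le> (\<epsilon> * \<bar>h\<bar> - M * \<bar>k\<bar>)^2 / (2 * \<epsilon>)" using \<epsilon> by simp
        also have "(\<epsilon> * \<bar>h\<bar> - M * \<bar>k\<bar>)^2 / (2 * \<epsilon>) = \<epsilon> / 2 * \<bar>h\<bar>^2 - (M * \<bar>k\<bar>) * \<bar>h\<bar> + M^2 / (2 * \<epsilon>) * \<bar>k\<bar>^2"
          using \<epsilon> by (simp add: power2_diff power_mult_distrib field_simps power2_eq_square)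
        finally show ?thesis by simp
      qed
      finally show ?thesis .
    qed
    then have "\<phi> y \<le> \<phi> z + \<phi>t z * k + \<phi>x z * h + (\<phi>xx z + e) / 2 * h^2 + (M / 2 + M^2 / (2 * \<epsilon>)) * k^2"
      using 1 2 by (simp add: y z0 h_def[symmetric] k_def[symmetric] \<epsilon>_def algebra_simps add_divide_distrib)
    moreover have "dist y z < r" using that r(1) by linarith
    then have "u y - \<phi> y \<le> u z - \<phi> z" using r(2) by blast
    ultimately show ?thesis by (simp add: y z0 h_def k_def)
  qed
  have "\<forall>\<^sub>F y in nhds z. u y \<le> u z + \<phi>t z * (snd y - snd z) + \<phi>x z * (fst y - fst z)
        + (\<phi>xx z + e) / 2 * (fst y - fst z)^2 + (M / 2 + M^2 / (2 * \<epsilon>)) * (snd y - snd z)^2"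
    unfolding eventually_nhds_metric using main r(1) by (intro exI[of _ "r / 2"]) auto
  then show "\<phi>t z \<le> f (g (\<phi>x z) * (\<phi>xx z + e))"
    using u z unfolding jet_sub_def by blast
qed

lemma partials_deriv:
  assumes "has_partials_on (Q b) \<phi> \<phi>x \<phi>t" "z \<in> Q b"
  shows "d_x \<phi> z = \<phi>x z" "d_t \<phi> z = \<phi>t z"
proof -
  obtain x t where z: "z = (x, t)" by fastforce
  have "((\<lambda>y. \<phi> (y, t)) has_real_derivative \<phi>x (x, t)) (at x)" "((\<lambda>s. \<phi> (x, s)) has_real_derivative \<phi>t (x, t)) (at t)"
    using assms z unfolding has_partials_on_def by fastforce+
  then show "d_x \<phi> z = \<phi>x z" "d_t \<phi> z = \<phi>t z" by (simp_all add: z d_x_def d_t_def DERIV_imp_deriv)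
qed

lemma partials_deriv2:
  assumes "has_partials_on (Q b) \<phi> \<phi>x \<phi>t" "has_partials_on (Q b) \<phi>x \<phi>xx \<phi>xt" "z \<in> Q b"
  shows "d_x (d_x \<phi>) z = \<phi>xx z"
proof -
  obtain x t where z: "z = (x, t)" by fastforce
  have xt: "-b < x" "x < b" "t > 0" using assms(3) by (auto simp: z Q_def)
  have d: "((\<lambda>y. \<phi>x (y, t)) has_real_derivative \<phi>xx (x, t)) (at x)"
    using assms z unfolding has_partials_on_def by fastforce
  have "\<forall>\<^sub>F y in nhds x. y \<in> {-b<..<b}" using xt by (intro eventually_nhds_in_open) auto
  then have ev: "\<forall>\<^sub>F y in nhds x. d_x \<phi> (y, t) = \<phi>x (y, t)"
    by eventually_elim (use partials_deriv(1)[OF assms(1)] xt in \<open>auto simp: Q_def\<close>)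
  have "((\<lambda>y. d_x \<phi> (y, t)) has_real_derivative \<phi>xx (x, t)) (at x)"
    using d DERIV_cong_ev[OF refl ev refl] by simp
  then show ?thesis unfolding z by (simp add: d_x_def[of "d_x \<phi>"] DERIV_imp_deriv)
qed

lemma jet_sub_C2:
  assumes u: "jet_sub b f g u" and f: "continuous_on UNIV f" and z: "z \<in> Q b" and \<phi>: "C2_on (Q b) \<phi>"
    and max: "\<forall>\<^sub>F y in nhds z. u y - \<phi> y \<le> u z - \<phi> z"
  shows "d_t \<phi> z + F f g (d_x \<phi> z) (d_x (d_x \<phi>) z) \<le> 0"
proof -
  obtain \<phi>x \<phi>t \<phi>xx \<phi>xt \<phi>tx \<phi>tt where
    P: "has_partials_on (Q b) \<phi> \<phi>x \<phi>t" "has_partials_on (Q b) \<phi>x \<phi>xx \<phi>xt" "has_partials_on (Q b) \<phi>t \<phi>tx \<phi>tt"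
    and c: "\<forall>h \<in> {\<phi>, \<phi>x, \<phi>t, \<phi>xx, \<phi>xt, \<phi>tx, \<phi>tt}. continuous_on (Q b) h"
    using \<phi> unfolding C2_on_def by blast
  have "\<phi>t z \<le> f (g (\<phi>x z) * \<phi>xx z)"
    by (rule jet_sub_test_function[OF u f z P _ _ _ max]) (use c in auto)
  then show ?thesis by (simp add: F_def partials_deriv[OF P(1) z] partials_deriv2[OF P(1,2) z])
qed

lemma has_partials_on_minus:
  "has_partials_on S \<phi> \<phi>x \<phi>t \<Longrightarrow> has_partials_on S (\<lambda>z. - \<phi> z) (\<lambda>z. - \<phi>x z) (\<lambda>z. - \<phi>t z)"
  unfolding has_partials_on_def by (auto intro: DERIV_minus)

lemma jet_super_C2:
  assumes v: "jet_sub b (\<lambda>s. - f (- s)) (\<lambda>p. g (- p)) (\<lambda>z. - v z)" and f: "continuous_on UNIV f"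
    and z: "z \<in> Q b" and \<phi>: "C2_on (Q b) \<phi>"
    and min: "\<forall>\<^sub>F y in nhds z. v y - \<phi> y \<ge> v z - \<phi> z"
  shows "d_t \<phi> z + F f g (d_x \<phi> z) (d_x (d_x \<phi>) z) \<ge> 0"
proof -
  obtain \<phi>x \<phi>t \<phi>xx \<phi>xt \<phi>tx \<phi>tt where
    P: "has_partials_on (Q b) \<phi> \<phi>x \<phi>t" "has_partials_on (Q b) \<phi>x \<phi>xx \<phi>xt" "has_partials_on (Q b) \<phi>t \<phi>tx \<phi>tt"
    and c: "\<forall>h \<in> {\<phi>, \<phi>x, \<phi>t, \<phi>xx, \<phi>xt, \<phi>tx, \<phi>tt}. continuous_on (Q b) h"
    using \<phi> unfolding C2_on_def by blast
  have fd: "continuous_on UNIV (\<lambda>s. - f (- s))"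
    by (intro continuous_intros continuous_on_compose2[OF f]) auto
  have max: "\<forall>\<^sub>F y in nhds z. - v y - - \<phi> y \<le> - v z - - \<phi> z"
    using min by eventually_elim auto
  have "- \<phi>t z \<le> - f (- (g (- (- \<phi>x z)) * - \<phi>xx z))"
    by (rule jet_sub_test_function[OF v fd z has_partials_on_minus[OF P(1)] has_partials_on_minus[OF P(2)]
          has_partials_on_minus[OF P(3)] _ _ _ max]) (use c in \<open>auto intro!: continuous_intros\<close>)
  then show ?thesis by (simp add: F_def partials_deriv[OF P(1) z] partials_deriv2[OF P(1,2) z])
qed

lemma quadratic_test:
  fixes z :: "real \<times> real" and \<tau> p X c :: real
  defines "\<phi> \<equiv> \<lambda>y. \<tau> * (snd y - snd z) + p * (fst y - fst z) + X/2 * (fst y - fst z)^2 + c * (snd y - snd z)^2"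
  assumes z: "z \<in> Q b"
  shows "C2_on (Q b) \<phi>" "d_t \<phi> z = \<tau>" "d_x \<phi> z = p" "d_x (d_x \<phi>) z = X"
proof -
  define \<phi>x where "\<phi>x y = p + X * (fst y - fst z)" for y :: "real \<times> real"
  define \<phi>t where "\<phi>t y = \<tau> + 2 * c * (snd y - snd z)" for y :: "real \<times> real"
  have P: "has_partials_on (Q b) \<phi> \<phi>x \<phi>t" "has_partials_on (Q b) \<phi>x (\<lambda>_. X) (\<lambda>_. 0)"
    "has_partials_on (Q b) \<phi>t (\<lambda>_. 0) (\<lambda>_. 2 * c)"
    unfolding has_partials_on_def \<phi>_def \<phi>x_def \<phi>t_def by (auto intro!: derivative_eq_intros)
  have "continuous_on (Q b) h" if "h \<in> {\<phi>, \<phi>x, \<phi>t, \<lambda>_. X, \<lambda>_. 0, \<lambda>_. 0, \<lambda>_. 2 * c}" for h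
    using that unfolding \<phi>_def \<phi>x_def \<phi>t_def by (auto intro!: continuous_intros)
  then show "C2_on (Q b) \<phi>" unfolding C2_on_def using P by blast
  show "d_t \<phi> z = \<tau>" "d_x \<phi> z = p" using partials_deriv[OF P(1) z] by (simp_all add: \<phi>x_def \<phi>t_def)
  show "d_x (d_x \<phi>) z = X" by (rule partials_deriv2[OF P(1,2) z])
qed

lemma sub_solution_jet:
  assumes "sub_solution b f g u"
  shows "jet_sub b f g u"
  unfolding jet_sub_def
proof (intro ballI allI impI)
  fix z \<tau> p X c
  assume z: "z \<in> Q b" and le: "\<forall>\<^sub>F y in nhds z. u y \<le> u z + \<tau> * (snd y - snd z) + p * (fst y - fst z)
        + X/2 * (fst y - fst z)^2 + c * (snd y - snd z)^2"
  define \<phi> where "\<phi> y = \<tau> * (snd y - snd z) + p * (fst y - fst z) + X/2 * (fst y - fst z)^2 + c * (snd y - snd z)^2"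
    for y :: "real \<times> real"
  note q = quadratic_test[OF z, of \<tau> p X c, folded \<phi>_def]
  have "\<forall>\<^sub>F y in nhds z. u y - \<phi> y \<le> u z - \<phi> z" using le by eventually_elim (simp add: \<phi>_def)
  then have "d_t \<phi> z + F f g (d_x \<phi> z) (d_x (d_x \<phi>) z) \<le> 0"
    using assms z q(1) unfolding sub_solution_def by blast
  then show "\<tau> \<le> f (g p * X)" by (simp add: q F_def)
qed

lemma super_solution_jet:
  assumes "super_solution b f g v"
  shows "jet_sub b (\<lambda>s. - f (- s)) (\<lambda>p. g (- p)) (\<lambda>z. - v z)"
  unfolding jet_sub_def
proof (intro ballI allI impI)
  fix z \<tau> p X c
  assume z: "z \<in> Q b" and le: "\<forall>\<^sub>F y in nhds z. - v y \<le> - v z + \<tau> * (snd y - snd z) + p * (fst y - fst z)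
        + X/2 * (fst y - fst z)^2 + c * (snd y - snd z)^2"
  define \<phi> where "\<phi> y = (- \<tau>) * (snd y - snd z) + (- p) * (fst y - fst z) + (- X)/2 * (fst y - fst z)^2 + (- c) * (snd y - snd z)^2"
    for y :: "real \<times> real"
  note q = quadratic_test[OF z, of "- \<tau>" "- p" "- X" "- c", folded \<phi>_def]
  have "\<forall>\<^sub>F y in nhds z. v y - \<phi> y \<ge> v z - \<phi> z" using le by eventually_elim (simp add: \<phi>_def)
  then have "d_t \<phi> z + F f g (d_x \<phi> z) (d_x (d_x \<phi>) z) \<ge> 0"
    using assms z q(1) unfolding super_solution_def by blast
  then show "\<tau> \<le> - f (- (g (- p) * X))" by (simp add: q F_def)
qed

section \<open>Semicontinuous envelopes as infima of suprema over balls\<close>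

lemma upper_env_tendsto:
  "((\<lambda>r. SUP p \<in> Q0 b \<inter> ball z r. ereal (u p)) \<longlongrightarrow> (INF r\<in>{0<..}. SUP p \<in> Q0 b \<inter> ball z r. ereal (u p))) (at_right 0)"
proof (rule order_tendstoI)
  fix a assume a: "a < (INF r\<in>{0<..}. SUP p \<in> Q0 b \<inter> ball z r. ereal (u p))"
  have "\<forall>\<^sub>F r in at_right (0::real). 0 < r" by (simp add: eventually_at_right_less)
  then show "\<forall>\<^sub>F r in at_right 0. a < (SUP p \<in> Q0 b \<inter> ball z r. ereal (u p))"
    by eventually_elim (rule less_le_trans[OF a INF_lower], simp)
next
  fix a assume "(INF r\<in>{0<..}. SUP p \<in> Q0 b \<inter> ball z r. ereal (u p)) < a"
  then obtain r0 where r0: "0 < r0" "(SUP p \<in> Q0 b \<inter> ball z r0. ereal (u p)) < a" unfolding INF_less_iff by auto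
  have "\<forall>\<^sub>F r in at_right (0::real). 0 < r \<and> r < r0" using r0(1) unfolding eventually_at_right_field by blast
  then show "\<forall>\<^sub>F r in at_right 0. (SUP p \<in> Q0 b \<inter> ball z r. ereal (u p)) < a"
  proof eventually_elim
    case (elim r)
    have "(SUP p \<in> Q0 b \<inter> ball z r. ereal (u p)) \<le> (SUP p \<in> Q0 b \<inter> ball z r0. ereal (u p))"
      by (rule SUP_subset_mono) (use elim in auto)
    then show ?case using r0(2) by simp
  qed
qed

lemma upper_env_eq: "upper_env b u z = (INF r\<in>{0<..}. SUP p \<in> Q0 b \<inter> ball z r. ereal (u p))"
  unfolding upper_env_def by (rule tendsto_Lim[OF _ upper_env_tendsto]) simp

text \<open>By this duality facts about lower envelopes are read off from those about upper
  envelopes of the negated function.\<close>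

lemma lower_env_eq: "lower_env b u z = - upper_env b (\<lambda>p. - u p) z"
proof -
  have *: "(INF p \<in> Q0 b \<inter> ball z r. ereal (u p)) = - (SUP p \<in> Q0 b \<inter> ball z r. ereal (- u p))" for r
    by (simp flip: uminus_ereal.simps add: ereal_SUP_uminus_eq)
  show ?thesis
    unfolding lower_env_def upper_env_eq *
    by (rule tendsto_Lim[OF _ tendsto_uminus_ereal[OF upper_env_tendsto]]) simp
qed

lemma upper_env_ge: "z \<in> Q0 b \<Longrightarrow> ereal (u z) \<le> upper_env b u z"
  unfolding upper_env_eq by (intro INF_greatest SUP_upper) auto

lemma upper_env_le:
  assumes "r > 0" "\<And>p. p \<in> Q0 b \<Longrightarrow> dist p z < r \<Longrightarrow> u p \<le> a"
  shows "upper_env b u z \<le> ereal a"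
proof -
  have "upper_env b u z \<le> (SUP p \<in> Q0 b \<inter> ball z r. ereal (u p))"
    unfolding upper_env_eq by (rule INF_lower) (use assms in auto)
  also have "\<dots> \<le> ereal a" by (rule SUP_least) (use assms(2) in \<open>auto simp: dist_commute\<close>)
  finally show ?thesis .
qed

lemma upper_env_lessD:
  assumes "upper_env b u z < ereal a"
  obtains r where "r > 0" "\<And>p. p \<in> Q0 b \<Longrightarrow> dist p z < r \<Longrightarrow> u p < a"
proof -
  obtain r where r: "0 < r" "(SUP p \<in> Q0 b \<inter> ball z r. ereal (u p)) < ereal a"
    using assms unfolding upper_env_eq INF_less_iff by auto
  have "u p < a" if "p \<in> Q0 b" "dist p z < r" for p
  proof -
    have "ereal (u p) \<le> (SUP p \<in> Q0 b \<inter> ball z r. ereal (u p))"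
      by (rule SUP_upper) (use that in \<open>auto simp: dist_commute\<close>)
    then show ?thesis using r(2) by (metis le_less_trans ereal_less_le linorder_not_less less_ereal.simps(1))
  qed
  then show ?thesis using that r(1) by blast
qed

lemma upper_env_greaterD:
  assumes "ereal a < upper_env b u z" "r > 0"
  obtains p where "p \<in> Q0 b" "dist p z < r" "a < u p"
proof -
  have "ereal a < (SUP p \<in> Q0 b \<inter> ball z r. ereal (u p))"
    using assms unfolding upper_env_eq by (meson INF_lower greaterThan_iff less_le_trans)
  then show ?thesis using that unfolding less_SUP_iff by (auto simp: dist_commute)
qed

lemma usc_upper_env:
  assumes fin: "\<And>z. z \<in> Q0 b \<Longrightarrow> \<bar>upper_env b u z\<bar> \<noteq> \<infinity>"
  shows "usc_on (Q0 b) (\<lambda>z. real_of_ereal (upper_env b u z))"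
  unfolding usc_on_iff
proof (intro ballI allI impI)
  fix z and e :: real assume z: "z \<in> Q0 b" "e > 0"
  let ?U = "\<lambda>z. real_of_ereal (upper_env b u z)"
  have U: "upper_env b u y = ereal (?U y)" if "y \<in> Q0 b" for y using fin[OF that] by (simp add: ereal_real)
  have "ereal (?U z) < ereal (?U z + e / 2)" using z(2) by simp
  then have "upper_env b u z < ereal (?U z + e / 2)" using U[OF z(1)] by metis
  then obtain r where r: "r > 0" "\<And>p. p \<in> Q0 b \<Longrightarrow> dist p z < r \<Longrightarrow> u p < ?U z + e / 2"
    by (rule upper_env_lessD) (rule that)
  have "?U y < ?U z + e" if y: "y \<in> Q0 b" "dist y z < r" for y
  proof -
    have "upper_env b u y \<le> ereal (?U z + e / 2)"
    proof (rule upper_env_le[of "r - dist y z"])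
      fix p assume p: "p \<in> Q0 b" "dist p y < r - dist y z"
      have "dist p z < r" using dist_triangle[of p z y] p by simp
      then show "u p \<le> ?U z + e / 2" using r(2) p by fastforce
    qed (use y in simp)
    then have "?U y \<le> ?U z + e / 2" using U[OF y(1)] by (metis ereal_less_eq(3))
    then show ?thesis using z(2) by simp
  qed
  then show "\<exists>d>0. \<forall>y\<in>Q0 b. dist y z < d \<longrightarrow> ?U y < ?U z + e" using r(1) by blast
qed

section \<open>Perron's method\<close>

lemma interval_attains:
  fixes h :: "real \<Rightarrow> real"
  assumes "l \<le> r" "continuous_on {l..r} h"
  shows "\<exists>x0. \<forall>x\<in>{l..r}. h x0 \<le> h x" "\<exists>x0. \<forall>x\<in>{l..r}. h x \<le> h x0"
proof -
  have "{l..r} \<noteq> {}" using assms(1) by auto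
  from continuous_attains_inf[OF compact_Icc this assms(2)] continuous_attains_sup[OF compact_Icc this assms(2)]
  show "\<exists>x0. \<forall>x\<in>{l..r}. h x0 \<le> h x" "\<exists>x0. \<forall>x\<in>{l..r}. h x \<le> h x0" by blast+
qed

text \<open>Restricting the inequality to the two coordinate lines through the point gives
  one-dimensional maxima. They determine the first-order entries of the jet and bound
  \<open>X\<close> from below.\<close>

lemma separated_jet:
  fixes A A1 B :: "real \<Rightarrow> real"
  assumes le: "\<forall>\<^sub>F y in nhds (x0, t0). A (fst y) + B (snd y) \<le> A x0 + B t0 + \<tau> * (snd y - t0) + p * (fst y - x0)
        + X/2 * (fst y - x0)^2 + c * (snd y - t0)^2"
    and A: "\<forall>\<^sub>F x in nhds x0. (A has_real_derivative A1 x) (at x)" "(A1 has_real_derivative A2) (at x0)"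
    and B: "(B has_real_derivative B1) (at t0)"
  shows "\<tau> = B1" "p = A1 x0" "A2 \<le> X"
proof -
  have "filterlim (\<lambda>x. (x, t0)) (nhds (x0, t0)) (nhds x0)" by (intro tendsto_intros) (simp add: filterlim_ident)
  from eventually_compose_filterlim[OF le this]
  have max: "\<forall>\<^sub>F x in nhds x0. A x - p * (x - x0) - X/2 * (x - x0)^2 \<le> A x0 - p * (x0 - x0) - X/2 * (x0 - x0)^2"
    by eventually_elim simp
  have d1: "\<forall>\<^sub>F x in nhds x0. ((\<lambda>x. A x - p * (x - x0) - X/2 * (x - x0)^2) has_real_derivative (A1 x - p - X * (x - x0))) (at x)"
    using A(1) by eventually_elim (auto intro!: derivative_eq_intros)
  have d2: "((\<lambda>x. A1 x - p - X * (x - x0)) has_real_derivative (A2 - X)) (at x0)"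
    using A(2) by (auto intro!: derivative_eq_intros)
  show "p = A1 x0" "A2 \<le> X" using second_derivative_local_max[OF max d1 d2] by auto
  have "filterlim (\<lambda>t. (x0, t)) (nhds (x0, t0)) (nhds t0)" by (intro tendsto_intros) (simp add: filterlim_ident)
  from eventually_compose_filterlim[OF le this]
  have "\<forall>\<^sub>F t in nhds t0. B t - \<tau> * (t - t0) - c * (t - t0)^2 \<le> B t0 - \<tau> * (t0 - t0) - c * (t0 - t0)^2"
    by eventually_elim simp
  then obtain d where d: "d > 0" "\<And>t. dist t t0 < d \<Longrightarrow> B t - \<tau> * (t - t0) - c * (t - t0)^2 \<le> B t0 - \<tau> * (t0 - t0) - c * (t0 - t0)^2"
    unfolding eventually_nhds_metric by blast
  have "((\<lambda>t. B t - \<tau> * (t - t0) - c * (t - t0)^2) has_real_derivative (B1 - \<tau>)) (at t0)"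
    using B by (auto intro!: derivative_eq_intros)
  then have "B1 - \<tau> = 0"
    by (rule DERIV_local_max[OF _ d(1)]) (use d(2) in \<open>auto simp: dist_real_def abs_minus_commute\<close>)
  then show "\<tau> = B1" by simp
qed

text \<open>This is where ellipticity enters: a jet from above has the same first derivatives and a
  second derivative that is at least as large, so \<open>f (g p * X)\<close> can only
  increase.\<close>

lemma jet_sub_classical:
  assumes f: "strict_mono f" and g: "\<And>s. g s > 0"
    and A: "\<And>x. -b < x \<Longrightarrow> x < b \<Longrightarrow> (A has_real_derivative A1 x) (at x)"
      "\<And>x. -b < x \<Longrightarrow> x < b \<Longrightarrow> (A1 has_real_derivative A2 x) (at x)"
    and eq: "\<And>x. -b < x \<Longrightarrow> x < b \<Longrightarrow> C \<le> f (g (A1 x) * A2 x)"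
  shows "jet_sub b f g (\<lambda>z. A (fst z) + C * snd z)"
  unfolding jet_sub_def
proof (intro ballI allI impI)
  fix z \<tau> p X c
  assume z: "z \<in> Q b" and le: "\<forall>\<^sub>F y in nhds z. A (fst y) + C * snd y \<le> A (fst z) + C * snd z + \<tau> * (snd y - snd z) + p * (fst y - fst z)
        + X/2 * (fst y - fst z)^2 + c * (snd y - snd z)^2"
  obtain x0 t0 where z0: "z = (x0, t0)" by fastforce
  have x0: "-b < x0" "x0 < b" using z by (auto simp: z0 Q_def)
  have "\<forall>\<^sub>F x in nhds x0. x \<in> {-b<..<b}" using x0 by (intro eventually_nhds_in_open) auto
  then have d1: "\<forall>\<^sub>F x in nhds x0. (A has_real_derivative A1 x) (at x)" by eventually_elim (use A in auto)
  have d2: "((\<lambda>t. C * t) has_real_derivative C) (at t0)" by (auto intro!: derivative_eq_intros)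
  have j: "\<tau> = C" "p = A1 x0" "A2 x0 \<le> X"
    using separated_jet[OF _ d1 A(2)[OF x0] d2] le by (auto simp: z0)
  have "g p * A2 x0 \<le> g p * X" using j(3) g[of p] by (intro mult_left_mono) auto
  then have "f (g p * A2 x0) \<le> f (g p * X)" using f by (simp add: strict_mono_less_eq)
  then show "\<tau> \<le> f (g p * X)" using eq[OF x0] j by simp
qed

lemma coercive_bounded_below:
  fixes u0 :: "real \<Rightarrow> real"
  assumes b: "b > 0" and u0_cont: "continuous_on {-b<..<b} u0"
    and u0_lim: "filterlim u0 at_top (at_left b)" "filterlim u0 at_top (at_right (-b))"
  shows "\<exists>m. \<forall>x. -b < x \<longrightarrow> x < b \<longrightarrow> m \<le> u0 x"
proof -
  obtain c1 where c1: "c1 < b" "\<And>y. c1 < y \<Longrightarrow> y < b \<Longrightarrow> 0 \<le> u0 y"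
    using u0_lim(1) unfolding filterlim_at_top eventually_at_left_field by blast
  obtain c2 where c2: "c2 > -b" "\<And>y. -b < y \<Longrightarrow> y < c2 \<Longrightarrow> 0 \<le> u0 y"
    using u0_lim(2) unfolding filterlim_at_top eventually_at_right_field by blast
  define l where "l = min 0 ((c2 - b) / 2)"
  define r where "r = max 0 ((c1 + b) / 2)"
  have lr: "-b < l" "l \<le> r" "r < b" "c1 < r" "l < c2"
  proof -
    show "-b < l" "l \<le> r" "r < b" using b c1(1) c2(1) by (auto simp: l_def r_def)
    have "c1 < (c1 + b) / 2" "(c2 - b) / 2 < c2" using c1(1) c2(1) by simp_all
    then show "c1 < r" "l < c2" unfolding l_def r_def by linarith+
  qed
  have "continuous_on {l..r} u0" by (rule continuous_on_subset[OF u0_cont]) (use lr in auto)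
  then obtain x0 where x0: "\<And>x. x \<in> {l..r} \<Longrightarrow> u0 x0 \<le> u0 x"
    using interval_attains(1)[OF lr(2)] by blast
  have "min 0 (u0 x0) \<le> u0 x" if "-b < x" "x < b" for x
  proof -
    consider "x < c2" | "c1 < x" | "x \<in> {l..r}" using lr by force
    then show ?thesis using c1(2)[of x] c2(2)[of x] x0[of x] that by cases auto
  qed
  then show ?thesis by blast
qed

section \<open>The Perron family and its envelopes\<close>

locale perron =
  fixes b C :: real and f g u0 A A1 A2 :: "real \<Rightarrow> real"
  assumes b: "b > 0" and f_cont: "continuous_on UNIV f" and f_mono: "strict_mono f" and f0: "f 0 = 0"
    and g_cont: "continuous_on UNIV g" and g_pos: "\<And>s. g s > 0"
    and u0_cont: "continuous_on {-b<..<b} u0"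
    and u0_lim: "filterlim u0 at_top (at_left b)" "filterlim u0 at_top (at_right (-b))"
    and A1: "\<And>x. -b < x \<Longrightarrow> x < b \<Longrightarrow> (A has_real_derivative A1 x) (at x)"
    and A2: "\<And>x. -b < x \<Longrightarrow> x < b \<Longrightarrow> (A1 has_real_derivative A2 x) (at x)"
    and A_super: "\<And>x. -b < x \<Longrightarrow> x < b \<Longrightarrow> f (g (A1 x) * A2 x) \<le> C"
    and A_ge: "\<And>x. -b < x \<Longrightarrow> x < b \<Longrightarrow> u0 x \<le> A x" and C: "C \<ge> 0"
begin

definition majorant :: "real \<times> real \<Rightarrow> real" where "majorant z = A (fst z) + C * snd z"

text \<open>The bound by \<open>majorant\<close> keeps the supremum finite. No lateral condition is
  imposed on the members; the blow-up at \<open>\<plusminus>b\<close> is produced by the affine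
  ones.\<close>

definition family :: "(real \<times> real \<Rightarrow> real) set" where
  "family = {w. usc_on (Q0 b) w \<and> jet_sub b f g w \<and> (\<forall>z\<in>Q0 b. w z \<le> majorant z) \<and>
     (\<forall>x. -b < x \<longrightarrow> x < b \<longrightarrow> w (x, 0) \<le> u0 x)}"

definition U :: "real \<times> real \<Rightarrow> real" where "U z = Sup ((\<lambda>w. w z) ` family)"

definition upper :: "real \<times> real \<Rightarrow> real" where "upper z = real_of_ereal (upper_env b U z)"

definition lower :: "real \<times> real \<Rightarrow> real" where "lower z = real_of_ereal (lower_env b U z)"

lemmas u0_bounded_below = coercive_bounded_below[OF b u0_cont u0_lim]

lemma majorant_cont: "continuous_on (Q0 b) majorant"
proof -
  have "continuous_on {-b<..<b} A" using A1 by (intro DERIV_continuous_on[of _ _ A1]) (auto intro: has_field_derivative_at_within)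
  then have "continuous_on (Q0 b) (\<lambda>z. A (fst z))"
    by (rule continuous_on_compose2) (auto simp: Q0_def intro!: continuous_intros)
  then show ?thesis unfolding majorant_def by (intro continuous_intros)
qed

lemma usc_continuous: "continuous_on S \<phi> \<Longrightarrow> usc_on S (\<phi> :: real \<times> real \<Rightarrow> real)"
  unfolding usc_on_iff
proof (intro ballI allI impI)
  fix z and e :: real assume "continuous_on S \<phi>" "z \<in> S" "e > 0"
  then obtain d where "d > 0" "\<forall>y\<in>S. dist y z < d \<longrightarrow> dist (\<phi> y) (\<phi> z) < e"
    unfolding continuous_on_iff by blast
  then show "\<exists>d>0. \<forall>y\<in>S. dist y z < d \<longrightarrow> \<phi> y < \<phi> z + e"
    by (intro exI[of _ d]) (auto simp: dist_real_def)
qed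

lemma familyD:
  assumes "w \<in> family"
  shows "usc_on (Q0 b) w" "jet_sub b f g w" "z \<in> Q0 b \<Longrightarrow> w z \<le> majorant z" "-b < x \<Longrightarrow> x < b \<Longrightarrow> w (x, 0) \<le> u0 x"
  using assms by (auto simp: family_def)

text \<open>A speed \<open>D \<le> 0\<close> keeps such a function below the majorant for all times.
  Affine functions, with \<open>D = 0\<close>, and the parabolas of \<open>lower_initial\<close> are
  the instances.\<close>

lemma classical_in_family:
  assumes P: "\<And>x. (P has_real_derivative P1 x) (at x)" "\<And>x. (P1 has_real_derivative P2 x) (at x)"
    and D: "D \<le> 0" and eq: "\<And>x. -b < x \<Longrightarrow> x < b \<Longrightarrow> D \<le> f (g (P1 x) * P2 x)"
    and le: "\<And>x. -b < x \<Longrightarrow> x < b \<Longrightarrow> P x \<le> u0 x"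
  shows "(\<lambda>z. P (fst z) + D * snd z) \<in> family"
proof -
  have "continuous_on UNIV P" using P(1) DERIV_isCont by (metis continuous_on_eq_continuous_at open_UNIV)
  then have "continuous_on (Q0 b) (\<lambda>z. P (fst z))"
    by (rule continuous_on_compose2) (auto intro!: continuous_intros)
  then have "usc_on (Q0 b) (\<lambda>z. P (fst z) + D * snd z)" by (intro usc_continuous continuous_intros)
  moreover have "jet_sub b f g (\<lambda>z. P (fst z) + D * snd z)"
    by (rule jet_sub_classical[OF f_mono g_pos P(1) P(2) eq])
  moreover have "P (fst z) + D * snd z \<le> majorant z" if "z \<in> Q0 b" for z
  proof -
    have z: "-b < fst z" "fst z < b" "0 \<le> snd z" using that by (auto simp: Q0_def)
    have "D * snd z \<le> 0" "0 \<le> C * snd z" using z D C by (auto simp: mult_nonpos_nonneg)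
    then show ?thesis using le[OF z(1,2)] A_ge[OF z(1,2)] by (simp add: majorant_def)
  qed
  ultimately show ?thesis using le by (simp add: family_def)
qed

lemma affine_in_family:
  assumes "\<And>x. -b < x \<Longrightarrow> x < b \<Longrightarrow> p * x + q \<le> u0 x"
  shows "(\<lambda>z. p * fst z + q) \<in> family"
proof -
  have "(\<lambda>z. (p * fst z + q) + 0 * snd z) \<in> family"
  proof (rule classical_in_family)
    show "((\<lambda>x. p * x + q) has_real_derivative p) (at x)" "((\<lambda>x. p) has_real_derivative 0) (at x)" for x
      by (auto intro!: derivative_eq_intros)
  qed (use assms f0 in auto)
  then show ?thesis by simp
qed

lemma family_nonempty: "family \<noteq> {}"
proof -
  obtain m where "\<forall>x. -b < x \<longrightarrow> x < b \<longrightarrow> m \<le> u0 x" using u0_bounded_below by blast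
  then have "(\<lambda>z. 0 * fst z + m) \<in> family" by (intro affine_in_family) auto
  then show ?thesis by blast
qed

lemma bdd_family: "z \<in> Q0 b \<Longrightarrow> bdd_above ((\<lambda>w. w z) ` family)"
  by (rule bdd_aboveI[of _ "majorant z"]) (auto simp: familyD(3))

lemma U_ge: "w \<in> family \<Longrightarrow> z \<in> Q0 b \<Longrightarrow> w z \<le> U z"
  unfolding U_def by (rule cSUP_upper[OF _ bdd_family])

lemma U_le: "(\<And>w. w \<in> family \<Longrightarrow> w z \<le> a) \<Longrightarrow> U z \<le> a"
  unfolding U_def by (rule cSUP_least[OF family_nonempty])

lemma U_greaterD: "a < U z \<Longrightarrow> \<exists>w\<in>family. a < w z"
  by (meson U_le not_le)

lemma U_le_majorant: "z \<in> Q0 b \<Longrightarrow> U z \<le> majorant z"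
  by (rule U_le) (rule familyD(3))

lemma upper_env_le_continuous:
  assumes z: "z \<in> Q0 b" and \<phi>: "continuous_on (Q0 b) \<phi>" and le: "\<And>y. y \<in> Q0 b \<Longrightarrow> w y \<le> \<phi> y"
  shows "upper_env b w z \<le> ereal (\<phi> z)"
proof (rule ereal_le_epsilon2)
  fix e :: real assume "e > 0"
  then obtain d where d: "d > 0" "\<forall>y\<in>Q0 b. dist y z < d \<longrightarrow> dist (\<phi> y) (\<phi> z) < e"
    using \<phi> z unfolding continuous_on_iff by blast
  have "w y \<le> \<phi> z + e" if "y \<in> Q0 b" "dist y z < d" for y
  proof -
    have "\<bar>\<phi> y - \<phi> z\<bar> < e" using d(2) that by (simp add: dist_real_def)
    then show ?thesis using le[OF that(1)] by linarith
  qed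
  then have "upper_env b w z \<le> ereal (\<phi> z + e)" by (rule upper_env_le[OF d(1)])
  then show "upper_env b w z \<le> ereal (\<phi> z) + ereal e" by simp
qed

lemma upper: "z \<in> Q0 b \<Longrightarrow> upper_env b U z = ereal (upper z)" "z \<in> Q0 b \<Longrightarrow> U z \<le> upper z"
  "z \<in> Q0 b \<Longrightarrow> upper z \<le> majorant z"
proof -
  assume z: "z \<in> Q0 b"
  have 1: "ereal (U z) \<le> upper_env b U z" by (rule upper_env_ge[OF z])
  have 2: "upper_env b U z \<le> ereal (majorant z)" by (rule upper_env_le_continuous[OF z majorant_cont U_le_majorant])
  show 3: "upper_env b U z = ereal (upper z)" unfolding upper_def using 1 2 by (cases "upper_env b U z") auto
  show "U z \<le> upper z" "upper z \<le> majorant z" using 1 2 3 by auto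
qed

lemma lower: "z \<in> Q0 b \<Longrightarrow> lower_env b U z = ereal (lower z)" "z \<in> Q0 b \<Longrightarrow> lower z \<le> U z"
  and upper_env_minus: "z \<in> Q0 b \<Longrightarrow> upper_env b (\<lambda>p. - U p) z = ereal (- lower z)"
proof -
  assume z: "z \<in> Q0 b"
  obtain m where "\<forall>x. -b < x \<longrightarrow> x < b \<longrightarrow> m \<le> u0 x" using u0_bounded_below by blast
  then have w: "(\<lambda>z. 0 * fst z + m) \<in> family" by (intro affine_in_family) auto
  have m: "m \<le> U y" if "y \<in> Q0 b" for y using U_ge[OF w that] by simp
  have 1: "ereal (- U z) \<le> upper_env b (\<lambda>p. - U p) z" by (rule upper_env_ge[OF z])
  have 2: "upper_env b (\<lambda>p. - U p) z \<le> ereal (- m)" by (rule upper_env_le_continuous[OF z]) (auto simp: m)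
  show 3: "lower_env b U z = ereal (lower z)" unfolding lower_def lower_env_eq
    using 1 2 by (cases "upper_env b (\<lambda>p. - U p) z") auto
  then show 4: "upper_env b (\<lambda>p. - U p) z = ereal (- lower z)"
    unfolding lower_env_eq by (cases "upper_env b (\<lambda>p. - U p) z") auto
  show "lower z \<le> U z" using 1 4 by simp
qed

lemma lower_ge_continuous:
  assumes "z \<in> Q0 b" "continuous_on (Q0 b) \<phi>" "\<And>y. y \<in> Q0 b \<Longrightarrow> \<phi> y \<le> U y"
  shows "\<phi> z \<le> lower z"
proof -
  have "upper_env b (\<lambda>p. - U p) z \<le> ereal (- \<phi> z)"
    by (rule upper_env_le_continuous[OF assms(1)]) (use assms in \<open>auto intro!: continuous_intros\<close>)
  then show ?thesis using upper_env_minus[OF assms(1)] by simp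
qed

lemma usc_upper: "usc_on (Q0 b) upper"
proof -
  have "usc_on (Q0 b) (\<lambda>z. real_of_ereal (upper_env b U z))"
    by (rule usc_upper_env) (simp add: upper(1))
  then show ?thesis by (simp add: upper_def[abs_def])
qed

lemma usc_lower: "usc_on (Q0 b) (\<lambda>z. - lower z)"
proof -
  have "usc_on (Q0 b) (\<lambda>z. real_of_ereal (upper_env b (\<lambda>p. - U p) z))"
    by (rule usc_upper_env) (simp add: upper_env_minus)
  then show ?thesis by (simp add: lower_def[abs_def] lower_env_eq)
qed

text \<open>A downward parabola with apex just below \<open>u0 x0\<close>, sinking at constant
  speed, is a member of the family; being continuous, it bounds the lower envelope too.\<close>

lemma lower_initial:
  assumes x0: "-b < x0" "x0 < b"
  shows "u0 x0 \<le> lower (x0, 0)"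
proof (rule field_le_epsilon)
  fix e :: real assume e: "e > 0"
  obtain m where m: "\<And>x. -b < x \<Longrightarrow> x < b \<Longrightarrow> m \<le> u0 x" using u0_bounded_below by blast
  have "isCont u0 x0" using u0_cont x0 by (simp add: continuous_on_eq_continuous_at)
  then obtain d where d: "d > 0" "\<And>x. \<bar>x - x0\<bar> < d \<Longrightarrow> \<bar>u0 x - u0 x0\<bar> < e"
    unfolding continuous_at_eps_delta using e by (metis dist_real_def)
  \<comment> \<open>At distance \<open>d\<close> from \<open>x0\<close> the parabola has then
    dropped below the global lower bound \<open>m\<close> of \<open>u0\<close>.\<close>
  define M where "M = \<bar>u0 x0 - m\<bar> / d^2"
  have M: "M \<ge> 0" by (simp add: M_def)
  define P where "P x = u0 x0 - e - M * (x - x0)^2" for x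
  define P1 where "P1 x = - (2 * M * (x - x0))" for x
  have Pu: "P x \<le> u0 x" if x: "-b < x" "x < b" for x
  proof (cases "\<bar>x - x0\<bar> < d")
    case True
    have "0 \<le> M * (x - x0)^2" using M by simp
    then show ?thesis using d(2)[OF True] by (simp add: P_def)
  next
    case False
    then have "d^2 \<le> \<bar>x - x0\<bar>^2" using d(1) by (intro power_mono) auto
    then have "M * d^2 \<le> M * (x - x0)^2" using M by (intro mult_left_mono) auto
    moreover have "M * d^2 = \<bar>u0 x0 - m\<bar>" using d(1) by (simp add: M_def)
    ultimately show ?thesis using m[OF x] e by (simp add: P_def)
  qed
  have "continuous_on {-b..b} (\<lambda>x. f (g (P1 x) * (- 2 * M)))"
    unfolding P1_def by (intro continuous_on_compose2[OF f_cont] continuous_intros continuous_on_compose2[OF g_cont]) auto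
  then obtain y0 where y0: "\<And>x. x \<in> {-b..b} \<Longrightarrow> f (g (P1 y0) * (- 2 * M)) \<le> f (g (P1 x) * (- 2 * M))"
    using interval_attains(1)[of "-b" b] b by fastforce
  \<comment> \<open>The slopes of the parabola stay in a compact set, so the operator attains a
    minimum along it, and this is an admissible speed.\<close>
  define D where "D = min 0 (f (g (P1 y0) * (- 2 * M)))"
  have w: "(\<lambda>z. P (fst z) + D * snd z) \<in> family"
  proof (rule classical_in_family[where ?P1.0 = P1 and ?P2.0 = "\<lambda>x. - 2 * M"])
    show "D \<le> f (g (P1 x) * (- 2 * M))" if "-b < x" "x < b" for x using y0[of x] that by (simp add: D_def)
    show "(P has_real_derivative P1 x) (at x)" for x
      unfolding P_def[abs_def] P1_def by (auto intro!: derivative_eq_intros)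
    show "(P1 has_real_derivative - 2 * M) (at x)" for x
      unfolding P1_def[abs_def] by (auto intro!: derivative_eq_intros)
  qed (auto simp: D_def Pu)
  have "P (fst (x0, 0::real)) + D * snd (x0, 0::real) \<le> lower (x0, 0)"
  proof (rule lower_ge_continuous)
    show "continuous_on (Q0 b) (\<lambda>z. P (fst z) + D * snd z)" unfolding P_def by (intro continuous_intros)
  qed (use x0 U_ge[OF w] in \<open>auto simp: Q0_def\<close>)
  then show "u0 x0 \<le> lower (x0, 0) + e" by (simp add: P_def)
qed

text \<open>One rising parabola bounds all members of the family near \<open>(x0, 0)\<close> at
  once, hence also their supremum and its envelope.\<close>

lemma upper_initial:
  assumes x0: "-b < x0" "x0 < b"
  shows "upper (x0, 0) \<le> u0 x0"
proof (rule field_le_epsilon)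
  fix e' :: real assume e': "e' > 0"
  define e where "e = e' / 2"
  have e: "e > 0" using e' by (simp add: e_def)
  have "isCont u0 x0" using u0_cont x0 by (simp add: continuous_on_eq_continuous_at)
  then obtain d where d: "d > 0" "\<And>x. \<bar>x - x0\<bar> < d \<Longrightarrow> \<bar>u0 x - u0 x0\<bar> < e"
    unfolding continuous_at_eps_delta using e by (metis dist_real_def)
  define r where "r = min d (min (b - x0) (b + x0)) / 2"
  have r: "0 < r" "r < d" "-b < x0 - r" "x0 + r < b"
  proof -
    show "0 < r" "r < d" using d x0 by (auto simp: r_def)
    have "r \<le> (b - x0) / 2" "r \<le> (b + x0) / 2" unfolding r_def by (intro divide_right_mono; simp)+
    then show "-b < x0 - r" "x0 + r < b" using x0 by (simp_all add: field_simps)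
  qed
  \<comment> \<open>Large enough for the parabola to exceed the majorant at \<open>x0 - r\<close>
    and \<open>x0 + r\<close> up to time 1, so that membership in the family supplies the lateral
    bounds.\<close>
  define M where "M = (\<bar>A (x0 - r)\<bar> + \<bar>A (x0 + r)\<bar> + C + \<bar>u0 x0\<bar>) / r^2"
  have M: "M \<ge> 0" using C by (simp add: M_def)
  have Mr: "M * r^2 = \<bar>A (x0 - r)\<bar> + \<bar>A (x0 + r)\<bar> + C + \<bar>u0 x0\<bar>" using r by (simp add: M_def)
  define P where "P x = u0 x0 + e + M * (x - x0)^2" for x
  define P1 where "P1 x = 2 * M * (x - x0)" for x
  have "continuous_on {-b..b} (\<lambda>x. f (g (P1 x) * (2 * M)))"
    unfolding P1_def by (intro continuous_on_compose2[OF f_cont] continuous_intros continuous_on_compose2[OF g_cont]) auto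
  then obtain y0 where y0: "\<And>x. x \<in> {-b..b} \<Longrightarrow> f (g (P1 x) * (2 * M)) \<le> f (g (P1 y0) * (2 * M))"
    using interval_attains(2)[of "-b" b] b by fastforce
  define D where "D = max 0 (f (g (P1 y0) * (2 * M)))"
  have main: "w (x, t) \<le> P x + D * t" if w: "w \<in> family" and x: "x0 - r \<le> x" "x \<le> x0 + r" and t: "0 \<le> t" "t < 1" for w x t
  proof -
    have "w (x, t) \<le> P x + D * (t - 0)"
    proof (rule jet_sub_le_barrier[OF familyD(2,1)[OF w] f_cont r(3) _ r(4), where ?A1.0 = P1 and ?A2.0 = "\<lambda>x. 2 * M" and T = 1])
      show "f (g (P1 x) * (2 * M)) \<le> D" if "x0 - r < x" "x < x0 + r" for x using y0[of x] that r by (simp add: D_def)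
      show "w (x, 0) \<le> P x" if "x0 - r \<le> x" "x \<le> x0 + r" for x
      proof -
        have "w (x, 0) \<le> u0 x" using familyD(4)[OF w] that r by simp
        moreover have "\<bar>u0 x - u0 x0\<bar> < e" using d(2) that r by (simp add: abs_less_iff)
        moreover have "0 \<le> M * (x - x0)^2" using M by simp
        ultimately show ?thesis by (simp add: P_def)
      qed
      have lat: "w (y, t) \<le> P y + D * (t - 0)" if y: "y = x0 - r \<or> y = x0 + r" and t: "0 \<le> t" "t < 1" for y t
      proof -
        have "(y, t) \<in> Q0 b" using y t r by (auto simp: Q0_def)
        then have "w (y, t) \<le> A y + C * t" using familyD(3)[OF w, of "(y, t)"] by (simp add: majorant_def)
        moreover have "C * t \<le> C * 1" using C t by (intro mult_left_mono) auto
        moreover have "0 \<le> D * (t - 0)" using t by (simp add: D_def)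
        moreover have "M * (y - x0)^2 = M * r^2" using y by auto
        ultimately show ?thesis using Mr e y by (auto simp: P_def)
      qed
      show "w (x0 - r, t) \<le> P (x0 - r) + D * (t - 0)" "w (x0 + r, t) \<le> P (x0 + r) + D * (t - 0)"
        if "0 \<le> t" "t < 1" for t using lat that by auto
      show "(P has_real_derivative P1 x) (at x)" for x
        unfolding P_def[abs_def] P1_def by (auto intro!: derivative_eq_intros)
      show "(P1 has_real_derivative 2 * M) (at x)" for x
        unfolding P1_def[abs_def] by (auto intro!: derivative_eq_intros)
      show "continuous_on {x0 - r..x0 + r} P" unfolding P_def[abs_def] by (intro continuous_intros)
    qed (use r x t in auto)
    then show ?thesis by simp
  qed
  have "isCont (\<lambda>z. P (fst z) + D * snd z) (x0, 0)" unfolding P_def by (intro continuous_intros)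
  then obtain \<rho> where \<rho>: "\<rho> > 0" "\<And>y. dist y (x0, 0) < \<rho> \<Longrightarrow> \<bar>P (fst y) + D * snd y - (P x0 + D * 0)\<bar> < e"
    unfolding continuous_at_eps_delta using e by (metis dist_real_def fst_conv snd_conv)
  have "upper_env b U (x0, 0) \<le> ereal (P x0 + e)"
  proof (rule upper_env_le[of "min \<rho> (min r 1)"])
    fix y assume y: "y \<in> Q0 b" "dist y (x0, 0) < min \<rho> (min r 1)"
    have dd: "\<bar>fst y - x0\<bar> < r" "\<bar>snd y\<bar> < 1"
      using dist_fst_le[of y "(x0, 0)"] dist_snd_le[of y "(x0, 0)"] y(2) by (auto simp: dist_real_def)
    have "U y \<le> P (fst y) + D * snd y"
      by (rule U_le) (use main[of _ "fst y" "snd y"] dd y(1) in \<open>auto simp: Q0_def\<close>)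
    then show "U y \<le> P x0 + e" using \<rho>(2)[of y] y(2) by simp
  qed (use \<rho> r in auto)
  then have "upper (x0, 0) \<le> u0 x0 + e + e" using upper(1)[of "(x0, 0)"] x0 by (simp add: Q0_def P_def)
  then show "upper (x0, 0) \<le> u0 x0 + e'" by (simp add: e_def)
qed

lemma upper_initial_eq: "-b < x \<Longrightarrow> x < b \<Longrightarrow> upper (x, 0) = u0 x \<and> lower (x, 0) = u0 x"
  using lower_initial[of x] upper_initial[of x] lower(2)[of "(x, 0)"] upper(2)[of "(x, 0)"] by (auto simp: Q0_def)

lemma lower_boundary:
  assumes t: "t > 0"
  shows "filterlim (\<lambda>x. lower (x, t)) at_top (at_left b)" "filterlim (\<lambda>x. lower (x, t)) at_top (at_right (-b))"
proof -
  obtain m where m: "\<And>x. -b < x \<Longrightarrow> x < b \<Longrightarrow> m \<le> u0 x" using u0_bounded_below by blast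
  have affine: "p * x + q \<le> lower (x, t)" if "\<And>x. -b < x \<Longrightarrow> x < b \<Longrightarrow> p * x + q \<le> u0 x" "-b < x" "x < b" for p q x
  proof -
    have "p * fst (x, t) + q \<le> lower (x, t)"
      by (rule lower_ge_continuous)
        (use U_ge[OF affine_in_family[OF that(1)]] that t in \<open>auto simp: Q0_def intro!: continuous_intros\<close>)
    then show ?thesis by simp
  qed
  show "filterlim (\<lambda>x. lower (x, t)) at_top (at_left b)"
    unfolding filterlim_at_top
  proof
    fix M
    obtain c where c: "c < b" "\<And>y. c < y \<Longrightarrow> y < b \<Longrightarrow> M + 1 \<le> u0 y"
      using u0_lim(1) unfolding filterlim_at_top eventually_at_left_field by blast
    \<comment> \<open>The line of slope \<open>S\<close> with value \<open>M + 1\<close> at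
      \<open>b\<close> is below \<open>m\<close> at \<open>c\<close>, hence below \<open>u0\<close>
      everywhere to the left of \<open>c\<close>; within distance \<open>1 / S\<close> of
      \<open>b\<close> it is still at least \<open>M\<close>.\<close>
    define S where "S = (\<bar>M + 1 - m\<bar> + 1) / (b - c)"
    have S: "S > 0" using c by (simp add: S_def)
    have le: "S * x + (M + 1 - S * b) \<le> u0 x" if x: "-b < x" "x < b" for x
    proof (cases "c < x")
      case True
      have "S * x \<le> S * b" using S x by (intro mult_left_mono) auto
      then show ?thesis using c(2)[OF True x(2)] by simp
    next
      case False
      then have "S * x \<le> S * c" using S by (intro mult_left_mono) auto
      moreover have "S * (b - c) = \<bar>M + 1 - m\<bar> + 1" using c by (simp add: S_def)
      then have "S * b - S * c = \<bar>M + 1 - m\<bar> + 1" by (simp add: right_diff_distrib)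
      ultimately show ?thesis using m[OF x] by linarith
    qed
    have "M \<le> lower (x, t)" if "max (-b) (b - 1 / S) < x" "x < b" for x
    proof -
      have "S * (b - x) \<le> 1" using that S by (auto simp: field_simps)
      then have "M \<le> S * x + (M + 1 - S * b)" by (simp add: algebra_simps)
      also have "\<dots> \<le> lower (x, t)" by (rule affine[OF le]) (use that in auto)
      finally show ?thesis .
    qed
    moreover have "max (-b) (b - 1 / S) < b" using S b by simp
    ultimately show "\<forall>\<^sub>F x in at_left b. M \<le> lower (x, t)" unfolding eventually_at_left_field by blast
  qed
  show "filterlim (\<lambda>x. lower (x, t)) at_top (at_right (-b))"
    unfolding filterlim_at_top
  proof
    fix M
    obtain c where c: "c > - b" "\<And>y. - b < y \<Longrightarrow> y < c \<Longrightarrow> M + 1 \<le> u0 y"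
      using u0_lim(2) unfolding filterlim_at_top eventually_at_right_field by blast
    define S where "S = (\<bar>M + 1 - m\<bar> + 1) / (c + b)"
    have S: "S > 0" using c by (simp add: S_def)
    have le: "(- S) * x + (M + 1 - S * b) \<le> u0 x" if x: "-b < x" "x < b" for x
    proof (cases "x < c")
      case True
      have "S * (- x) \<le> S * b" using S x by (intro mult_left_mono) auto
      then show ?thesis using c(2)[OF x(1) True] by simp
    next
      case False
      then have "S * c \<le> S * x" using S by (intro mult_left_mono) auto
      moreover have "S * (c + b) = \<bar>M + 1 - m\<bar> + 1" using c by (simp add: S_def)
      then have "S * c + S * b = \<bar>M + 1 - m\<bar> + 1" by (simp add: distrib_left)
      ultimately show ?thesis using m[OF x] by simp
    qed
    have "M \<le> lower (x, t)" if "- b < x" "x < min b (- b + 1 / S)" for x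
    proof -
      have "S * (x + b) \<le> 1" using that S by (auto simp: field_simps)
      then have "M \<le> (- S) * x + (M + 1 - S * b)" by (simp add: algebra_simps)
      also have "\<dots> \<le> lower (x, t)" by (rule affine[OF le]) (use that in auto)
      finally show ?thesis .
    qed
    moreover have "- b < min b (- b + 1 / S)" using S b by simp
    ultimately show "\<forall>\<^sub>F x in at_right (-b). M \<le> lower (x, t)" unfolding eventually_at_right_field by blast
  qed
qed

section \<open>The envelopes are sub- and supersolutions\<close>

lemma dist_sq: "(fst y - fst z)^2 + (snd y - snd z)^2 = (dist y z)^2" for y z :: "real \<times> real"
  by (cases y; cases z) (simp add: dist_Pair_Pair dist_real_def)

text \<open>Raising the quadratic by \<open>\<epsilon> * (dist y z)^2\<close> makes the contact
  strict. Members of the family that nearly reach \<open>upper z\<close> near \<open>z\<close> then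
  touch a translate of it inside arbitrarily small balls, and their jet inequalities pass to the
  limit by continuity of \<open>f\<close> and \<open>g\<close>.\<close>

lemma upper_jet: "jet_sub b f g upper"
  unfolding jet_sub_def
proof (intro ballI allI impI)
  fix z \<tau> p X c
  assume z: "z \<in> Q b" and le: "\<forall>\<^sub>F y in nhds z. upper y \<le> upper z + \<tau> * (snd y - snd z) + p * (fst y - fst z)
        + X/2 * (fst y - fst z)^2 + c * (snd y - snd z)^2"
  show "\<tau> \<le> f (g p * X)"
  proof (rule le_isCont_limit)
    show "isCont f (g p * X)" using f_cont by (simp add: continuous_on_eq_continuous_at)
    fix e :: real assume e: "e > 0"
    define \<epsilon> where "\<epsilon> = e / 2"
    have \<epsilon>: "\<epsilon> > 0" using e by (simp add: \<epsilon>_def)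
    define Aq where "Aq x = p * (x - fst z) + (X + e)/2 * (x - fst z)^2" for x
    define Bq where "Bq t = \<tau> * (t - snd z) + (c + \<epsilon>) * (t - snd z)^2" for t
    define G where "G y = \<tau> + 2 * (c + \<epsilon>) * (snd y - snd z) - f (g (p + (X + e) * (fst y - fst z)) * (X + e))" for y
    have "\<forall>\<^sub>F y in nhds z. y \<in> Q b" using z open_Q by (rule eventually_nhds_in_open[rotated])
    with le have "\<forall>\<^sub>F y in nhds z. y \<in> Q b \<and> upper y \<le> upper z + \<tau> * (snd y - snd z) + p * (fst y - fst z)
        + X/2 * (fst y - fst z)^2 + c * (snd y - snd z)^2" by eventually_elim auto
    then obtain r0 where r0: "r0 > 0" "\<And>y. dist y z < r0 \<Longrightarrow> y \<in> Q b \<and> upper y \<le> upper z + \<tau> * (snd y - snd z) + p * (fst y - fst z)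
        + X/2 * (fst y - fst z)^2 + c * (snd y - snd z)^2" unfolding eventually_nhds_metric by blast
    have strict: "upper y \<le> upper z + Aq (fst y) + Bq (snd y) - \<epsilon> * (dist y z)^2" if "dist y z < r0" for y
      using r0(2)[OF that] unfolding dist_sq[symmetric] Aq_def Bq_def \<epsilon>_def by (simp add: algebra_simps add_divide_distrib)
    have near: "\<exists>y. dist y z < \<rho> \<and> G y \<le> 0" if \<rho>: "0 < \<rho>" "\<rho> < r0" for \<rho>
    proof -
      define K where "K = cball z \<rho>"
      have KQ: "K \<subseteq> Q b" using r0(2) \<rho> by (auto simp: K_def dist_commute)
      \<comment> \<open>A member within \<open>\<eta>\<close> of the contact value has its maximum
        where \<open>\<epsilon> * (dist y z)^2 < \<eta>\<close>, hence in the interior of the ball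
        of radius \<open>\<rho>\<close>.\<close>
      define \<eta> where "\<eta> = \<epsilon> * \<rho>^2 / 2"
      have \<eta>: "\<eta> > 0" using \<epsilon> \<rho> by (simp add: \<eta>_def)
      have "isCont (\<lambda>y. Aq (fst y) + Bq (snd y)) z" unfolding Aq_def Bq_def by (intro continuous_intros)
      then obtain d where d: "d > 0" "\<And>y. dist y z < d \<Longrightarrow> \<bar>Aq (fst y) + Bq (snd y) - (Aq (fst z) + Bq (snd z))\<bar> < \<eta> / 2"
        unfolding continuous_at_eps_delta using \<eta> by (metis dist_real_def half_gt_zero)
      have zQ0: "z \<in> Q0 b" using z Q_subset_Q0 by blast
      have "ereal (upper z - \<eta> / 2) < upper_env b U z" using upper(1)[OF zQ0] \<eta> by simp
      then obtain z' where z': "z' \<in> Q0 b" "dist z' z < min d \<rho>" "upper z - \<eta> / 2 < U z'"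
        by (rule upper_env_greaterD[of _ _ _ _ "min d \<rho>"]) (use d \<rho> in auto)
      obtain w where w: "w \<in> family" "upper z - \<eta> / 2 < w z'" using U_greaterD[OF z'(3)] by blast
      have "Aq (fst z) + Bq (snd z) = 0" by (simp add: Aq_def Bq_def)
      moreover have "dist z' z < d" using z'(2) by simp
      ultimately have "Aq (fst z') + Bq (snd z') < \<eta> / 2" using d(2)[of z'] by linarith
      then have wz': "w z' - (Aq (fst z') + Bq (snd z')) > upper z - \<eta>" using w(2) by linarith
      have Kc: "compact K" "K \<noteq> {}" using \<rho> by (auto simp: K_def)
      have "usc_on K (\<lambda>y. w y - (Aq (fst y) + Bq (snd y)))"
        unfolding Aq_def Bq_def
        by (intro usc_on_diff_continuous usc_on_subset[OF familyD(1)[OF w(1)]] continuous_intros) (use KQ Q_subset_Q0 in blast)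
      from usc_attains_max[OF Kc this] obtain y where y: "y \<in> K"
        "\<And>y'. y' \<in> K \<Longrightarrow> w y' - (Aq (fst y') + Bq (snd y')) \<le> w y - (Aq (fst y) + Bq (snd y))" by blast
      have yQ: "y \<in> Q b" using y(1) KQ by blast
      have "z' \<in> K" using z'(2) by (simp add: K_def dist_commute)
      then have wy: "w y - (Aq (fst y) + Bq (snd y)) > upper z - \<eta>" using y(2)[of z'] wz' by linarith
      have yr0: "dist y z < r0" using y(1) \<rho> by (simp add: K_def dist_commute)
      have "w y \<le> U y" by (rule U_ge[OF w(1)]) (use yQ Q_subset_Q0 in blast)
      also have "U y \<le> upper y" by (rule upper(2)) (use yQ Q_subset_Q0 in blast)
      finally have "\<epsilon> * (dist y z)^2 < \<eta>" using strict[OF yr0] wy by linarith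
      then have "(dist y z)^2 < \<rho>^2 / 2" using \<epsilon> by (simp add: \<eta>_def)
      then have "(dist y z)^2 < \<rho>^2" using \<rho> by (smt (verit) zero_less_power field_sum_of_halves)
      then have yr: "dist y z < \<rho>" using \<rho> by (simp add: power_less_imp_less_base)
      have "\<forall>\<^sub>F y' in nhds y. y' \<in> ball z \<rho>" using yr by (intro eventually_nhds_in_open) (auto simp: dist_commute)
      then have max: "\<forall>\<^sub>F y' in nhds (fst y, snd y). w y' - Aq (fst y') - Bq (snd y') \<le> w (fst y, snd y) - Aq (fst y) - Bq (snd y)"
        unfolding prod.collapse
        by eventually_elim (use y(2) in \<open>force simp: K_def diff_diff_eq\<close>)
      have "\<tau> + 2 * (c + \<epsilon>) * (snd y - snd z) \<le> f (g (p + (X + e) * (fst y - fst z)) * (X + e))"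
      proof (rule jet_sub_separated[OF familyD(2)[OF w(1)] f_cont _ max])
        show "\<forall>\<^sub>F x in nhds (fst y). (Aq has_real_derivative (p + (X + e) * (x - fst z))) (at x)"
          unfolding Aq_def[abs_def] by (auto intro!: always_eventually derivative_eq_intros)
        show "((\<lambda>x. p + (X + e) * (x - fst z)) has_real_derivative (X + e)) (at (fst y))"
          by (auto intro!: derivative_eq_intros)
        show "\<forall>\<^sub>F t in nhds (snd y). (Bq has_real_derivative (\<tau> + 2 * (c + \<epsilon>) * (t - snd z))) (at t)"
          unfolding Bq_def[abs_def] by (auto intro!: always_eventually derivative_eq_intros simp: algebra_simps)
        show "((\<lambda>t. \<tau> + 2 * (c + \<epsilon>) * (t - snd z)) has_real_derivative 2 * (c + \<epsilon>)) (at (snd y))"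
          by (auto intro!: derivative_eq_intros)
      qed (use yQ in simp)
      then have "G y \<le> 0" by (simp add: G_def)
      then show ?thesis using yr by blast
    qed
    have "isCont G z"
      unfolding G_def using f_cont g_cont
      by (intro continuous_intros isCont_o2[of z _ f] isCont_o2[of z _ g]) (auto simp: continuous_on_eq_continuous_at)
    have "G z \<le> 0"
    proof (rule ccontr)
      assume "\<not> G z \<le> 0"
      then have "G z > 0" by simp
      then obtain d where d: "d > 0" "\<And>y. dist y z < d \<Longrightarrow> dist (G y) (G z) < G z"
        using \<open>isCont G z\<close> unfolding continuous_at_eps_delta by blast
      define \<rho> where "\<rho> = min d r0 / 2"
      have \<rho>: "0 < \<rho>" "\<rho> < r0" "\<rho> < d" unfolding \<rho>_def using d(1) r0(1) by linarith+
      obtain y where y: "dist y z < \<rho>" "G y \<le> 0" using near[OF \<rho>(1,2)] by blast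
      have "\<bar>G y - G z\<bar> < G z" using d(2)[of y] y(1) \<rho>(3) by (simp add: dist_real_def)
      then show False using y(2) by linarith
    qed
    then show "\<tau> \<le> f (g p * (X + e))" by (simp add: G_def)
  qed
qed

lemma majorant_jet: "jet_sub b (\<lambda>s. - f (- s)) (\<lambda>p. g (- p)) (\<lambda>z. - majorant z)"
proof -
  have "jet_sub b (\<lambda>s. - f (- s)) (\<lambda>p. g (- p)) (\<lambda>z. - A (fst z) + (- C) * snd z)"
  proof (rule jet_sub_classical)
    show "strict_mono (\<lambda>s. - f (- s))" using f_mono by (auto simp: strict_mono_def)
    show "((\<lambda>x. - A x) has_real_derivative - A1 x) (at x)" "((\<lambda>x. - A1 x) has_real_derivative - A2 x) (at x)"
      if "-b < x" "x < b" for x using A1[OF that] A2[OF that] by (auto intro: DERIV_minus)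
    show "- C \<le> - f (- (g (- (- A1 x)) * - A2 x))" if "-b < x" "x < b" for x using A_super[OF that] by simp
  qed (rule g_pos)
  then show ?thesis by (simp add: majorant_def)
qed

text \<open>Where \<open>lower\<close> meets the majorant, the jet is also one of the majorant.
  Elsewhere Perron's bump applies: if the inequality failed, a slightly raised quadratic would be a
  strict subsolution near \<open>z\<close>, and its maximum with \<open>upper\<close> would be a
  member of the family exceeding \<open>U\<close> somewhere.\<close>

lemma lower_jet: "jet_sub b (\<lambda>s. - f (- s)) (\<lambda>p. g (- p)) (\<lambda>z. - lower z)"
  unfolding jet_sub_def
proof (intro ballI allI impI)
  fix z \<tau> p X c
  assume z: "z \<in> Q b" and le: "\<forall>\<^sub>F y in nhds z. - lower y \<le> - lower z + \<tau> * (snd y - snd z) + p * (fst y - fst z)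
        + X/2 * (fst y - fst z)^2 + c * (snd y - snd z)^2"
  have zQ0: "z \<in> Q0 b" using z Q_subset_Q0 by blast
  have lm: "lower y \<le> majorant y" if "y \<in> Q0 b" for y using lower(2)[OF that] U_le_majorant[OF that] by simp
  have evQ: "\<forall>\<^sub>F y in nhds z. y \<in> Q b" using z open_Q by (rule eventually_nhds_in_open[rotated])
  show "\<tau> \<le> - f (- (g (- p) * X))"
  proof (cases "lower z = majorant z")
    case True
    have "\<forall>\<^sub>F y in nhds z. - majorant y \<le> - majorant z + \<tau> * (snd y - snd z) + p * (fst y - fst z)
        + X/2 * (fst y - fst z)^2 + c * (snd y - snd z)^2"
      using le evQ
    proof eventually_elim
      case (elim y)
      then show ?case using lm[of y] Q_subset_Q0 True by fastforce
    qed
    then show ?thesis using majorant_jet z unfolding jet_sub_def by blast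
  next
    case False
    then have gap: "lower z < majorant z" using lm[OF zQ0] by simp
    show ?thesis
    proof (rule ccontr)
      assume neg: "\<not> ?thesis"
      \<comment> \<open>\<open>G e y < 0\<close> says that the negated test quadratic, lowered by
        \<open>e * (dist y z)^2\<close>, is a strict subsolution at \<open>y\<close>. By continuity
        this persists for a small positive \<open>e\<close> and for \<open>y\<close> near
        \<open>z\<close>.\<close>
      define G where "G e y = - \<tau> + 2 * (- c - e) * (snd y - snd z)
          - f (g (- p + (- X - 2 * e) * (fst y - fst z)) * (- X - 2 * e))" for e and y :: "real \<times> real"
      have G00: "G 0 z < 0" using neg by (simp add: G_def)
      have "isCont (\<lambda>e. G e z) 0"
        unfolding G_def using f_cont
        by (intro continuous_intros isCont_o2[of 0 _ f]) (auto simp: continuous_on_eq_continuous_at)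
      then obtain d where d: "d > 0" "\<And>e. dist e 0 < d \<Longrightarrow> dist (G e z) (G 0 z) < - G 0 z"
        unfolding continuous_at_eps_delta using G00 by (metis neg_0_less_iff_less)
      define \<epsilon> where "\<epsilon> = d / 2"
      have \<epsilon>: "\<epsilon> > 0" using d by (simp add: \<epsilon>_def)
      have G0: "G \<epsilon> z < 0" using d(2)[of \<epsilon>] \<epsilon> d(1) by (auto simp: \<epsilon>_def dist_real_def)
      have "isCont (G \<epsilon>) z"
        unfolding G_def[abs_def] using f_cont g_cont
        by (intro continuous_intros isCont_o2[of z _ f] isCont_o2[of z _ g]) (auto simp: continuous_on_eq_continuous_at)
      then have "\<forall>\<^sub>F y in nhds z. G \<epsilon> y < 0"
        using G0 by (intro order_tendstoD(2)) (auto simp: isCont_def tendsto_at_iff_tendsto_nhds)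
      define Aq where "Aq x = (- p) * (x - fst z) + (- X - 2 * \<epsilon>)/2 * (x - fst z)^2" for x
      define Bq where "Bq t = (- \<tau>) * (t - snd z) + (- c - \<epsilon>) * (t - snd z)^2" for t
      define q where "q y = Aq (fst y) + Bq (snd y)" for y
      have qcont: "continuous_on S q" for S unfolding q_def Aq_def Bq_def by (intro continuous_intros)
      have qz: "q z = 0" by (simp add: q_def Aq_def Bq_def)
      define \<kappa>0 where "\<kappa>0 = (majorant z - lower z) / 2"
      have \<kappa>0: "\<kappa>0 > 0" using gap by (simp add: \<kappa>0_def)
      have "isCont (\<lambda>y. majorant y - q y) z"
      proof -
        have "continuous_on (Q b) (\<lambda>y. majorant y - q y)"
          by (intro continuous_on_diff qcont continuous_on_subset[OF majorant_cont] Q_subset_Q0)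
        then show ?thesis using z open_Q by (simp add: continuous_on_eq_continuous_at)
      qed
      have "\<forall>\<^sub>F y in nhds z. lower z + \<kappa>0 < majorant y - q y"
      proof (rule order_tendstoD(1)[OF _, rotated])
        show "lower z + \<kappa>0 < majorant z - q z" using gap by (simp add: qz \<kappa>0_def field_simps)
        show "((\<lambda>y. majorant y - q y) \<longlongrightarrow> majorant z - q z) (nhds z)"
          using \<open>isCont (\<lambda>y. majorant y - q y) z\<close> by (simp add: isCont_def tendsto_at_iff_tendsto_nhds[of "\<lambda>y. majorant y - q y" z])
      qed
      with \<open>\<forall>\<^sub>F y in nhds z. G \<epsilon> y < 0\<close> le evQ
      have "\<forall>\<^sub>F y in nhds z. y \<in> Q b \<and> G \<epsilon> y < 0 \<and> lower z + \<kappa>0 < majorant y - q y \<and>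
         lower z + q y + \<epsilon> * (dist y z)^2 \<le> lower y"
      proof eventually_elim
        case (elim y)
        have "q y + \<epsilon> * (dist y z)^2 = - (\<tau> * (snd y - snd z) + p * (fst y - fst z)
          + X/2 * (fst y - fst z)^2 + c * (snd y - snd z)^2)"
          unfolding dist_sq[symmetric] q_def Aq_def Bq_def by (simp add: algebra_simps add_divide_distrib diff_divide_distrib)
        then show ?case using elim by auto
      qed
      then obtain r where r: "r > 0" "\<And>y. dist y z < r \<Longrightarrow> y \<in> Q b \<and> G \<epsilon> y < 0 \<and> lower z + \<kappa>0 < majorant y - q y \<and>
         lower z + q y + \<epsilon> * (dist y z)^2 \<le> lower y" unfolding eventually_nhds_metric by blast
      \<comment> \<open>The first entry keeps the raised quadratic below the majorant. The second
        puts it below \<open>lower\<close> at distances between \<open>r / 2\<close> and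
        \<open>r\<close> from \<open>z\<close>, so that the maximum glues to
        \<open>upper\<close>.\<close>
      define \<kappa> where "\<kappa> = min \<kappa>0 (\<epsilon> * (r / 2)^2)"
      have \<kappa>: "\<kappa> > 0" "\<kappa> \<le> \<kappa>0" "\<kappa> \<le> \<epsilon> * (r / 2)^2" using \<kappa>0 \<epsilon> r by (auto simp: \<kappa>_def)
      define h where "h y = lower z + \<kappa> + q y" for y
      \<comment> \<open>\<open>upper\<close> is taken instead of \<open>U\<close> because members of
        the family have to be upper semicontinuous; its initial bound is
        \<open>upper_initial\<close>.\<close>
      define w where "w y = (if dist y z < r then max (upper y) (h y) else upper y)" for y
      have w_ge: "upper y \<le> w y" for y by (simp add: w_def)
      have w_outer: "w y = upper y" if "r / 2 \<le> dist y z" "y \<in> Q0 b" for y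
      proof (cases "dist y z < r")
        case True
        have "\<epsilon> * (r / 2)^2 \<le> \<epsilon> * (dist y z)^2" using that(1) \<epsilon> r(1) by (intro mult_left_mono power_mono) auto
        then have "h y \<le> lower y" using r(2)[OF True] \<kappa>(3) by (simp add: h_def)
        also have "\<dots> \<le> upper y" using lower(2)[OF that(2)] upper(2)[OF that(2)] by simp
        finally show ?thesis by (simp add: w_def max_def)
      qed (simp add: w_def)
      have hcont: "continuous_on S h" for S unfolding h_def by (intro continuous_intros qcont)
      have "usc_on (Q0 b) w"
        unfolding usc_on_iff
      proof (intro ballI allI impI)
        fix y and e :: real assume y: "y \<in> Q0 b" "e > 0"
        obtain d1 where d1: "d1 > 0" "\<And>y'. y' \<in> Q0 b \<Longrightarrow> dist y' y < d1 \<Longrightarrow> upper y' < upper y + e"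
          using usc_onD[OF usc_upper y] by blast
        show "\<exists>d>0. \<forall>y'\<in>Q0 b. dist y' y < d \<longrightarrow> w y' < w y + e"
        proof (cases "dist y z < r")
          case True
          obtain d2 where d2: "d2 > 0" "\<And>y'. y' \<in> Q0 b \<Longrightarrow> dist y' y < d2 \<Longrightarrow> h y' < h y + e"
            using usc_onD[OF usc_continuous[OF hcont] y] by blast
          have "w y' < w y + e" if y': "y' \<in> Q0 b" "dist y' y < min d1 d2" for y'
          proof -
            have "upper y' < upper y + e" "h y' < h y + e" using d1 d2 y' by auto
            moreover have "upper y \<le> w y" "h y \<le> w y" using True by (auto simp: w_def)
            ultimately show ?thesis by (auto simp: w_def)
          qed
          then show ?thesis using d1 d2 by (intro exI[of _ "min d1 d2"]) auto
        next
          case False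
          have "w y' < w y + e" if y': "y' \<in> Q0 b" "dist y' y < min d1 (r / 2)" for y'
          proof -
            have "dist y z \<le> dist y' y + dist y' z" using dist_triangle[of y z y'] by (simp add: dist_commute)
            then have "r / 2 \<le> dist y' z" using False y'(2) by simp
            then have "w y' = upper y'" using w_outer y' by simp
            moreover have "upper y' < upper y + e" using d1(2) y' by simp
            ultimately show ?thesis using w_ge[of y] by simp
          qed
          then show ?thesis using d1 r by (intro exI[of _ "min d1 (r / 2)"]) auto
        qed
      qed
      moreover have "jet_sub b f g w"
        unfolding jet_sub_def
      proof (intro ballI allI impI)
        fix y \<tau>' p' X' c'
        assume y: "y \<in> Q b" and jet: "\<forall>\<^sub>F y' in nhds y. w y' \<le> w y + \<tau>' * (snd y' - snd y) + p' * (fst y' - fst y)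
          + X'/2 * (fst y' - fst y)^2 + c' * (snd y' - snd y)^2"
        show "\<tau>' \<le> f (g p' * X')"
        proof (cases "w y = upper y")
          case True
          have "\<forall>\<^sub>F y' in nhds y. upper y' \<le> upper y + \<tau>' * (snd y' - snd y) + p' * (fst y' - fst y)
            + X'/2 * (fst y' - fst y)^2 + c' * (snd y' - snd y)^2"
            using jet
          proof eventually_elim
            case (elim y')
            then show ?case using w_ge[of y'] True by linarith
          qed
          then show ?thesis using upper_jet y unfolding jet_sub_def by blast
        next
          case False
          then have yr: "dist y z < r" and wy: "w y = h y" by (auto simp: w_def max_def split: if_splits)
          have "\<forall>\<^sub>F y' in nhds y. y' \<in> ball z r" using yr by (intro eventually_nhds_in_open) (auto simp: dist_commute)
          with jet have "\<forall>\<^sub>F y' in nhds (fst y, snd y). Aq (fst y') + Bq (snd y') \<le> Aq (fst y) + Bq (snd y) + \<tau>' * (snd y' - snd y) + p' * (fst y' - fst y)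
            + X'/2 * (fst y' - fst y)^2 + c' * (snd y' - snd y)^2"
            unfolding prod.collapse
          proof eventually_elim
            case (elim y')
            then have "h y' \<le> w y'" by (simp add: w_def dist_commute)
            then show ?case using elim(1) by (simp add: wy h_def q_def)
          qed
          note jet_le = this
          have dA: "\<forall>\<^sub>F x in nhds (fst y). (Aq has_real_derivative (- p + (- X - 2 * \<epsilon>) * (x - fst z))) (at x)"
            unfolding Aq_def[abs_def] by (auto intro!: always_eventually derivative_eq_intros)
          have dA2: "((\<lambda>x. - p + (- X - 2 * \<epsilon>) * (x - fst z)) has_real_derivative (- X - 2 * \<epsilon>)) (at (fst y))"
            by (auto intro!: derivative_eq_intros)
          have dB: "(Bq has_real_derivative (- \<tau> + 2 * (- c - \<epsilon>) * (snd y - snd z))) (at (snd y))"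
            unfolding Bq_def[abs_def] by (auto intro!: derivative_eq_intros simp: algebra_simps)
          note j = separated_jet[OF jet_le dA dA2 dB]
          have "\<tau>' < f (g p' * (- X - 2 * \<epsilon>))" using r(2)[OF yr] unfolding G_def j(1,2) by simp
          also have "\<dots> \<le> f (g p' * X')"
            using j(3) g_pos[of p'] f_mono by (simp add: strict_mono_less_eq mult_left_mono)
          finally show ?thesis by simp
        qed
      qed
      moreover have "w y \<le> majorant y" if "y \<in> Q0 b" for y
        using upper(3)[OF that] r(2)[of y] \<kappa>(2) by (auto simp: w_def h_def)
      \<comment> \<open>The ball around \<open>z\<close> lies in the open set \<open>Q b\<close>, so
        the bump does not reach time 0.\<close>
      moreover have "w (x, 0) \<le> u0 x" if x: "-b < x" "x < b" for x
      proof -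
        have "\<not> dist (x, 0) z < r" using r(2)[of "(x, 0)"] by (auto simp: Q_def)
        then show ?thesis using upper_initial[OF x] by (simp add: w_def)
      qed
      ultimately have wf: "w \<in> family" by (simp add: family_def)
      have "isCont q z" unfolding q_def Aq_def Bq_def by (intro continuous_intros)
      then obtain d' where d': "d' > 0" "\<And>y. dist y z < d' \<Longrightarrow> \<bar>q y\<bar> < \<kappa> / 2"
        unfolding continuous_at_eps_delta using \<kappa>(1) qz by (metis dist_real_def diff_zero half_gt_zero)
      \<comment> \<open>Arbitrarily close to \<open>z\<close> there are points where
        \<open>U\<close> is below \<open>lower z + \<kappa> / 2\<close>, while the new member forces
        \<open>U\<close> to be at least \<open>h\<close>, which is above this value there.\<close>
      have "ereal (- lower z - \<kappa> / 2) < upper_env b (\<lambda>p. - U p) z" using upper_env_minus[OF zQ0] \<kappa>(1) by simp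
      then obtain y where y: "y \<in> Q0 b" "dist y z < min d' r" "- lower z - \<kappa> / 2 < - U y"
        by (rule upper_env_greaterD[of _ _ _ _ "min d' r"]) (use d' r in auto)
      have "h y \<le> w y" using y(2) by (simp add: w_def)
      then have "h y \<le> U y" using U_ge[OF wf y(1)] by simp
      moreover have "\<bar>q y\<bar> < \<kappa> / 2" using d'(2) y(2) by simp
      ultimately show False using y(3) by (simp add: h_def abs_less_iff)
    qed
  qed
qed

lemma viscosity_solution_U: "viscosity_solution b f g u0 U"
  unfolding viscosity_solution_def
proof (intro conjI ballI)
  fix z assume z: "z \<in> Q0 b"
  show "\<bar>upper_env b U z\<bar> \<noteq> \<infinity>" "\<bar>lower_env b U z\<bar> \<noteq> \<infinity>" by (simp_all add: upper(1)[OF z] lower(1)[OF z])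
next
  fix x assume "x \<in> {-b<..<b}"
  then have x: "-b < x" "x < b" by auto
  then have "(x, 0) \<in> Q0 b" by (simp add: Q0_def)
  then show "upper_env b U (x, 0) = ereal (u0 x)" "lower_env b U (x, 0) = ereal (u0 x)"
    using upper_initial_eq[OF x] by (simp_all add: upper(1) lower(1))
next
  show "sub_solution b f g (\<lambda>z. real_of_ereal (upper_env b U z))"
    unfolding sub_solution_def upper_def[symmetric]
    using usc_upper jet_sub_C2[OF upper_jet f_cont] by blast
  show "super_solution b f g (\<lambda>z. real_of_ereal (lower_env b U z))"
    unfolding super_solution_def lower_def[symmetric] lsc_on_iff_usc
    using usc_lower jet_super_C2[OF lower_jet f_cont] lower_boundary by blast
qed

end

section \<open>Existence and uniqueness\<close>

text \<open>The majorant \<open>K (b\<^sup>2 - x\<^sup>2)\<^sup>-\<^sup>\<nu>\<close> has bounded speed: near \<open>\<plusminus>b\<close> it is so steep that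
  \<open>near_stationary\<close> applies.\<close>

lemma viscosity_solution_exists:
  fixes f g u0 :: "real \<Rightarrow> real"
  assumes b: "b > 0" and f: "continuous_on UNIV f" "strict_mono f" "f 0 = 0"
    and g: "continuous_on UNIV g" "\<And>s. g s > 0" "power_decay \<alpha> g" "\<alpha> > 2"
    and u0: "continuous_on {-b<..<b} u0" "filterlim u0 at_top (at_left b)" "filterlim u0 at_top (at_right (-b))"
    and \<nu>: "\<nu> > 0" and K: "K > 0"
    and growth: "\<And>x. -b < x \<Longrightarrow> x < b \<Longrightarrow> u0 x \<le> K * (b^2 - x^2) powr (-\<nu>)"
  shows "\<exists>u. viscosity_solution b f g u0 u"
proof -
  define Y where "Y x = b^2 - x^2" for x
  have Y: "Y x > 0" if "-b < x" "x < b" for x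
  proof -
    have "0 < (b - x) * (b + x)" using that by (intro mult_pos_pos) auto
    then show ?thesis by (simp add: Y_def algebra_simps power2_eq_square)
  qed
  have dY: "(Y has_real_derivative - (2 * x)) (at x)" for x
    unfolding Y_def[abs_def] by (auto intro!: derivative_eq_intros)
  define A where "A x = K * Y x powr (-\<nu>)" for x
  define A1 where "A1 x = 2 * K * \<nu> * x * Y x powr (-\<nu> - 1)" for x
  define A2 where "A2 x = 2 * K * \<nu> * Y x powr (-\<nu> - 1) + 4 * K * \<nu> * (\<nu> + 1) * x^2 * Y x powr (-\<nu> - 2)" for x
  have A1: "(A has_real_derivative A1 x) (at x)" if "-b < x" "x < b" for x
    unfolding A_def[abs_def] A1_def using Y[OF that]
    by (auto intro!: derivative_eq_intros dY)
  have A2: "(A1 has_real_derivative A2 x) (at x)" if "-b < x" "x < b" for x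
    unfolding A1_def[abs_def] A2_def using Y[OF that]
    by (auto intro!: derivative_eq_intros dY simp: algebra_simps power2_eq_square)
  \<comment> \<open>Near the ends \<open>|x| \<ge> b / 2\<close>, so \<open>|A1 x|\<close> is at
    least \<open>m * Y x powr (-\<nu> - 1)\<close>; \<open>L\<close> bounds the ratio of
    \<open>Y x * A2 x\<close> to this quantity.\<close>
  define m where "m = K * \<nu> * b"
  have m: "m > 0" using K \<nu> b by (simp add: m_def)
  define L where "L = (2 * K * \<nu> * b^2 + 4 * K * \<nu> * (\<nu> + 1) * b^2) / m"
  have L: "L \<ge> 0" using K \<nu> m by (simp add: L_def)
  obtain s1 where s1: "0 < s1" "s1 \<le> 1" and
    stat: "\<And>s p z. 0 < s \<Longrightarrow> s \<le> s1 \<Longrightarrow> m * s powr (- 1) \<le> \<bar>p\<bar> \<Longrightarrow> \<bar>z\<bar> \<le> L * \<bar>p\<bar> / s \<Longrightarrow> \<bar>f (g p * z)\<bar> \<le> 1"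
    by (rule near_stationary[OF f(1,3) g(2,3), of 1 m L 1]) (use g(4) m L in auto)
  define s2 where "s2 = min s1 (b^2 / 2)"
  have s2: "0 < s2" "s2 \<le> s1" "s2 \<le> 1" "s2 \<le> b^2 / 2" using s1 b by (auto simp: s2_def)
  have outer: "f (g (A1 x) * A2 x) \<le> 1" if x: "-b < x" "x < b" and s: "Y x \<le> s2" for x
  proof -
    have y: "0 < Y x" "Y x \<le> s1" "Y x \<le> 1" using Y[OF x] s s2 by auto
    have "x^2 \<ge> b^2 / 2" using s s2 by (simp add: Y_def)
    moreover have "(b / 2)^2 = b^2 / 4" "0 \<le> b^2" by (simp_all add: power_divide)
    ultimately have "\<bar>x\<bar>^2 \<ge> (b / 2)^2" unfolding power2_abs by linarith
    then have xb: "\<bar>x\<bar> \<ge> b / 2" by (rule power2_le_imp_le) simp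
    have xb': "x^2 \<le> b^2" using Y[OF x] by (simp add: Y_def)
    have a1: "m * Y x powr (-\<nu> - 1) \<le> \<bar>A1 x\<bar>"
    proof -
      have "m * Y x powr (-\<nu> - 1) = 2 * K * \<nu> * (b / 2) * Y x powr (-\<nu> - 1)" by (simp add: m_def)
      also have "\<dots> \<le> 2 * K * \<nu> * \<bar>x\<bar> * Y x powr (-\<nu> - 1)"
        using xb K \<nu> by (intro mult_right_mono mult_left_mono) auto
      also have "\<dots> = \<bar>A1 x\<bar>" using K \<nu> by (simp add: A1_def abs_mult)
      finally show ?thesis .
    qed
    have "m * Y x powr (- 1) \<le> m * Y x powr (-\<nu> - 1)"
      using m y \<nu> by (intro mult_left_mono powr_mono') auto
    then have p: "m * Y x powr (- 1) \<le> \<bar>A1 x\<bar>" using a1 by simp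
    have A20: "0 \<le> A2 x" using K \<nu> by (simp add: A2_def)
    have pow: "Y x powr (-\<nu> - 2) = Y x powr (-\<nu> - 1) / Y x" using y by (simp add: powr_diff field_simps power2_eq_square)
    have "Y x \<le> b^2" by (simp add: Y_def)
    have "A2 x = (2 * K * \<nu> * Y x + 4 * K * \<nu> * (\<nu> + 1) * x^2) * Y x powr (-\<nu> - 1) / Y x"
      using y by (simp add: A2_def pow field_simps)
    also have "\<dots> \<le> (L * m) * Y x powr (-\<nu> - 1) / Y x"
    proof -
      have "2 * K * \<nu> * Y x \<le> 2 * K * \<nu> * b^2" using K \<nu> \<open>Y x \<le> b^2\<close> by (intro mult_left_mono) auto
      moreover have "4 * K * \<nu> * (\<nu> + 1) * x^2 \<le> 4 * K * \<nu> * (\<nu> + 1) * b^2" using K \<nu> xb' by (intro mult_left_mono) auto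
      ultimately have "2 * K * \<nu> * Y x + 4 * K * \<nu> * (\<nu> + 1) * x^2 \<le> L * m" using m by (simp add: L_def)
      then show ?thesis using y by (intro divide_right_mono mult_right_mono) auto
    qed
    also have "\<dots> = L * (m * Y x powr (-\<nu> - 1)) / Y x" by simp
    also have "\<dots> \<le> L * \<bar>A1 x\<bar> / Y x" using a1 L y by (intro divide_right_mono mult_left_mono) auto
    finally have "\<bar>f (g (A1 x) * A2 x)\<bar> \<le> 1" using A20 p y by (intro stat) auto
    then show ?thesis by simp
  qed
  \<comment> \<open>Away from the ends the operator along the majorant is continuous on a compact
    set; its bound there and the bound 1 near the ends give the speed \<open>C\<close>.\<close>
  define S where "S = {-b..b} \<inter> {x. s2 \<le> Y x}"
  have "compact S" unfolding S_def Y_def by (intro compact_Int_closed compact_Icc closed_Collect_le continuous_intros)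
  moreover have Sb: "-b < x \<and> x < b" if "x \<in> S" for x
  proof -
    have "x \<noteq> b" "x \<noteq> -b" using that s2(1) by (auto simp: S_def Y_def)
    then show ?thesis using that by (auto simp: S_def)
  qed
  have "continuous_on S (\<lambda>x. f (g (A1 x) * A2 x))"
  proof -
    have Yc: "continuous_on S Y" unfolding Y_def[abs_def] by (intro continuous_intros)
    have "continuous_on S A1" "continuous_on S A2"
      unfolding A1_def[abs_def] A2_def[abs_def] using Y Sb by (intro continuous_intros Yc; force)+
    then show ?thesis
      by (intro continuous_on_compose2[OF f(1)] continuous_intros continuous_on_compose2[OF g(1)]) auto
  qed
  ultimately have "compact ((\<lambda>x. f (g (A1 x) * A2 x)) ` S)" by (intro compact_continuous_image)
  then obtain B where B: "\<forall>y\<in>(\<lambda>x. f (g (A1 x) * A2 x)) ` S. norm y \<le> B"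
    using compact_imp_bounded bounded_iff by metis
  define C where "C = max 1 \<bar>B\<bar>"
  interpret perron b C f g u0 A A1 A2
  proof
    fix x assume x: "-b < x" "x < b"
    show "(A has_real_derivative A1 x) (at x)" "(A1 has_real_derivative A2 x) (at x)" using A1 A2 x by auto
    show "u0 x \<le> A x" using growth[OF x] by (simp add: A_def Y_def)
    show "f (g (A1 x) * A2 x) \<le> C"
    proof (cases "Y x \<le> s2")
      case True
      then show ?thesis using outer[OF x] by (simp add: C_def)
    next
      case False
      then have "x \<in> S" using x by (simp add: S_def)
      then have "\<bar>f (g (A1 x) * A2 x)\<bar> \<le> B" using B by auto
      then show ?thesis by (simp add: C_def)
    qed
  qed (use b f g u0 in \<open>auto simp: C_def\<close>)
  show ?thesis using viscosity_solution_U by blast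
qed

section \<open>Growth of the initial datum\<close>

lemma growth_bound_global:
  fixes u0 :: "real \<Rightarrow> real"
  assumes b: "b > 0" and u0: "continuous_on {-b<..<b} u0" and \<nu>: "\<nu> > 0"
    and R: "\<forall>\<^sub>F x in at_left b. u0 x \<le> Kp * (b - x) powr (-\<nu>)"
    and L: "\<forall>\<^sub>F x in at_right (-b). u0 x \<le> Km * (b + x) powr (-\<nu>)"
  obtains K where "K > 0" "\<And>x. -b < x \<Longrightarrow> x < b \<Longrightarrow> u0 x \<le> K * (b^2 - x^2) powr (-\<nu>)"
proof -
  obtain c1 where c1: "c1 < b" "\<And>y. c1 < y \<Longrightarrow> y < b \<Longrightarrow> u0 y \<le> Kp * (b - y) powr (-\<nu>)"
    using R unfolding eventually_at_left_field by blast
  obtain c2 where c2: "c2 > -b" "\<And>y. -b < y \<Longrightarrow> y < c2 \<Longrightarrow> u0 y \<le> Km * (b + y) powr (-\<nu>)"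
    using L unfolding eventually_at_right_field by blast
  define l where "l = min 0 ((c2 - b) / 2)"
  define r where "r = max 0 ((c1 + b) / 2)"
  have lr: "-b < l" "l \<le> r" "r < b" using b c1(1) c2(1) by (auto simp: l_def r_def)
  have "c1 < (c1 + b) / 2" "(c2 - b) / 2 < c2" using c1(1) c2(1) by simp_all
  then have lr': "c1 < r" "l < c2" unfolding l_def r_def by linarith+
  have "continuous_on {l..r} u0" by (rule continuous_on_subset[OF u0]) (use lr in auto)
  then obtain x0 where x0: "\<And>x. x \<in> {l..r} \<Longrightarrow> u0 x \<le> u0 x0"
    using interval_attains(2)[OF lr(2)] by blast
  define K1 where "K1 = \<bar>Kp\<bar> + \<bar>Km\<bar>"
  define K where "K = K1 * (2 * b) powr \<nu> + \<bar>u0 x0\<bar> * (b^2) powr \<nu> + 1"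
  have K: "K1 * (2 * b) powr \<nu> \<le> K" "\<bar>u0 x0\<bar> * (b^2) powr \<nu> \<le> K" "K > 0"
    by (auto simp: K_def K1_def intro!: add_nonneg_pos add_nonneg_nonneg)
  have main: "u0 x \<le> K * (b^2 - x^2) powr (-\<nu>)" if x: "-b < x" "x < b" for x
  proof -
    define p where "p = (b^2 - x^2) powr (-\<nu>)"
    have p: "p \<ge> 0" by (simp add: p_def)
    \<comment> \<open>Near one end the factor belonging to the other end is at most
      \<open>2 * b\<close>, which turns a one-sided power bound into one for the product.\<close>
    have fact: "b^2 - x^2 = (b - x) * (b + x)" by (simp add: algebra_simps power2_eq_square)
    have y: "b - x > 0" "b + x > 0" using x by auto
    have end_le: "s powr (-\<nu>) \<le> (2 * b) powr \<nu> * p" if s: "s > 0" "s' > 0" "s' \<le> 2 * b" "b^2 - x^2 = s * s'" for s s'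
    proof -
      have "p = s powr (-\<nu>) * s' powr (-\<nu>)" using s by (simp add: p_def powr_mult)
      then have "s' powr \<nu> * p = s powr (-\<nu>)" using s by (simp add: powr_minus field_simps)
      moreover have "s' powr \<nu> * p \<le> (2 * b) powr \<nu> * p" using s \<nu> p by (intro mult_right_mono powr_mono2) auto
      ultimately show ?thesis by simp
    qed
    have K1p: "K1 * ((2 * b) powr \<nu> * p) \<le> K * p"
      using mult_right_mono[OF K(1) p] by (simp add: mult_ac)
    consider "c1 < x" | "x < c2" | "x \<in> {l..r}" using lr' by force
    then have "u0 x \<le> K * p"
    proof cases
      case 1
      have "u0 x \<le> Kp * (b - x) powr (-\<nu>)" using c1(2) 1 x by simp
      also have "\<dots> \<le> K1 * (b - x) powr (-\<nu>)" by (intro mult_right_mono) (auto simp: K1_def)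
      also have "\<dots> \<le> K1 * ((2 * b) powr \<nu> * p)"
        using end_le[of "b - x" "b + x"] y x fact by (intro mult_left_mono) (auto simp: K1_def)
      finally show ?thesis using K1p by simp
    next
      case 2
      have "u0 x \<le> Km * (b + x) powr (-\<nu>)" using c2(2) 2 x by simp
      also have "\<dots> \<le> K1 * (b + x) powr (-\<nu>)" by (intro mult_right_mono) (auto simp: K1_def)
      also have "\<dots> \<le> K1 * ((2 * b) powr \<nu> * p)"
        using end_le[of "b + x" "b - x"] y x fact by (intro mult_left_mono) (auto simp: K1_def)
      finally show ?thesis using K1p by simp
    next
      case 3
      have "b^2 - x^2 > 0" using y by (simp add: fact)
      then have "(b^2) powr (-\<nu>) \<le> p" unfolding p_def using \<nu> by (intro powr_mono2') auto
      then have "1 \<le> (b^2) powr \<nu> * p" using b by (simp add: powr_minus field_simps)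
      have "u0 x \<le> \<bar>u0 x0\<bar> * 1" using x0[OF 3] by simp
      also have "\<dots> \<le> \<bar>u0 x0\<bar> * ((b^2) powr \<nu> * p)" using \<open>1 \<le> (b^2) powr \<nu> * p\<close> by (intro mult_left_mono) auto
      also have "\<dots> \<le> K * p" using mult_right_mono[OF K(2) p] by (simp add: mult_ac)
      finally show ?thesis .
    qed
    then show ?thesis by (simp add: p_def)
  qed
  show ?thesis by (rule that[OF K(3) main])
qed

lemma Limsup_growth:
  fixes h w :: "real \<Rightarrow> real"
  assumes "Limsup G (\<lambda>x. ereal (h x * w x powr \<gamma>)) < \<infinity>" "\<forall>\<^sub>F x in G. w x > 0"
  shows "\<exists>K. \<forall>\<^sub>F x in G. h x \<le> K * w x powr (-\<gamma>)"
proof -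
  obtain K where "Limsup G (\<lambda>x. ereal (h x * w x powr \<gamma>)) < ereal K"
    using assms(1) less_PInf_Ex_of_nat by (metis less_irrefl)
  then have "\<forall>\<^sub>F x in G. ereal (h x * w x powr \<gamma>) < ereal K" by (rule Limsup_lessD)
  with assms(2) have "\<forall>\<^sub>F x in G. h x \<le> K * w x powr (-\<gamma>)"
    by eventually_elim (simp add: powr_minus field_simps)
  then show ?thesis by blast
qed

text \<open>The exponent is at least 1 in order to dominate the logarithm as well, through
  \<open>- ln w \<le> 1 / w\<close>.\<close>

lemma psi_growth:
  assumes \<gamma>: "\<gamma> \<ge> 0" and \<nu>: "\<gamma> \<le> \<nu>" "1 \<le> \<nu>" and D: "D > 0" and w: "\<forall>\<^sub>F x in G. 0 < w x \<and> w x < 1"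
    and lim: "((\<lambda>x. h x - D * psi \<gamma> (w x)) \<longlongrightarrow> C) G"
  shows "\<forall>\<^sub>F x in G. h x \<le> (D + \<bar>C\<bar> + 1) * w x powr (-\<nu>)"
proof -
  have "\<forall>\<^sub>F x in G. h x - D * psi \<gamma> (w x) < \<bar>C\<bar> + 1" by (rule order_tendstoD(2)[OF lim]) auto
  with w show ?thesis
  proof eventually_elim
    case (elim x)
    have big: "1 \<le> w x powr (-\<nu>)" using powr_mono'[of "-\<nu>" 0 "w x"] elim \<nu> by simp
    have "psi \<gamma> (w x) \<le> w x powr (-\<nu>)"
    proof (cases "\<gamma> > 0")
      case True
      then show ?thesis using elim \<nu> by (simp add: psi_def powr_mono')
    next
      case False
      have "- ln (w x) = ln (1 / w x)" using elim by (simp add: ln_div)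
      also have "\<dots> \<le> 1 / w x" using elim by (intro ln_bound) auto
      also have "\<dots> = w x powr (-1)" using elim by (simp add: powr_minus field_simps)
      also have "\<dots> \<le> w x powr (-\<nu>)" using elim \<nu> by (intro powr_mono') auto
      finally show ?thesis using False by (simp add: psi_def)
    qed
    then have "D * psi \<gamma> (w x) \<le> D * w x powr (-\<nu>)" using D by (intro mult_left_mono) auto
    moreover have "(\<bar>C\<bar> + 1) * 1 \<le> (\<bar>C\<bar> + 1) * w x powr (-\<nu>)" using big by (intro mult_left_mono) auto
    ultimately show ?case using elim by (simp add: distrib_right)
  qed
qed

lemma psi_at_top:
  assumes \<gamma>: "\<gamma> \<ge> 0" and D: "D > 0" and w: "(w \<longlongrightarrow> 0) G" "\<forall>\<^sub>F x in G. 0 < w x"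
    and lim: "((\<lambda>x. h x - D * psi \<gamma> (w x)) \<longlongrightarrow> C) G"
  shows "filterlim (h :: real \<Rightarrow> real) at_top G"
proof -
  have "filterlim (\<lambda>x. psi \<gamma> (w x)) at_top G"
    unfolding filterlim_at_top
  proof
    fix Z
    obtain s0 where s0: "s0 > 0" "\<And>s. 0 < s \<Longrightarrow> s \<le> s0 \<Longrightarrow> Z \<le> psi \<gamma> s" using psi_large[OF \<gamma>] by blast
    have "\<forall>\<^sub>F x in G. w x < s0" by (rule order_tendstoD(2)[OF w(1) s0(1)])
    with w(2) show "\<forall>\<^sub>F x in G. Z \<le> psi \<gamma> (w x)" by eventually_elim (use s0(2) in auto)
  qed
  then have "filterlim (\<lambda>x. D * psi \<gamma> (w x)) at_top G"
    using D by (intro filterlim_tendsto_pos_mult_at_top[OF tendsto_const])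
  from filterlim_tendsto_add_at_top[OF lim this] show ?thesis by simp
qed

text \<open>The finite constant in the expansion lets both barriers start within a multiple of
  \<open>\<epsilon>\<close> of \<open>u0\<close>, which ties \<open>u\<close> and \<open>v\<close>
  to the same function and not merely to the same leading term. The factor 5 adds the
  \<open>3 * \<epsilon>\<close> of \<open>sub_boundary_upper\<close>, the shift of \<open>C\<close>
  and the error of the expansion.\<close>

lemma boundary_squeeze:
  assumes u: "jet_sub b f g u" "usc_on (Q0 b) u" "\<And>x. -b < x \<Longrightarrow> x < b \<Longrightarrow> u (x, 0) = u0 x"
    and v: "jet_sub b (\<lambda>s. - f (- s)) (\<lambda>p. g (- p)) (\<lambda>z. - v z)" "usc_on (Q0 b) (\<lambda>z. - v z)"
      "\<And>x. -b < x \<Longrightarrow> x < b \<Longrightarrow> v (x, 0) = u0 x"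
    and f: "continuous_on UNIV f" "f 0 = 0" and g: "\<And>s. g s > 0" "power_decay \<alpha> g" "\<alpha> > 2"
    and b: "b > 0"
    and lim: "\<And>t. t \<ge> 0 \<Longrightarrow> filterlim (\<lambda>x. v (x, t)) at_top (at_left b)"
      "\<And>t. t \<ge> 0 \<Longrightarrow> filterlim (\<lambda>x. v (x, t)) at_top (at_right (-b))"
    and m: "\<And>x. -b < x \<Longrightarrow> x < b \<Longrightarrow> m \<le> u0 x"
    and \<gamma>: "\<gamma> \<ge> 0" and D: "D > 0" and T: "T > 0" and \<epsilon>: "\<epsilon> > 0"
    and asym: "((\<lambda>x. u0 x - D * psi \<gamma> (b - x)) \<longlongrightarrow> C) (at_left b)"
  shows "\<exists>d>0. \<forall>x t. -b < x \<longrightarrow> b - d < x \<longrightarrow> x < b \<longrightarrow> 0 \<le> t \<longrightarrow> t < T \<longrightarrow>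
    u (x, t) \<le> u0 x + 5 * \<epsilon> \<and> u0 x - 5 * \<epsilon> \<le> v (x, t)"
proof -
  have "\<forall>\<^sub>F x in at_left b. dist (u0 x - D * psi \<gamma> (b - x)) C < \<epsilon>" using asym \<epsilon> by (rule tendstoD)
  then obtain c where c: "c < b" "\<And>x. c < x \<Longrightarrow> x < b \<Longrightarrow> \<bar>u0 x - D * psi \<gamma> (b - x) - C\<bar> < \<epsilon>"
    unfolding eventually_at_left_field dist_real_def by blast
  define d1 where "d1 = b - c"
  have d1: "d1 > 0" "\<And>x. b - d1 < x \<Longrightarrow> x < b \<Longrightarrow> \<bar>u0 x - D * psi \<gamma> (b - x) - C\<bar> < \<epsilon>"
    using c by (auto simp: d1_def)
  have "\<exists>d>0. \<forall>x t. - b < x \<longrightarrow> b - d < x \<longrightarrow> x < b \<longrightarrow> 0 \<le> t \<longrightarrow> t < T \<longrightarrow> u (x, t) \<le> D * psi \<gamma> (b - x) + (C + \<epsilon>) + 3 * \<epsilon>"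
  proof (rule sub_boundary_upper[OF u(1,2) f g b \<gamma> D T d1(1) \<epsilon>])
    show "u (x, 0) \<le> D * psi \<gamma> (b - x) + (C + \<epsilon>)" if "-b < x" "b - d1 < x" "x < b" for x
      using d1(2)[OF that(2,3)] u(3)[OF that(1,3)] by linarith
  qed
  then obtain d2 where d2: "d2 > 0" "\<And>x t. - b < x \<Longrightarrow> b - d2 < x \<Longrightarrow> x < b \<Longrightarrow> 0 \<le> t \<Longrightarrow> t < T \<Longrightarrow>
      u (x, t) \<le> D * psi \<gamma> (b - x) + (C + \<epsilon>) + 3 * \<epsilon>" by blast
  have "\<exists>d>0. \<forall>x t. - b < x \<longrightarrow> b - d < x \<longrightarrow> x < b \<longrightarrow> t \<ge> 0 \<longrightarrow> D * psi \<gamma> (b - x) + (C - \<epsilon>) \<le> v (x, t)"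
  proof (rule super_boundary_lower[OF v(1,2) f g b lim \<gamma> D d1(1), where m = m])
    show "D * psi \<gamma> (b - x) + (C - \<epsilon>) \<le> v (x, 0)" if "-b < x" "b - d1 < x" "x < b" for x
      using d1(2)[OF that(2,3)] v(3)[OF that(1,3)] by linarith
    show "m \<le> v (x, 0)" if "-b < x" "x < b" for x using m[OF that] v(3)[OF that] by simp
  qed
  then obtain d3 where d3: "d3 > 0" "\<And>x t. - b < x \<Longrightarrow> b - d3 < x \<Longrightarrow> x < b \<Longrightarrow> t \<ge> 0 \<Longrightarrow>
      D * psi \<gamma> (b - x) + (C - \<epsilon>) \<le> v (x, t)" by blast
  have "u (x, t) \<le> u0 x + 5 * \<epsilon> \<and> u0 x - 5 * \<epsilon> \<le> v (x, t)"
    if "-b < x" "b - min d1 (min d2 d3) < x" "x < b" "0 \<le> t" "t < T" for x t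
  proof -
    have x: "b - d1 < x" "b - d2 < x" "b - d3 < x" using that(2) by linarith+
    show ?thesis
      using d1(2)[OF x(1) that(3)] d2(2)[OF that(1) x(2) that(3-5)] d3(2)[OF that(1) x(3) that(3,4)] \<epsilon> by linarith
  qed
  then show ?thesis using d1(1) d2(1) d3(1) by (intro exI[of _ "min d1 (min d2 d3)"]) auto
qed

text \<open>\<open>boundary_squeeze\<close> at \<open>b\<close>, and after reflection at
  \<open>- b\<close>, supplies lateral values on two lines that enclose the given point;
  \<open>interior_comparison\<close> then applies with \<open>u0\<close> as the common
  datum.\<close>

lemma sub_le_super:
  assumes u: "jet_sub b f g u" "usc_on (Q0 b) u" "\<And>x. -b < x \<Longrightarrow> x < b \<Longrightarrow> u (x, 0) = u0 x"
    and v: "jet_sub b (\<lambda>s. - f (- s)) (\<lambda>p. g (- p)) (\<lambda>z. - v z)" "usc_on (Q0 b) (\<lambda>z. - v z)"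
      "\<And>x. -b < x \<Longrightarrow> x < b \<Longrightarrow> v (x, 0) = u0 x"
    and f: "continuous_on UNIV f" "strict_mono f" "f 0 = 0"
    and g: "continuous_on UNIV g" "\<And>s. g s > 0" "power_decay \<alpha> g" "\<alpha> > 2"
    and b: "b > 0" and u0: "continuous_on {-b<..<b} u0"
    and lim: "\<And>t. t \<ge> 0 \<Longrightarrow> filterlim (\<lambda>x. v (x, t)) at_top (at_left b)"
      "\<And>t. t \<ge> 0 \<Longrightarrow> filterlim (\<lambda>x. v (x, t)) at_top (at_right (-b))"
    and m: "\<And>x. -b < x \<Longrightarrow> x < b \<Longrightarrow> m \<le> u0 x"
    and \<gamma>: "\<gamma>p \<ge> 0" "\<gamma>m \<ge> 0" and D: "Dp > 0" "Dm > 0"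
    and asym: "((\<lambda>x. u0 x - Dp * psi \<gamma>p (b - x)) \<longlongrightarrow> Cp) (at_left b)"
      "((\<lambda>x. u0 x - Dm * psi \<gamma>m (b + x)) \<longlongrightarrow> Cm) (at_right (-b))"
    and z: "z \<in> Q0 b"
  shows "u z \<le> v z"
proof (rule field_le_epsilon)
  fix \<eta> :: real assume \<eta>: "\<eta> > 0"
  \<comment> \<open>\<open>u\<close> and \<open>v\<close> each deviate from \<open>u0\<close> by up
    to \<open>5 * \<epsilon>\<close> on the lateral lines, which adds up to
    \<open>\<eta>\<close>.\<close>
  define \<epsilon> where "\<epsilon> = \<eta> / 10"
  have \<epsilon>: "\<epsilon> > 0" using \<eta> by (simp add: \<epsilon>_def)
  obtain x0 t0 where z0: "z = (x0, t0)" by fastforce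
  have x0: "-b < x0" "x0 < b" "0 \<le> t0" using z by (auto simp: z0 Q0_def)
  define T where "T = t0 + 1"
  have T: "T > 0" "t0 < T" using x0 by (auto simp: T_def)
  obtain dp where dp: "dp > 0" "\<And>x t. -b < x \<Longrightarrow> b - dp < x \<Longrightarrow> x < b \<Longrightarrow> 0 \<le> t \<Longrightarrow> t < T \<Longrightarrow>
      u (x, t) \<le> u0 x + 5 * \<epsilon> \<and> u0 x - 5 * \<epsilon> \<le> v (x, t)"
    using boundary_squeeze[OF u v f(1,3) g(2-4) b lim m \<gamma>(1) D(1) T(1) \<epsilon> asym(1)] by blast
  have vr: "jet_sub b (\<lambda>s. - f (- s)) (\<lambda>p. g (- (- p))) (\<lambda>z. - v (- fst z, snd z))"
    using jet_sub_reflect[OF v(1)] by simp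
  have vr2: "usc_on (Q0 b) (\<lambda>z. - v (- fst z, snd z))" using usc_on_reflect[OF v(2)] by simp
  have "\<exists>d>0. \<forall>x t. -b < x \<longrightarrow> b - d < x \<longrightarrow> x < b \<longrightarrow> 0 \<le> t \<longrightarrow> t < T \<longrightarrow>
    u (- fst (x, t), snd (x, t)) \<le> u0 (- x) + 5 * \<epsilon> \<and> u0 (- x) - 5 * \<epsilon> \<le> v (- fst (x, t), snd (x, t))"
  proof (rule boundary_squeeze[OF jet_sub_reflect[OF u(1)] usc_on_reflect[OF u(2)] _ vr vr2 _ f(1,3) _
        power_decay_reflect[OF g(3)] g(4) b _ _ _ \<gamma>(2) D(2) T(1) \<epsilon>, of "\<lambda>x. u0 (- x)" m Cm])
    show "filterlim (\<lambda>x. v (- fst (x, t), snd (x, t))) at_top (at_left b)" if "t \<ge> 0" for t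
      using lim(2)[OF that] by (simp add: filterlim_at_left_to_right[of _ _ b])
    show "filterlim (\<lambda>x. v (- fst (x, t), snd (x, t))) at_top (at_right (-b))" if "t \<ge> 0" for t
      using lim(1)[OF that] by (simp add: filterlim_at_left_to_right[of _ _ b])
    show "((\<lambda>x. u0 (- x) - Dm * psi \<gamma>m (b - x)) \<longlongrightarrow> Cm) (at_left b)"
      using asym(2) by (simp add: filterlim_at_left_to_right[of _ _ b])
  qed (use u v g m in auto)
  then obtain dm where dm: "dm > 0" "\<And>x t. -b < x \<Longrightarrow> b - dm < x \<Longrightarrow> x < b \<Longrightarrow> 0 \<le> t \<Longrightarrow> t < T \<Longrightarrow>
      u (- x, t) \<le> u0 (- x) + 5 * \<epsilon> \<and> u0 (- x) - 5 * \<epsilon> \<le> v (- x, t)" by auto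
  define r where "r = max ((x0 + b) / 2) (b - min b dp / 2)"
  define l where "l = min ((x0 - b) / 2) (- b + min b dm / 2)"
  have "x0 < (x0 + b) / 2" "(x0 + b) / 2 < b" "(x0 - b) / 2 < x0" "-b < (x0 - b) / 2" using x0 by simp_all
  moreover have "b - min b dp / 2 < b" "- b + min b dm / 2 > - b" "b - dp < b - min b dp / 2" "- b + min b dm / 2 < - b + dm"
    using b dp(1) dm(1) by auto
  ultimately have r: "x0 < r" "r < b" "b - dp < r" and l: "l < x0" "-b < l" "l < - b + dm"
    unfolding l_def r_def by linarith+
  have "u (x0, t0) - v (x0, t0) \<le> 2 * (5 * \<epsilon>)"
  proof (rule interior_comparison[OF u(1,2) v(1,2) f g(1,2) l(2) _ r(2) T(1), where ?w0.0 = u0])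
    show "continuous_on {l..r} u0" by (rule continuous_on_subset[OF u0]) (use l r in auto)
    show "u (l, t) \<le> u0 l + 5 * \<epsilon>" "v (l, t) \<ge> u0 l - 5 * \<epsilon>" if "0 \<le> t" "t < T" for t
      using dm(2)[of "- l" t] that l x0 by auto
    show "u (r, t) \<le> u0 r + 5 * \<epsilon>" "v (r, t) \<ge> u0 r - 5 * \<epsilon>" if "0 \<le> t" "t < T" for t
      using dp(2)[of r t] that r x0 by auto
  qed (use l r x0 T \<epsilon> u(3) v(3) in auto)
  then show "u z \<le> v z + \<eta>" by (simp add: z0 \<epsilon>_def)
qed

lemma viscosity_solutionD:
  assumes "viscosity_solution b f g u0 v"
  defines "hi \<equiv> \<lambda>z. real_of_ereal (upper_env b v z)" and "lo \<equiv> \<lambda>z. real_of_ereal (lower_env b v z)"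
  shows "jet_sub b f g hi" "usc_on (Q0 b) hi"
    "jet_sub b (\<lambda>s. - f (- s)) (\<lambda>p. g (- p)) (\<lambda>z. - lo z)" "usc_on (Q0 b) (\<lambda>z. - lo z)"
    "-b < x \<Longrightarrow> x < b \<Longrightarrow> hi (x, 0) = u0 x" "-b < x \<Longrightarrow> x < b \<Longrightarrow> lo (x, 0) = u0 x"
    "t > 0 \<Longrightarrow> filterlim (\<lambda>x. lo (x, t)) at_top (at_left b)" "t > 0 \<Longrightarrow> filterlim (\<lambda>x. lo (x, t)) at_top (at_right (-b))"
    "z \<in> Q0 b \<Longrightarrow> v z \<le> hi z" "z \<in> Q0 b \<Longrightarrow> lo z \<le> v z"
proof -
  have fin: "\<And>z. z \<in> Q0 b \<Longrightarrow> \<bar>upper_env b v z\<bar> \<noteq> \<infinity> \<and> \<bar>lower_env b v z\<bar> \<noteq> \<infinity>"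
    and sub: "sub_solution b f g hi" and super: "super_solution b f g lo"
    and init: "\<And>x. x \<in> {-b<..<b} \<Longrightarrow> upper_env b v (x, 0) = ereal (u0 x) \<and> lower_env b v (x, 0) = ereal (u0 x)"
    using assms(1)[unfolded viscosity_solution_def, folded hi_def lo_def] by (simp_all del: abs_ereal_less0)
  show "jet_sub b f g hi" by (rule sub_solution_jet[OF sub])
  show "usc_on (Q0 b) hi" using sub by (simp add: sub_solution_def)
  show "jet_sub b (\<lambda>s. - f (- s)) (\<lambda>p. g (- p)) (\<lambda>z. - lo z)" by (rule super_solution_jet[OF super])
  show "usc_on (Q0 b) (\<lambda>z. - lo z)" using super by (simp add: super_solution_def lsc_on_iff_usc)
  show "hi (x, 0) = u0 x" "lo (x, 0) = u0 x" if "-b < x" "x < b" using init[of x] that by (auto simp: hi_def lo_def)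
  show "filterlim (\<lambda>x. lo (x, t)) at_top (at_left b)" "filterlim (\<lambda>x. lo (x, t)) at_top (at_right (-b))" if "t > 0"
    using super that by (auto simp: super_solution_def)
  show "v z \<le> hi z" if "z \<in> Q0 b"
    using upper_env_ge[OF that, of v] fin[OF that] unfolding hi_def by (cases "upper_env b v z") auto
  show "lo z \<le> v z" if "z \<in> Q0 b"
    using upper_env_ge[OF that, of "\<lambda>p. - v p"] fin[OF that] unfolding lo_def lower_env_eq
    by (cases "upper_env b (\<lambda>p. - v p) z") auto
qed

lemma continuous_on_usc_lsc:
  fixes u :: "'a::metric_space \<Rightarrow> real"
  assumes "usc_on S u" "usc_on S (\<lambda>z. - u z)"
  shows "continuous_on S u"
  unfolding continuous_on_iff
proof (intro ballI allI impI)
  fix z and e :: real assume z: "z \<in> S" "e > 0"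
  obtain d1 where d1: "d1 > 0" "\<And>y. y \<in> S \<Longrightarrow> dist y z < d1 \<Longrightarrow> u y < u z + e" using usc_onD[OF assms(1) z] by blast
  obtain d2 where d2: "d2 > 0" "\<And>y. y \<in> S \<Longrightarrow> dist y z < d2 \<Longrightarrow> - u y < - u z + e" using usc_onD[OF assms(2) z] by blast
  have "dist (u y) (u z) < e" if "y \<in> S" "dist y z < min d1 d2" for y
    using d1(2)[of y] d2(2)[of y] that by (simp add: dist_real_def abs_less_iff)
  then show "\<exists>d>0. \<forall>y\<in>S. dist y z < d \<longrightarrow> dist (u y) (u z) < e" using d1(1) d2(1) by (intro exI[of _ "min d1 d2"]) auto
qed

lemma usc_on_cong: "(\<And>z. z \<in> S \<Longrightarrow> u z = w z) \<Longrightarrow> usc_on S u \<longleftrightarrow> usc_on S (w :: 'a::metric_space \<Rightarrow> real)"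
  unfolding usc_on_iff by (simp cong: ball_cong)

theorem theorem1p1:
  fixes b \<alpha> Cgp Cgm :: real and f g :: "real \<Rightarrow> real"
  assumes "b > 0"
    and "continuous_on UNIV f" and "strict_mono f" and "f 0 = 0"
    and "filterlim f at_top at_top" and "filterlim f at_bot at_bot"
    and "continuous_on UNIV g" and "\<And>s. g s > 0"
    and "\<alpha> > 2" and "Cgp > 0" and "Cgm > 0"
    and "((\<lambda>s. \<bar>s\<bar> powr \<alpha> * g s) \<longlongrightarrow> Cgp) at_top"
    and "((\<lambda>s. \<bar>s\<bar> powr \<alpha> * g s) \<longlongrightarrow> Cgm) at_bot"
  shows
    "(\<forall>u0 \<gamma>. continuous_on {-b<..<b} u0 \<and> \<gamma> > 0 \<and>
        filterlim u0 at_top (at_left b) \<and> filterlim u0 at_top (at_right (-b)) \<and>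
        Limsup (at_left b) (\<lambda>x. ereal (u0 x * (b - x) powr \<gamma>)) < \<infinity> \<and>
        Limsup (at_right (-b)) (\<lambda>x. ereal (u0 x * (b + x) powr \<gamma>)) < \<infinity>
        \<longrightarrow> (\<exists>u. viscosity_solution b f g u0 u)) \<and>
     (\<forall>u0 \<gamma>p \<gamma>m Dp Dm Cp Cm. continuous_on {-b<..<b} u0 \<and>
        \<gamma>p \<ge> 0 \<and> \<gamma>m \<ge> 0 \<and> Dp > 0 \<and> Dm > 0 \<and>
        ((\<lambda>x. u0 x - Dp * psi \<gamma>p (b - x)) \<longlongrightarrow> Cp) (at_left b) \<and>
        ((\<lambda>x. u0 x - Dm * psi \<gamma>m (b + x)) \<longlongrightarrow> Cm) (at_right (-b))
        \<longrightarrow> (\<exists>u. viscosity_solution b f g u0 u \<and> continuous_on (Q0 b) u \<and>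
               (\<forall>v. viscosity_solution b f g u0 v \<longrightarrow> (\<forall>z \<in> Q0 b. v z = u z))))"
proof (intro conjI allI impI; elim conjE)
  have decay: "power_decay \<alpha> g" using power_decay_of_limits assms(12,13) .
  have near: "\<forall>\<^sub>F x in at_left b. 0 < b - x \<and> b - x < 1" "\<forall>\<^sub>F x in at_right (-b). 0 < b + x \<and> b + x < 1"
  proof -
    show "\<forall>\<^sub>F x in at_left b. 0 < b - x \<and> b - x < 1"
      unfolding eventually_at_left_field by (rule exI[of _ "b - 1"]) auto
    show "\<forall>\<^sub>F x in at_right (-b). 0 < b + x \<and> b + x < 1"
      unfolding eventually_at_right_field by (rule exI[of _ "- b + 1"]) auto
  qed
  have exist: "\<exists>u. viscosity_solution b f g u0 u"
    if u0: "continuous_on {-b<..<b} u0" "filterlim u0 at_top (at_left b)" "filterlim u0 at_top (at_right (-b))"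
      and \<nu>: "\<nu> > 0" and R: "\<forall>\<^sub>F x in at_left b. u0 x \<le> Kp * (b - x) powr (-\<nu>)"
      and L: "\<forall>\<^sub>F x in at_right (-b). u0 x \<le> Km * (b + x) powr (-\<nu>)" for u0 \<nu> Kp Km
  proof -
    obtain K where "K > 0" "\<And>x. -b < x \<Longrightarrow> x < b \<Longrightarrow> u0 x \<le> K * (b^2 - x^2) powr (-\<nu>)"
      using growth_bound_global[OF assms(1) u0(1) \<nu> R L] by blast
    then show ?thesis by (rule viscosity_solution_exists[OF assms(1-4,7,8) decay assms(9) u0 \<nu>])
  qed
  {
    fix u0 \<gamma>
    assume u0: "continuous_on {-b<..<b} u0" "\<gamma> > 0" "filterlim u0 at_top (at_left b)" "filterlim u0 at_top (at_right (-b))"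
      and lim: "Limsup (at_left b) (\<lambda>x. ereal (u0 x * (b - x) powr \<gamma>)) < \<infinity>"
        "Limsup (at_right (-b)) (\<lambda>x. ereal (u0 x * (b + x) powr \<gamma>)) < \<infinity>"
    have pos: "\<forall>\<^sub>F x in at_left b. 0 < b - x" "\<forall>\<^sub>F x in at_right (-b). 0 < b + x"
      by (rule eventually_mono[OF near(1)], simp) (rule eventually_mono[OF near(2)], simp)
    obtain Kp Km where "\<forall>\<^sub>F x in at_left b. u0 x \<le> Kp * (b - x) powr (-\<gamma>)"
      "\<forall>\<^sub>F x in at_right (-b). u0 x \<le> Km * (b + x) powr (-\<gamma>)"
      using Limsup_growth[OF lim(1) pos(1)] Limsup_growth[OF lim(2) pos(2)] by blast
    then show "\<exists>u. viscosity_solution b f g u0 u" using exist u0 by blast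
  }
  {
    fix u0 \<gamma>p \<gamma>m Dp Dm Cp Cm
    assume u0: "continuous_on {-b<..<b} u0" and \<gamma>: "0 \<le> \<gamma>p" "0 \<le> \<gamma>m" and D: "0 < Dp" "0 < Dm"
      and asym: "((\<lambda>x. u0 x - Dp * psi \<gamma>p (b - x)) \<longlongrightarrow> Cp) (at_left b)"
        "((\<lambda>x. u0 x - Dm * psi \<gamma>m (b + x)) \<longlongrightarrow> Cm) (at_right (-b))"
    have w0: "((\<lambda>x. b - x) \<longlongrightarrow> 0) (at_left b)" "((\<lambda>x. b + x) \<longlongrightarrow> 0) (at_right (-b))"
      by (auto intro!: tendsto_eq_intros)
    have pos: "\<forall>\<^sub>F x in at_left b. 0 < b - x" "\<forall>\<^sub>F x in at_right (-b). 0 < b + x"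
      by (rule eventually_mono[OF near(1)], simp) (rule eventually_mono[OF near(2)], simp)
    have top: "filterlim u0 at_top (at_left b)" "filterlim u0 at_top (at_right (-b))"
      using psi_at_top[OF \<gamma>(1) D(1) w0(1) pos(1) asym(1)] psi_at_top[OF \<gamma>(2) D(2) w0(2) pos(2) asym(2)] by auto
    \<comment> \<open>One exponent for both ends: at least 1 as \<open>psi_growth\<close> requires,
      and at least \<open>\<gamma>p\<close> and \<open>\<gamma>m\<close>.\<close>
    define \<nu> where "\<nu> = max 1 (max \<gamma>p \<gamma>m)"
    have \<nu>: "\<nu> > 0" "1 \<le> \<nu>" "\<gamma>p \<le> \<nu>" "\<gamma>m \<le> \<nu>" by (auto simp: \<nu>_def)
    obtain u where u: "viscosity_solution b f g u0 u"
      using exist[OF u0 top \<nu>(1) psi_growth[OF \<gamma>(1) \<nu>(3,2) D(1) near(1) asym(1)] psi_growth[OF \<gamma>(2) \<nu>(4,2) D(2) near(2) asym(2)]]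
      by blast
    obtain m where m: "\<And>x. -b < x \<Longrightarrow> x < b \<Longrightarrow> m \<le> u0 x" using coercive_bounded_below[OF assms(1) u0 top] by blast
    have ordered: "real_of_ereal (upper_env b v z) \<le> real_of_ereal (lower_env b w z)"
      if v: "viscosity_solution b f g u0 v" and w: "viscosity_solution b f g u0 w" and z: "z \<in> Q0 b" for v w z
    proof (rule sub_le_super[OF viscosity_solutionD(1,2,5)[OF v] viscosity_solutionD(3,4,6)[OF w] assms(2-4,7,8) decay assms(9,1) u0 _ _ m \<gamma> D asym z])
      fix t :: real assume t: "t \<ge> 0"
      \<comment> \<open>A super-solution blows up laterally for \<open>t > 0\<close> by definition.
        At \<open>t = 0\<close> the lower envelope equals \<open>u0\<close>, which blows up by its
        expansion.\<close>
      have ev: "\<forall>\<^sub>F x in at_left b. real_of_ereal (lower_env b w (x, 0)) = u0 x"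
        "\<forall>\<^sub>F x in at_right (-b). real_of_ereal (lower_env b w (x, 0)) = u0 x"
      proof -
        show "\<forall>\<^sub>F x in at_left b. real_of_ereal (lower_env b w (x, 0)) = u0 x"
          unfolding eventually_at_left_field
          by (rule exI[of _ "-b"]) (use assms(1) viscosity_solutionD(6)[OF w] in auto)
        show "\<forall>\<^sub>F x in at_right (-b). real_of_ereal (lower_env b w (x, 0)) = u0 x"
          unfolding eventually_at_right_field
          by (rule exI[of _ b]) (use assms(1) viscosity_solutionD(6)[OF w] in auto)
      qed
      show "filterlim (\<lambda>x. real_of_ereal (lower_env b w (x, t))) at_top (at_left b)"
      proof (cases "t = 0")
        case True
        show ?thesis unfolding True by (rule filterlim_cong[THEN iffD2, OF refl refl ev(1) top(1)])
      qed (use t viscosity_solutionD(7)[OF w, of t] in simp)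
      show "filterlim (\<lambda>x. real_of_ereal (lower_env b w (x, t))) at_top (at_right (-b))"
      proof (cases "t = 0")
        case True
        show ?thesis unfolding True by (rule filterlim_cong[THEN iffD2, OF refl refl ev(2) top(2)])
      qed (use t viscosity_solutionD(8)[OF w, of t] in simp)
    qed
    \<comment> \<open>With the ordering in both directions, \<open>v\<close>, its upper envelope,
      the lower and the upper envelope of \<open>u\<close>, the lower envelope of \<open>v\<close>,
      and \<open>v\<close> again form an increasing chain, so all are equal. The case
      \<open>v = u\<close> gives continuity.\<close>
    have eq: "v z = real_of_ereal (upper_env b u z)" "v z = real_of_ereal (lower_env b u z)"
      if v: "viscosity_solution b f g u0 v" and z: "z \<in> Q0 b" for v z
      using ordered[OF u v z] ordered[OF v u z] ordered[OF u u z] viscosity_solutionD(9,10)[OF v z] viscosity_solutionD(9,10)[OF u z]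
      by linarith+
    have "usc_on (Q0 b) u" 
      by (rule usc_on_cong[THEN iffD2, OF _ viscosity_solutionD(2)[OF u]]) (rule eq(1)[OF u])
    moreover have "usc_on (Q0 b) (\<lambda>z. - u z)"
      by (rule usc_on_cong[THEN iffD2, OF _ viscosity_solutionD(4)[OF u]]) (rule arg_cong[OF eq(2)[OF u]])
    ultimately have "continuous_on (Q0 b) u" by (rule continuous_on_usc_lsc)
    moreover have "\<forall>v. viscosity_solution b f g u0 v \<longrightarrow> (\<forall>z \<in> Q0 b. v z = u z)"
      using eq(1) eq(1)[OF u] by simp
    ultimately show "\<exists>u. viscosity_solution b f g u0 u \<and> continuous_on (Q0 b) u \<and>
        (\<forall>v. viscosity_solution b f g u0 v \<longrightarrow> (\<forall>z \<in> Q0 b. v z = u z))" using u by blast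
  }
qed

end
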